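(* Assume that $A,C_1,C_2\in\mathcal L^\infty(0,T;\mathbb R^{n\times n})$, $B\in\mathcal L^\infty(0,T;\mathbb R^{n\times m})$, $H,N_1,N_2\in\mathcal L^\infty(0,T;\mathbb S^n_+)$, $R\in\mathcal L^\infty(0,T;\widehat{\mathbb S}^m_+)$, $G\in\mathbb S^n_+$, and let $\zeta\in\mathcal L^2_{\mathcal F_T}(\Omega;\mathbb R^n)$. If $(X^*,Y^*,Z_1^*,Z_2^*,v^* )$ is an adapted solution to the stochastic Hamiltonian system $$\left\{\begin{aligned} &dY=\left(AY+Bv+C_1Z_1+C_2Z_2\right)dt+Z_1dW_1+Z_2dW_2,\\ &dX=-\left(A^\top X+HY\right)dt-\left(C_1^\top X+N_1Z_1\right)dW_1-\left(C_2^\top X+N_2Z_2\right)dW_2,\\ &Y_T=\zeta,\qquad X_0=-GY_0,\\ &\mathbb E[R_tv_t+B_t^\top X_t\,|\,\mathcal F^{W_1}_t]=0, \end{aligned}\right.$$ then $v^*$ is an optimal control of Problem BLQ, i.e. $v^*\in\mathcal V_{ad}[0,T]$ and $J(v^* )=\inf_{v\in\mathcal V_{ad}[0,T]}J(v)$.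
   Context: Probability setting: $T>0$ is fixed, $(\Omega,\mathcal F,\mathbb F,\mathbb P)$ is a complete filtered probability space carrying a standard $\mathbb R^2$-valued Wiener process $(W_1,W_2)$ on $[0,T]$, and $\mathbb F=\{\mathcal F_t\}$ is the natural filtration of $(W_1,W_2)$ augmented by all $\mathbb P$-null sets. $\mathcal F^{W_1}_t=\sigma\{W_{1s}:0\le s\le t\}$. Spaces: $\mathbb S^n_+$ is the set of symmetric positive semidefinite $n\times n$ matrices; $\mathcal L^\infty(0,T;M)$ is the set of bounded (measurable, deterministic) functions $[0,T]\to M$; $R\in\mathcal L^\infty(0,T;\widehat{\mathbb S}^m_+)$ means that $R$ is bounded, symmetric and uniformly positive definite ($R_t\ge\delta I$ for some $\delta>0$ and all $t$). $\mathcal L^2_{\mathcal F_T}(\Omega;M)$ is the set of square-integrable $\mathcal F_T$-measurable $M$-valued random variables; $\mathcal L^2_{\mathcal F}(0,T;M)$ is the set of $\mathbb F$-adapted $M$-valued processes $u$ with $\mathbb E\int_0^T|u_t|^2dt<\infty$; $\mathcal S^2_{\mathcal F}(0,T;M)$ is the set of continuous $\mathbb F$-adapted processes $u$ with $\mathbb E[\sup_{t\in[0,T]}|u_t|^2]<\infty$. Admissible controls: $\mathcal V_{ad}[0,T]$ is the set of $\mathbb R^m$-valued $\{\mathcal F^{W_1}_t\}$-adapted processes $v$ with $\mathbb E\int_0^T|v_t|^2dt<\infty$. State and cost: for $v\in\mathcal V_{ad}[0,T]$ the state $(Y,Z_1,Z_2)\in\mathcal S^2_{\mathcal F}(0,T;\mathbb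 R^n)\times\mathcal L^2_{\mathcal F}(0,T;\mathbb R^n)\times\mathcal L^2_{\mathcal F}(0,T;\mathbb R^n)$ is the unique solution of the backward stochastic differential equation (BSDE) $$dY_t=(A_tY_t+B_tv_t+C_{1t}Z_{1t}+C_{2t}Z_{2t})dt+Z_{1t}dW_{1t}+Z_{2t}dW_{2t},\quad Y_T=\zeta,$$ and the cost is $$J(v)=\tfrac12\mathbb E\Big[Y_0^\top GY_0+\int_0^T\big(Y_t^\top H_tY_t+v_t^\top R_tv_t+Z_{1t}^\top N_{1t}Z_{1t}+Z_{2t}^\top N_{2t}Z_{2t}\big)dt\Big].$$ Problem BLQ: find $v^*\in\mathcal V_{ad}[0,T]$ with $J(v^* )=\inf_{v\in\mathcal V_{ad}[0,T]}J(v)$; such a $v^*$ is called an optimal control. An adapted solution of the Hamiltonian system is a tuple $(X,Y,Z_1,Z_2,v)$ with $X,Y\in\mathcal S^2_{\mathcal F}(0,T;\mathbb R^n)$, $Z_1,Z_2\in\mathcal L^2_{\mathcal F}(0,T;\mathbb R^n)$, $v\in\mathcal V_{ad}[0,T]$ satisfying all its relations (the last one for a.e. $t\in[0,T]$, $\mathbb P$-a.s.). Time arguments are suppressed in the equations. *)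

theory Defs
  imports "HOL-Probability.Probability"
begin

section \<open>Coefficients\<close>

definition psd :: "real^'n^'n \<Rightarrow> bool" where
  "psd S \<longleftrightarrow> transpose S = S \<and> (\<forall>x. 0 \<le> x \<bullet> (S *v x))"

definition Linf :: "real \<Rightarrow> (real \<Rightarrow> 'b::euclidean_space) set" where
  "Linf T = {f \<in> borel_measurable (restrict_space borel {0..T}).
      \<exists>K. \<forall>t\<in>{0..T}. norm (f t) \<le> K}"

definition Linf_psd :: "real \<Rightarrow> (real \<Rightarrow> real^'n^'n) set" where
  "Linf_psd T = {f \<in> Linf T. \<forall>t\<in>{0..T}. psd (f t)}"

text \<open>Uniformly positive definite: \<open>f t \<ge> \<delta> I\<close> in the Loewner order, where \<open>mat \<delta> = \<delta> I\<close>.\<close>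

definition Linf_upd :: "real \<Rightarrow> (real \<Rightarrow> real^'n^'n) set" where
  "Linf_upd T = {f \<in> Linf T. (\<forall>t\<in>{0..T}. transpose (f t) = f t) \<and>
      (\<exists>\<delta>>0. \<forall>t\<in>{0..T}. psd (f t - mat \<delta>))}"


section \<open>Filtrations and the Wiener process\<close>

text \<open>\<open>\<W>\<close> is the set of processes generating the filtration.\<close>

definition natural_filtration ::
    "'a measure \<Rightarrow> (real \<Rightarrow> 'a \<Rightarrow> real) set \<Rightarrow> real \<Rightarrow> 'a measure" where
  "natural_filtration M \<W> t =
     sigma (space M) {W s -` A \<inter> space M | W s A. W \<in> \<W> \<and> s \<in> {0..t} \<and> A \<in> sets borel}"

definition augmented_filtration ::
    "'a measure \<Rightarrow> (real \<Rightarrow> 'a \<Rightarrow> real) set \<Rightarrow> real \<Rightarrow> 'a measure" where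
  "augmented_filtration M \<W> t =
     sigma (space M) (sets (natural_filtration M \<W> t) \<union> null_sets M)"

text \<open>Standard two-dimensional Wiener process on \<open>[0,T]\<close>: the increment over \<open>[s,t]\<close> has law
  \<open>N(0, (t - s) I)\<close> and is independent of the path up to time \<open>s\<close>.\<close>

definition wiener_process2 ::
    "'a measure \<Rightarrow> real \<Rightarrow> (real \<Rightarrow> 'a \<Rightarrow> real) \<Rightarrow> (real \<Rightarrow> 'a \<Rightarrow> real) \<Rightarrow> bool" where
  "wiener_process2 M T W1 W2 \<longleftrightarrow>
     (\<forall>W\<in>{W1, W2}.
        (\<forall>t\<in>{0..T}. W t \<in> borel_measurable M) \<and>
        (AE \<omega> in M. W 0 \<omega> = 0) \<and>
        (AE \<omega> in M. continuous_on {0..T} (\<lambda>t. W t \<omega>)) \<and>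
        (\<forall>s t. 0 \<le> s \<and> s < t \<and> t \<le> T \<longrightarrow>
           distributed M lborel (\<lambda>\<omega>. W t \<omega> - W s \<omega>) (normal_density 0 (sqrt (t - s))))) \<and>
     (\<forall>s t. 0 \<le> s \<and> s < t \<and> t \<le> T \<longrightarrow>
        prob_space.indep_var M borel (\<lambda>\<omega>. W1 t \<omega> - W1 s \<omega>) borel (\<lambda>\<omega>. W2 t \<omega> - W2 s \<omega>) \<and>
        prob_space.indep_set M
          (sets (natural_filtration M {W1, W2} s))
          (sets (vimage_algebra (space M) (\<lambda>\<omega>. (W1 t \<omega> - W1 s \<omega>, W2 t \<omega> - W2 s \<omega>)) borel)))"


section \<open>Spaces of random variables and processes\<close>

text \<open>In these definitions \<open>F\<close> is a filtration and \<open>Ft\<close> a single sub-\<open>\<sigma>\<close>-algebra.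
  Only the values of a process at times in \<open>[0,T]\<close> matter.\<close>

definition L2_rv :: "'a measure \<Rightarrow> 'a measure \<Rightarrow> ('a \<Rightarrow> 'b::euclidean_space) set" where
  "L2_rv M Ft = {\<xi> \<in> borel_measurable Ft. (\<integral>\<^sup>+ \<omega>. ennreal ((norm (\<xi> \<omega>))\<^sup>2) \<partial>M) < \<infinity>}"

definition adapted ::
    "(real \<Rightarrow> 'a measure) \<Rightarrow> real \<Rightarrow> (real \<Rightarrow> 'a \<Rightarrow> 'b::euclidean_space) \<Rightarrow> bool" where
  "adapted F T u \<longleftrightarrow> (\<forall>t\<in>{0..T}. u t \<in> borel_measurable (F t))"

definition L2_proc ::
    "'a measure \<Rightarrow> (real \<Rightarrow> 'a measure) \<Rightarrow> real \<Rightarrow> (real \<Rightarrow> 'a \<Rightarrow> 'b::euclidean_space) set" where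
  "L2_proc M F T = {u.
      (\<lambda>(t, \<omega>). u t \<omega>) \<in> borel_measurable (restrict_space borel {0..T} \<Otimes>\<^sub>M M) \<and>
      adapted F T u \<and>
      (\<integral>\<^sup>+ \<omega>. (\<integral>\<^sup>+ t\<in>{0..T}. ennreal ((norm (u t \<omega>))\<^sup>2) \<partial>lborel) \<partial>M) < \<infinity>}"

definition S2_proc ::
    "'a measure \<Rightarrow> (real \<Rightarrow> 'a measure) \<Rightarrow> real \<Rightarrow> (real \<Rightarrow> 'a \<Rightarrow> 'b::euclidean_space) set" where
  "S2_proc M F T = {u.
      (\<forall>\<omega>\<in>space M. continuous_on {0..T} (\<lambda>t. u t \<omega>)) \<and>
      adapted F T u \<and>
      (\<integral>\<^sup>+ \<omega>. (SUP t\<in>{0..T}. ennreal ((norm (u t \<omega>))\<^sup>2)) \<partial>M) < \<infinity>}"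

definition cond_exp_vec :: "'a measure \<Rightarrow> 'a measure \<Rightarrow> ('a \<Rightarrow> real^'m) \<Rightarrow> 'a \<Rightarrow> real^'m" where
  "cond_exp_vec M Ft f \<omega> = (\<chi> i. real_cond_exp M Ft (\<lambda>\<omega>'. f \<omega>' $ i) \<omega>)"


section \<open>The Ito integral\<close>

text \<open>A simple process \<open>\<Sum>i<k. \<xi> i * 1_(p i, p (i+1)]\<close> is given by its number of steps \<open>k\<close>, its
  partition points \<open>p\<close> and its bounded coefficients \<open>\<xi>\<close>, with \<open>\<xi> i\<close> measurable at time \<open>p i\<close>.\<close>

definition simple_data ::
    "'a measure \<Rightarrow> (real \<Rightarrow> 'a measure) \<Rightarrow> real \<Rightarrow> nat \<Rightarrow> (nat \<Rightarrow> real) \<Rightarrow>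
     (nat \<Rightarrow> 'a \<Rightarrow> 'b::euclidean_space) \<Rightarrow> bool" where
  "simple_data M F T k p \<xi> \<longleftrightarrow>
     0 \<le> p 0 \<and> (\<forall>i<k. p i \<le> p (Suc i)) \<and> p k \<le> T \<and>
     (\<forall>i<k. \<xi> i \<in> borel_measurable (F (p i)) \<and> (\<exists>K. \<forall>\<omega>\<in>space M. norm (\<xi> i \<omega>) \<le> K))"

definition simple_process ::
    "nat \<Rightarrow> (nat \<Rightarrow> real) \<Rightarrow> (nat \<Rightarrow> 'a \<Rightarrow> 'b::euclidean_space) \<Rightarrow> real \<Rightarrow> 'a \<Rightarrow> 'b" where
  "simple_process k p \<xi> t \<omega> = (\<Sum>i<k. indicator {p i<..p (Suc i)} t *\<^sub>R \<xi> i \<omega>)"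

definition simple_integral ::
    "(real \<Rightarrow> 'a \<Rightarrow> real) \<Rightarrow> nat \<Rightarrow> (nat \<Rightarrow> real) \<Rightarrow> (nat \<Rightarrow> 'a \<Rightarrow> 'b::euclidean_space) \<Rightarrow>
     real \<Rightarrow> 'a \<Rightarrow> 'b" where
  "simple_integral W k p \<xi> t \<omega> =
     (\<Sum>i<k. (W (min (p (Suc i)) t) \<omega> - W (min (p i) t) \<omega>) *\<^sub>R \<xi> i \<omega>)"

text \<open>\<open>has_ito_integral M F T W u t I\<close>: the random variable \<open>I\<close> is (a version of) the Ito integral
  of \<open>u\<close> against \<open>W\<close> over \<open>[0,t]\<close>, i.e. the \<open>L\<^sup>2\<close>-limit of the integrals of simple processes
  converging to \<open>u\<close> in \<open>L\<^sup>2\<close> on \<open>[0,t] \<times> \<Omega>\<close>. It is determined up to almost sure equality.\<close>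

definition has_ito_integral ::
    "'a measure \<Rightarrow> (real \<Rightarrow> 'a measure) \<Rightarrow> real \<Rightarrow> (real \<Rightarrow> 'a \<Rightarrow> real) \<Rightarrow>
     (real \<Rightarrow> 'a \<Rightarrow> 'b::euclidean_space) \<Rightarrow> real \<Rightarrow> ('a \<Rightarrow> 'b) \<Rightarrow> bool" where
  "has_ito_integral M F T W u t I \<longleftrightarrow>
     u \<in> L2_proc M F T \<and> I \<in> borel_measurable M \<and>
     (\<exists>k p \<xi>. (\<forall>j. simple_data M F T (k j) (p j) (\<xi> j)) \<and>
        (\<lambda>j. \<integral>\<^sup>+ \<omega>. (\<integral>\<^sup>+ s\<in>{0..t}.
            ennreal ((norm (u s \<omega> - simple_process (k j) (p j) (\<xi> j) s \<omega>))\<^sup>2) \<partial>lborel) \<partial>M)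
          \<longlonglongrightarrow> 0 \<and>
        (\<lambda>j. \<integral>\<^sup>+ \<omega>.
            ennreal ((norm (I \<omega> - simple_integral W (k j) (p j) (\<xi> j) t \<omega>))\<^sup>2) \<partial>M)
          \<longlonglongrightarrow> 0)"

text \<open>\<open>dU = b dt + \<sigma>1 dW1 + \<sigma>2 dW2\<close> on \<open>[0,T]\<close>, in integrated form.\<close>

definition ito_differential ::
    "'a measure \<Rightarrow> (real \<Rightarrow> 'a measure) \<Rightarrow> real \<Rightarrow>
     (real \<Rightarrow> 'a \<Rightarrow> real) \<Rightarrow> (real \<Rightarrow> 'a \<Rightarrow> real) \<Rightarrow>
     (real \<Rightarrow> 'a \<Rightarrow> 'b::euclidean_space) \<Rightarrow>
     (real \<Rightarrow> 'a \<Rightarrow> 'b) \<Rightarrow> (real \<Rightarrow> 'a \<Rightarrow> 'b) \<Rightarrow> (real \<Rightarrow> 'a \<Rightarrow> 'b) \<Rightarrow> bool" where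
  "ito_differential M F T W1 W2 U b \<sigma>1 \<sigma>2 \<longleftrightarrow>
     (AE \<omega> in M. set_integrable lborel {0..T} (\<lambda>s. b s \<omega>)) \<and>
     (\<forall>t\<in>{0..T}. \<exists>I1 I2.
        has_ito_integral M F T W1 \<sigma>1 t I1 \<and> has_ito_integral M F T W2 \<sigma>2 t I2 \<and>
        (AE \<omega> in M. U t \<omega> = U 0 \<omega> + (LINT s:{0..t}|lborel. b s \<omega>) + I1 \<omega> + I2 \<omega>))"


section \<open>The backward linear-quadratic control problem\<close>

definition Vad ::
    "'a measure \<Rightarrow> real \<Rightarrow> (real \<Rightarrow> 'a \<Rightarrow> real) \<Rightarrow> (real \<Rightarrow> 'a \<Rightarrow> real^'m) set" where
  "Vad M T W1 = L2_proc M (natural_filtration M {W1}) T"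

definition is_state ::
    "'a measure \<Rightarrow> real \<Rightarrow> (real \<Rightarrow> 'a \<Rightarrow> real) \<Rightarrow> (real \<Rightarrow> 'a \<Rightarrow> real) \<Rightarrow>
     (real \<Rightarrow> real^'n^'n) \<Rightarrow> (real \<Rightarrow> real^'m^'n) \<Rightarrow>
     (real \<Rightarrow> real^'n^'n) \<Rightarrow> (real \<Rightarrow> real^'n^'n) \<Rightarrow> ('a \<Rightarrow> real^'n) \<Rightarrow>
     (real \<Rightarrow> 'a \<Rightarrow> real^'m) \<Rightarrow>
     (real \<Rightarrow> 'a \<Rightarrow> real^'n) \<Rightarrow> (real \<Rightarrow> 'a \<Rightarrow> real^'n) \<Rightarrow> (real \<Rightarrow> 'a \<Rightarrow> real^'n) \<Rightarrow> bool" where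
  "is_state M T W1 W2 A B C1 C2 \<zeta> v Y Z1 Z2 \<longleftrightarrow>
     (let F = augmented_filtration M {W1, W2} in
      Y \<in> S2_proc M F T \<and> Z1 \<in> L2_proc M F T \<and> Z2 \<in> L2_proc M F T \<and>
      ito_differential M F T W1 W2 Y
        (\<lambda>t \<omega>. A t *v Y t \<omega> + B t *v v t \<omega> + C1 t *v Z1 t \<omega> + C2 t *v Z2 t \<omega>) Z1 Z2 \<and>
      (AE \<omega> in M. Y T \<omega> = \<zeta> \<omega>))"

definition cost ::
    "'a measure \<Rightarrow> real \<Rightarrow> (real \<Rightarrow> real^'n^'n) \<Rightarrow> (real \<Rightarrow> real^'m^'m) \<Rightarrow>
     (real \<Rightarrow> real^'n^'n) \<Rightarrow> (real \<Rightarrow> real^'n^'n) \<Rightarrow> real^'n^'n \<Rightarrow>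
     (real \<Rightarrow> 'a \<Rightarrow> real^'m) \<Rightarrow>
     (real \<Rightarrow> 'a \<Rightarrow> real^'n) \<Rightarrow> (real \<Rightarrow> 'a \<Rightarrow> real^'n) \<Rightarrow> (real \<Rightarrow> 'a \<Rightarrow> real^'n) \<Rightarrow> real" where
  "cost M T H R N1 N2 G v Y Z1 Z2 =
     1/2 * (LINT \<omega>|M. Y 0 \<omega> \<bullet> (G *v Y 0 \<omega>) +
       (LINT t:{0..T}|lborel.
          Y t \<omega> \<bullet> (H t *v Y t \<omega>) + v t \<omega> \<bullet> (R t *v v t \<omega>) +
          Z1 t \<omega> \<bullet> (N1 t *v Z1 t \<omega>) + Z2 t \<omega> \<bullet> (N2 t *v Z2 t \<omega>)))"

text \<open>The cost functional \<open>J\<close>. The state of an admissible control exists and is unique up to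
  indistinguishability, so \<open>THE\<close> picks the cost of the state of \<open>v\<close>. The value \<open>\<infinity>\<close>
  only makes \<open>J\<close> total: it is the usual convention for a minimisation problem at a \<open>v\<close>
  that has no state, and by well-posedness of the linear BSDE it is not attained on \<open>Vad\<close>.\<close>

definition J ::
    "'a measure \<Rightarrow> real \<Rightarrow> (real \<Rightarrow> 'a \<Rightarrow> real) \<Rightarrow> (real \<Rightarrow> 'a \<Rightarrow> real) \<Rightarrow>
     (real \<Rightarrow> real^'n^'n) \<Rightarrow> (real \<Rightarrow> real^'m^'n) \<Rightarrow>
     (real \<Rightarrow> real^'n^'n) \<Rightarrow> (real \<Rightarrow> real^'n^'n) \<Rightarrow>
     (real \<Rightarrow> real^'n^'n) \<Rightarrow> (real \<Rightarrow> real^'m^'m) \<Rightarrow>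
     (real \<Rightarrow> real^'n^'n) \<Rightarrow> (real \<Rightarrow> real^'n^'n) \<Rightarrow> real^'n^'n \<Rightarrow> ('a \<Rightarrow> real^'n) \<Rightarrow>
     (real \<Rightarrow> 'a \<Rightarrow> real^'m) \<Rightarrow> ereal" where
  "J M T W1 W2 A B C1 C2 H R N1 N2 G \<zeta> v =
     (if \<exists>Y Z1 Z2. is_state M T W1 W2 A B C1 C2 \<zeta> v Y Z1 Z2
      then ereal (THE c. \<exists>Y Z1 Z2. is_state M T W1 W2 A B C1 C2 \<zeta> v Y Z1 Z2 \<and>
                                    c = cost M T H R N1 N2 G v Y Z1 Z2)
      else \<infinity>)"

definition optimal_control ::
    "'a measure \<Rightarrow> real \<Rightarrow> (real \<Rightarrow> 'a \<Rightarrow> real) \<Rightarrow> (real \<Rightarrow> 'a \<Rightarrow> real) \<Rightarrow>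
     (real \<Rightarrow> real^'n^'n) \<Rightarrow> (real \<Rightarrow> real^'m^'n) \<Rightarrow>
     (real \<Rightarrow> real^'n^'n) \<Rightarrow> (real \<Rightarrow> real^'n^'n) \<Rightarrow>
     (real \<Rightarrow> real^'n^'n) \<Rightarrow> (real \<Rightarrow> real^'m^'m) \<Rightarrow>
     (real \<Rightarrow> real^'n^'n) \<Rightarrow> (real \<Rightarrow> real^'n^'n) \<Rightarrow> real^'n^'n \<Rightarrow> ('a \<Rightarrow> real^'n) \<Rightarrow>
     (real \<Rightarrow> 'a \<Rightarrow> real^'m) \<Rightarrow> bool" where
  "optimal_control M T W1 W2 A B C1 C2 H R N1 N2 G \<zeta> v \<longleftrightarrow>
     v \<in> Vad M T W1 \<and>
     J M T W1 W2 A B C1 C2 H R N1 N2 G \<zeta> v =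
       (INF u\<in>Vad M T W1. J M T W1 W2 A B C1 C2 H R N1 N2 G \<zeta> u)"

definition hamiltonian_solution ::
    "'a measure \<Rightarrow> real \<Rightarrow> (real \<Rightarrow> 'a \<Rightarrow> real) \<Rightarrow> (real \<Rightarrow> 'a \<Rightarrow> real) \<Rightarrow>
     (real \<Rightarrow> real^'n^'n) \<Rightarrow> (real \<Rightarrow> real^'m^'n) \<Rightarrow>
     (real \<Rightarrow> real^'n^'n) \<Rightarrow> (real \<Rightarrow> real^'n^'n) \<Rightarrow>
     (real \<Rightarrow> real^'n^'n) \<Rightarrow> (real \<Rightarrow> real^'m^'m) \<Rightarrow>
     (real \<Rightarrow> real^'n^'n) \<Rightarrow> (real \<Rightarrow> real^'n^'n) \<Rightarrow> real^'n^'n \<Rightarrow> ('a \<Rightarrow> real^'n) \<Rightarrow>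
     (real \<Rightarrow> 'a \<Rightarrow> real^'n) \<Rightarrow> (real \<Rightarrow> 'a \<Rightarrow> real^'n) \<Rightarrow>
     (real \<Rightarrow> 'a \<Rightarrow> real^'n) \<Rightarrow> (real \<Rightarrow> 'a \<Rightarrow> real^'n) \<Rightarrow> (real \<Rightarrow> 'a \<Rightarrow> real^'m) \<Rightarrow> bool" where
  "hamiltonian_solution M T W1 W2 A B C1 C2 H R N1 N2 G \<zeta> X Y Z1 Z2 v \<longleftrightarrow>
     (let F = augmented_filtration M {W1, W2} in
      X \<in> S2_proc M F T \<and> Y \<in> S2_proc M F T \<and>
      Z1 \<in> L2_proc M F T \<and> Z2 \<in> L2_proc M F T \<and> v \<in> Vad M T W1 \<and>
      ito_differential M F T W1 W2 Y
        (\<lambda>t \<omega>. A t *v Y t \<omega> + B t *v v t \<omega> + C1 t *v Z1 t \<omega> + C2 t *v Z2 t \<omega>) Z1 Z2 \<and>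
      ito_differential M F T W1 W2 X
        (\<lambda>t \<omega>. - (transpose (A t) *v X t \<omega> + H t *v Y t \<omega>))
        (\<lambda>t \<omega>. - (transpose (C1 t) *v X t \<omega> + N1 t *v Z1 t \<omega>))
        (\<lambda>t \<omega>. - (transpose (C2 t) *v X t \<omega> + N2 t *v Z2 t \<omega>)) \<and>
      (AE \<omega> in M. Y T \<omega> = \<zeta> \<omega>) \<and>
      (AE \<omega> in M. X 0 \<omega> = - (G *v Y 0 \<omega>)) \<and>
      (AE t in lborel. t \<in> {0..T} \<longrightarrow>
        (AE \<omega> in M. cond_exp_vec M (natural_filtration M {W1} t)
           (\<lambda>\<omega>'. R t *v v t \<omega>' + transpose (B t) *v X t \<omega>') \<omega> = 0)))"

end

theory Submission
  imports Defs
begin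

text \<open>Let \<open>(Y', Z1', Z2')\<close> be the state of another admissible control \<open>v'\<close>. Since the cost is a convex
  quadratic functional, \<open>J v' - J v\<close> is at least the first variation of \<open>J\<close> at \<open>v\<close> in the direction
  \<open>v' - v\<close>. Pairing the adjoint process \<open>X\<close> with \<open>Y' - Y\<close> by Ito's product rule in expectation, and using
  \<open>X 0 = - G Y 0\<close> and \<open>Y' T = Y T\<close>, turns this variation into the integral of
  \<open>(R v + B\<^sup>T X) \<bullet> (v' - v)\<close>, which vanishes by the stationarity condition because \<open>v' - v\<close> is adapted
  to \<open>W1\<close>.

  The product rule needs no Ito formula. Splitting both processes into initial value, drift and
  martingale part, every mixed term of \<open>E[U t \<bullet> V t]\<close> follows from the Ito isometry, the martingale
  property and Fubini's theorem. Applied to the difference of two solutions of the backward equation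
  with the same control, it yields uniqueness by Gronwall's lemma, so that \<open>J\<close> is well defined.\<close>

section \<open>Square-integrable functions\<close>

text \<open>The obstacle is how little an Ito integral offers: \<open>has_ito_integral\<close>
  speaks of one fixed time, determines the integral only up to a null set, and its approximating
  simple processes may change with the time. No continuous or even jointly measurable version is at
  hand, so nothing is done pathwise with it. All identities are between expectations at fixed times,
  and the martingale part of a process is handled as what remains of the process after subtracting
  initial value and drift. Adaptedness of a drift density \<open>b\<close> enters through its
  pairing with a martingale part N: under the time integral, E[N t \<bullet> b s] may be replaced by
  E[N s \<bullet> b s] for s \<le> t. Processes are treated as functions on time times \<Omega>
  under a product measure, so that one calculus of square-integrable functions, together with Fubini
  in both orders, serves random variables and processes alike.\<close>

definition sqint :: "'a measure \<Rightarrow> ('a \<Rightarrow> 'b::euclidean_space) \<Rightarrow> bool" where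
  "sqint N f \<longleftrightarrow> f \<in> borel_measurable N \<and> integrable N (\<lambda>x. (norm (f x))\<^sup>2)"

lemma sqint_measurable: "sqint N f \<Longrightarrow> f \<in> borel_measurable N"
  by (simp add: sqint_def)

lemma sqint_integrable: "sqint N f \<Longrightarrow> integrable N (\<lambda>x. (norm (f x))\<^sup>2)"
  by (simp add: sqint_def)

lemma sqint_iff_nn_integral:
  "sqint N f \<longleftrightarrow> f \<in> borel_measurable N \<and> (\<integral>\<^sup>+x. ennreal ((norm (f x))\<^sup>2) \<partial>N) < \<infinity>"
  by (auto simp: sqint_def integrable_iff_bounded)

text \<open>The outer \<open>norm\<close> on the right absorbs the sign of \<open>K\<close>, so
  callers may pass any bound. The functions \<open>f\<close> and \<open>g\<close> may take values in
  different spaces.\<close>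

lemma sqint_mono:
  assumes "f \<in> borel_measurable N" "sqint N g" "AE x in N. norm (f x) \<le> norm (K * norm (g x))"
  shows "sqint N f"
  unfolding sqint_def
proof
  show "integrable N (\<lambda>x. (norm (f x))\<^sup>2)"
  proof (rule Bochner_Integration.integrable_bound)
    show "integrable N (\<lambda>x. K\<^sup>2 * (norm (g x))\<^sup>2)"
      using assms(2) by (auto simp: sqint_def)
    show "AE x in N. norm ((norm (f x))\<^sup>2) \<le> norm (K\<^sup>2 * (norm (g x))\<^sup>2)"
      using assms(3)
    proof eventually_elim
      case (elim x)
      then have "(norm (f x))\<^sup>2 \<le> (norm (K * norm (g x)))\<^sup>2"
        by (intro power_mono) auto
      then show ?case by (simp add: power_mult_distrib)
    qed
  qed (use assms(1) in simp)
qed (use assms(1) in simp)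

lemma parallelogram_identity:
  fixes a b :: "'b::real_inner"
  shows "(norm (a + b))\<^sup>2 + (norm (a - b))\<^sup>2 = 2 * (norm a)\<^sup>2 + 2 * (norm b)\<^sup>2"
  unfolding power2_norm_eq_inner
  by (simp add: inner_add_left inner_add_right inner_diff_left inner_diff_right)

text \<open>Dropping |a - b|^2 from the parallelogram identity dominates |a + b|^2 by 2|a|^2 +
  2|b|^2.\<close>

lemma sqint_add:
  assumes "sqint N f" "sqint N g"
  shows "sqint N (\<lambda>x. f x + g x)"
  unfolding sqint_def
proof
  show m: "(\<lambda>x. f x + g x) \<in> borel_measurable N"
    using assms by (auto simp: sqint_def)
  have *: "(norm (a + b))\<^sup>2 \<le> 2 * (norm a)\<^sup>2 + 2 * (norm b)\<^sup>2" for a b :: 'b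
    using parallelogram_identity[of a b] zero_le_power2[of "norm (a - b)"] by linarith
  show "integrable N (\<lambda>x. (norm (f x + g x))\<^sup>2)"
  proof (rule Bochner_Integration.integrable_bound)
    show "integrable N (\<lambda>x. 2 * (norm (f x))\<^sup>2 + 2 * (norm (g x))\<^sup>2)"
      using assms by (auto simp: sqint_def)
    show "AE x in N. norm ((norm (f x + g x))\<^sup>2) \<le> norm (2 * (norm (f x))\<^sup>2 + 2 * (norm (g x))\<^sup>2)"
      by (rule AE_I2) (simp add: *)
  qed (use m in simp)
qed

lemma sqint_uminus: "sqint N f \<Longrightarrow> sqint N (\<lambda>x. - f x)"
  by (auto simp: sqint_def)

lemma sqint_diff: "sqint N f \<Longrightarrow> sqint N g \<Longrightarrow> sqint N (\<lambda>x. f x - g x)"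
  using sqint_add[of N f "\<lambda>x. - g x"] by (simp add: sqint_uminus)

lemma sqint_zero: "sqint N (\<lambda>x. 0)"
  by (simp add: sqint_def)

lemma sqint_sum: "(\<And>i. i \<in> I \<Longrightarrow> sqint N (f i)) \<Longrightarrow> sqint N (\<lambda>x. \<Sum>i\<in>I. f i x)"
  by (induction I rule: infinite_finite_induct) (auto simp: sqint_zero intro!: sqint_add)

lemma (in finite_measure) sqint_const: "sqint M (\<lambda>x. c)"
  by (simp add: sqint_def)

lemma sqint_inner_integrable:
  assumes "sqint N f" "sqint N g"
  shows "integrable N (\<lambda>x. f x \<bullet> g x)"
proof (rule Bochner_Integration.integrable_bound)
  show "integrable N (\<lambda>x. (norm (f x))\<^sup>2 + (norm (g x))\<^sup>2)"
    using assms by (auto simp: sqint_def)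
  have *: "\<bar>a \<bullet> b\<bar> \<le> (norm a)\<^sup>2 + (norm b)\<^sup>2" for a b :: 'b
  proof -
    have "\<bar>a \<bullet> b\<bar> \<le> norm a * norm b"
      by (rule Cauchy_Schwarz_ineq2)
    moreover have "2 * (norm a * norm b) \<le> (norm a)\<^sup>2 + (norm b)\<^sup>2"
      using sum_squares_bound[of "norm a" "norm b"] by simp
    moreover have "0 \<le> norm a * norm b" by simp
    ultimately show ?thesis by linarith
  qed
  show "AE x in N. norm (f x \<bullet> g x) \<le> norm ((norm (f x))\<^sup>2 + (norm (g x))\<^sup>2)"
    by (rule AE_I2) (simp add: *)
qed (use assms in \<open>auto simp: sqint_def\<close>)

text \<open>On a finite measure the constant 1 is integrable, and |a| \<le> 1 + |a|^2 follows from
  (|a| - 1)^2 \<ge> 0.\<close>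

lemma (in finite_measure) sqint_imp_integrable:
  fixes f :: "'a \<Rightarrow> 'b::euclidean_space"
  assumes "sqint M f"
  shows "integrable M f"
proof (rule Bochner_Integration.integrable_bound)
  show "integrable M (\<lambda>x. 1 + (norm (f x))\<^sup>2)"
    using assms by (auto simp: sqint_def)
  have *: "norm a \<le> 1 + (norm a)\<^sup>2" for a :: 'b
    using zero_le_power2[of "norm a - 1"] norm_ge_zero[of a] unfolding power2_diff one_power2 mult_1_right by linarith
  show "AE x in M. norm (f x) \<le> norm (1 + (norm (f x))\<^sup>2)"
    by (rule AE_I2) (simp add: *)
qed (use assms in \<open>auto simp: sqint_def\<close>)

text \<open>Evaluation at the minimiser \<open>b / c\<close> gives the claim. This is the algebra
  behind Cauchy-Schwarz, with \<open>a\<close>, \<open>b\<close>, \<open>c\<close> the integrals of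
  |f|^2, f \<bullet> g and |g|^2.\<close>

lemma quadratic_nonneg_imp_discriminant:
  fixes a b c :: real
  assumes nn: "\<And>r. 0 \<le> a - 2 * r * b + r\<^sup>2 * c" and "0 \<le> c"
  shows "b\<^sup>2 \<le> a * c"
proof (cases "c = 0")
  case True
  have "b = 0"
  proof (rule ccontr)
    assume "b \<noteq> 0"
    \<comment> \<open>With \<open>c = 0\<close> the polynomial is affine in \<open>r\<close>, and at
      this \<open>r\<close> it equals -1.\<close>
    then show False using nn[of "(a + 1) / (2 * b)"] True by simp
  qed
  then show ?thesis using True by simp
next
  case False
  then have "c > 0" using assms(2) by simp
  moreover have "a - 2 * (b / c) * b + (b / c)\<^sup>2 * c = a - b\<^sup>2 / c"
    using \<open>c > 0\<close> by (simp add: field_simps power2_eq_square)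
  ultimately have "b\<^sup>2 / c \<le> a" using nn[of "b / c"] by linarith
  then show ?thesis using \<open>c > 0\<close> by (simp add: pos_divide_le_eq)
qed

lemma sqint_Cauchy_Schwarz:
  assumes f: "sqint N f" and g: "sqint N g"
  shows "\<bar>\<integral>x. f x \<bullet> g x \<partial>N\<bar> \<le> sqrt (\<integral>x. (norm (f x))\<^sup>2 \<partial>N) * sqrt (\<integral>x. (norm (g x))\<^sup>2 \<partial>N)"
proof -
  have "(\<integral>x. f x \<bullet> g x \<partial>N)\<^sup>2 \<le> (\<integral>x. (norm (f x))\<^sup>2 \<partial>N) * (\<integral>x. (norm (g x))\<^sup>2 \<partial>N)"
  proof (rule quadratic_nonneg_imp_discriminant)
    fix r
    have "0 \<le> (\<integral>x. (norm (f x - r *\<^sub>R g x))\<^sup>2 \<partial>N)"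
      by simp
    also have "\<dots> = (\<integral>x. (norm (f x))\<^sup>2 - 2 * r * (f x \<bullet> g x) + r\<^sup>2 * (norm (g x))\<^sup>2 \<partial>N)"
      by (intro Bochner_Integration.integral_cong refl, unfold power2_norm_eq_inner)
        (simp add: inner_diff_left inner_diff_right inner_commute algebra_simps power2_eq_square)
    also have "\<dots> = (\<integral>x. (norm (f x))\<^sup>2 \<partial>N) - 2 * r * (\<integral>x. f x \<bullet> g x \<partial>N) + r\<^sup>2 * (\<integral>x. (norm (g x))\<^sup>2 \<partial>N)"
      using f g sqint_inner_integrable[OF f g] by (simp add: sqint_def)
    finally show "0 \<le> (\<integral>x. (norm (f x))\<^sup>2 \<partial>N) - 2 * r * (\<integral>x. f x \<bullet> g x \<partial>N) + r\<^sup>2 * (\<integral>x. (norm (g x))\<^sup>2 \<partial>N)" .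
  qed simp
  then show ?thesis
    by (metis real_sqrt_abs real_sqrt_le_mono real_sqrt_mult)
qed

section \<open>Convergence in mean square\<close>

definition L2lim :: "'a measure \<Rightarrow> (nat \<Rightarrow> 'a \<Rightarrow> 'b::euclidean_space) \<Rightarrow> ('a \<Rightarrow> 'b) \<Rightarrow> bool" where
  "L2lim N f g \<longleftrightarrow> (\<forall>j. sqint N (f j)) \<and> sqint N g \<and>
     (\<lambda>j. \<integral>x. (norm (f j x - g x))\<^sup>2 \<partial>N) \<longlonglongrightarrow> 0"

lemma L2lim_const: "sqint N f \<Longrightarrow> L2lim N (\<lambda>j. f) f"
  by (simp add: L2lim_def)

text \<open>Continuity of the inner product in mean square. It carries the isometry and the
  martingale property from simple processes over to Ito integrals.\<close>

lemma L2lim_inner: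
  assumes f: "L2lim N f f0" and g: "L2lim N g g0"
  shows "(\<lambda>j. \<integral>x. f j x \<bullet> g j x \<partial>N) \<longlonglongrightarrow> (\<integral>x. f0 x \<bullet> g0 x \<partial>N)"
proof (rule LIM_zero_cancel, rule tendsto_rabs_zero_cancel)
  let ?n = "\<lambda>h. sqrt (\<integral>x. (norm (h x))\<^sup>2 \<partial>N)"
  let ?df = "\<lambda>j x. f j x - f0 x" and ?dg = "\<lambda>j x. g j x - g0 x"
  have sq [intro]: "sqint N (f j)" "sqint N f0" "sqint N (g j)" "sqint N g0" for j
    using f g by (auto simp: L2lim_def)
  have sqd: "sqint N (?df j)" "sqint N (?dg j)" for j
    by (intro sqint_diff sq)+
  have lim: "(\<lambda>j. ?n (?df j)) \<longlonglongrightarrow> 0" "(\<lambda>j. ?n (?dg j)) \<longlonglongrightarrow> 0"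
    using f g tendsto_real_sqrt[of _ 0] by (auto simp: L2lim_def)
  have bd: "\<bar>(\<integral>x. f j x \<bullet> g j x \<partial>N) - (\<integral>x. f0 x \<bullet> g0 x \<partial>N)\<bar>
      \<le> ?n (?df j) * ?n (?dg j) + ?n (?df j) * ?n g0 + ?n f0 * ?n (?dg j)" for j
  proof -
    have "(\<integral>x. f j x \<bullet> g j x \<partial>N) - (\<integral>x. f0 x \<bullet> g0 x \<partial>N)
        = (\<integral>x. f j x \<bullet> g j x - f0 x \<bullet> g0 x \<partial>N)"
      by (subst Bochner_Integration.integral_diff) (auto intro!: sqint_inner_integrable)
    \<comment> \<open>Bilinear expansion around the limits; Cauchy-Schwarz then makes each of the
      three terms small.\<close>
    also have "\<dots> = (\<integral>x. ?df j x \<bullet> ?dg j x + ?df j x \<bullet> g0 x + f0 x \<bullet> ?dg j x \<partial>N)"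
      by (intro Bochner_Integration.integral_cong refl) (simp add: inner_diff_left inner_diff_right)
    also have "\<dots> = (\<integral>x. ?df j x \<bullet> ?dg j x \<partial>N) + (\<integral>x. ?df j x \<bullet> g0 x \<partial>N) + (\<integral>x. f0 x \<bullet> ?dg j x \<partial>N)"
      by (subst Bochner_Integration.integral_add Bochner_Integration.integral_add,
          (intro Bochner_Integration.integrable_add sqint_inner_integrable sqd sq)+)+ simp
    finally show ?thesis
      using sqint_Cauchy_Schwarz[OF sqd(1)[of j] sqd(2)[of j]]
        sqint_Cauchy_Schwarz[OF sqd(1)[of j] sq(4)] sqint_Cauchy_Schwarz[OF sq(2) sqd(2)[of j]]
      by linarith
  qed
  have "(\<lambda>j. ?n (?df j) * ?n (?dg j) + ?n (?df j) * ?n g0 + ?n f0 * ?n (?dg j)) \<longlonglongrightarrow> 0 * 0 + 0 * ?n g0 + ?n f0 * 0"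
    by (intro tendsto_intros lim)
  then have lim0: "(\<lambda>j. ?n (?df j) * ?n (?dg j) + ?n (?df j) * ?n g0 + ?n f0 * ?n (?dg j)) \<longlonglongrightarrow> 0"
    by simp
  show "(\<lambda>j. \<bar>(\<integral>x. f j x \<bullet> g j x \<partial>N) - (\<integral>x. f0 x \<bullet> g0 x \<partial>N)\<bar>) \<longlonglongrightarrow> 0"
    by (rule tendsto_sandwich[OF _ _ tendsto_const[of 0] lim0]) (use bd in auto)
qed

text \<open>Bridge from the extended-valued convergence in \<open>has_ito_integral\<close>, where
  the limit is not known in advance to be square integrable: one term at finite distance from
  \<open>g\<close> makes \<open>g\<close> square integrable, and from then on nonnegative and
  Bochner integrals agree.\<close>

lemma L2limI_nn_integral:
  assumes f: "\<And>j. sqint N (f j)" and g: "g \<in> borel_measurable N"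
    and lim: "(\<lambda>j. \<integral>\<^sup>+x. ennreal ((norm (g x - f j x))\<^sup>2) \<partial>N) \<longlonglongrightarrow> 0"
  shows "L2lim N f g"
proof -
  have "eventually (\<lambda>j. (\<integral>\<^sup>+x. ennreal ((norm (g x - f j x))\<^sup>2) \<partial>N) < 1) sequentially"
    using lim by (rule order_tendstoD) simp
  then obtain j where j: "(\<integral>\<^sup>+x. ennreal ((norm (g x - f j x))\<^sup>2) \<partial>N) < 1"
    by (auto simp: eventually_sequentially)
  have "sqint N (\<lambda>x. g x - f j x)"
    using j f[of j] g by (auto simp: sqint_iff_nn_integral intro: less_trans[OF _ ennreal_one_less_top])
  from sqint_add[OF this f[of j]] have sg: "sqint N g" by simp
  have "(\<integral>\<^sup>+x. ennreal ((norm (g x - f j x))\<^sup>2) \<partial>N) = ennreal (\<integral>x. (norm (f j x - g x))\<^sup>2 \<partial>N)" for j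
    using sqint_diff[OF sg f[of j]]
    by (subst nn_integral_eq_integral) (auto simp: sqint_def norm_minus_commute)
  then have "(\<lambda>j. ennreal (\<integral>x. (norm (f j x - g x))\<^sup>2 \<partial>N)) \<longlonglongrightarrow> ennreal 0"
    using lim by simp
  then have "(\<lambda>j. \<integral>x. (norm (f j x - g x))\<^sup>2 \<partial>N) \<longlonglongrightarrow> 0"
    by (subst (asm) tendsto_ennreal_iff) auto
  then show ?thesis using f sg by (simp add: L2lim_def)
qed

text \<open>The parallelogram identity around the common limit bounds the distance of the two
  sequences. It serves to compare two approximations of the same integrand.\<close>

lemma L2lim_dist:
  assumes f: "L2lim N f f0" and g: "L2lim N g f0"
  shows "(\<lambda>j. \<integral>x. (norm (f j x - g j x))\<^sup>2 \<partial>N) \<longlonglongrightarrow> 0"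
proof (rule tendsto_sandwich[OF _ _ tendsto_const])
  have sq: "sqint N (\<lambda>x. f j x - f0 x)" "sqint N (\<lambda>x. g j x - f0 x)"
    "sqint N (\<lambda>x. f j x - g j x)" for j
    using f g by (auto simp: L2lim_def intro!: sqint_diff)
  have *: "(norm (a - b))\<^sup>2 \<le> 2 * (norm (a - c))\<^sup>2 + 2 * (norm (b - c))\<^sup>2" for a b c :: 'b
    using parallelogram_identity[of "a - c" "b - c"] zero_le_power2[of "norm ((a - c) + (b - c))"]
    unfolding diff_diff_eq2 diff_add_cancel by linarith
  show "\<forall>\<^sub>F j in sequentially. (\<integral>x. (norm (f j x - g j x))\<^sup>2 \<partial>N)
      \<le> 2 * (\<integral>x. (norm (f j x - f0 x))\<^sup>2 \<partial>N) + 2 * (\<integral>x. (norm (g j x - f0 x))\<^sup>2 \<partial>N)"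
  proof (intro always_eventually allI)
    fix j
    have "(\<integral>x. (norm (f j x - g j x))\<^sup>2 \<partial>N)
      \<le> (\<integral>x. 2 * (norm (f j x - f0 x))\<^sup>2 + 2 * (norm (g j x - f0 x))\<^sup>2 \<partial>N)"
      using sq[of j] by (intro integral_mono *) (auto simp: sqint_def)
    then show "(\<integral>x. (norm (f j x - g j x))\<^sup>2 \<partial>N)
      \<le> 2 * (\<integral>x. (norm (f j x - f0 x))\<^sup>2 \<partial>N) + 2 * (\<integral>x. (norm (g j x - f0 x))\<^sup>2 \<partial>N)"
      using sq[of j] by (simp add: sqint_def)
  qed
  have "(\<lambda>j. 2 * (\<integral>x. (norm (f j x - f0 x))\<^sup>2 \<partial>N) + 2 * (\<integral>x. (norm (g j x - f0 x))\<^sup>2 \<partial>N))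
      \<longlonglongrightarrow> 2 * 0 + 2 * 0"
    using f g by (intro tendsto_intros) (auto simp: L2lim_def)
  then show "(\<lambda>j. 2 * (\<integral>x. (norm (f j x - f0 x))\<^sup>2 \<partial>N) + 2 * (\<integral>x. (norm (g j x - f0 x))\<^sup>2 \<partial>N))
      \<longlonglongrightarrow> 0" by simp
qed auto

text \<open>The l1 norm bounds the Euclidean norm and each component is a scalar product with a row,
  hence the crude constant \<open>CARD('m)\<close>. Bilinearity supplies both the continuity behind
  measurability and the bounds for products with coefficients.\<close>

lemma bounded_bilinear_matrix_vector_mult: "bounded_bilinear ((*v) :: real^'n^'m \<Rightarrow> _)"
proof
  show "\<exists>K. \<forall>(A::real^'n^'m) x. norm (A *v x) \<le> norm A * norm x * K"
  proof (intro exI allI)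
    fix A :: "real^'n^'m" and x
    have "norm (A *v x) \<le> (\<Sum>i\<in>UNIV. \<bar>(A *v x) $ i\<bar>)"
      by (rule norm_le_l1_cart)
    also have "\<dots> \<le> (\<Sum>i::'m\<in>UNIV. norm A * norm x)"
    proof (rule sum_mono)
      fix i :: 'm
      have "\<bar>(A *v x) $ i\<bar> = \<bar>(A $ i) \<bullet> x\<bar>"
        by (simp add: matrix_vector_mul_component)
      also have "\<dots> \<le> norm (A $ i) * norm x"
        by (rule Cauchy_Schwarz_ineq2)
      also have "\<dots> \<le> norm A * norm x"
        by (intro mult_right_mono Finite_Cartesian_Product.norm_nth_le) auto
      finally show "\<bar>(A *v x) $ i\<bar> \<le> norm A * norm x" .
    qed
    finally show "norm (A *v x) \<le> norm A * norm x * real CARD('m)"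
      by (simp add: mult.commute)
  qed
qed (auto simp: matrix_vector_mult_add_rdistrib matrix_vector_right_distrib
    scaleR_matrix_vector_assoc matrix_vector_mult_scaleR)

section \<open>Wiener increments\<close>

locale wiener = prob_space M for M :: "'a measure" +
  fixes T :: real and W1 W2 :: "real \<Rightarrow> 'a \<Rightarrow> real"
  assumes T_pos: "T > 0" and wiener: "wiener_process2 M T W1 W2"
begin

abbreviation F :: "real \<Rightarrow> 'a measure" where
  "F \<equiv> augmented_filtration M {W1, W2}"

text \<open>Boolean indexing lets one statement treat equal and different components at once, with
  \<open>of_bool (i = j)\<close> as Kronecker delta.\<close>

definition Wn :: "bool \<Rightarrow> real \<Rightarrow> 'a \<Rightarrow> real" where
  "Wn i = (if i then W2 else W1)"

lemma Wn_in: "Wn i \<in> {W1, W2}"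
  by (simp add: Wn_def)

lemma measurable_Wn: "t \<in> {0..T} \<Longrightarrow> Wn i t \<in> borel_measurable M"
  using wiener Wn_in[of i] unfolding wiener_process2_def by blast

section \<open>The natural and the augmented filtration\<close>

lemma space_natural: "space (natural_filtration M \<W> t) = space M"
  unfolding natural_filtration_def by (rule space_measure_of) auto

lemma sets_natural:
  "sets (natural_filtration M \<W> t) = sigma_sets (space M)
     {W s -` A \<inter> space M | W s A. W \<in> \<W> \<and> s \<in> {0..t} \<and> A \<in> sets borel}"
  unfolding natural_filtration_def by (rule sets_measure_of) auto

lemma natural_mono:
  assumes "\<W> \<subseteq> \<V>" "s \<le> t"
  shows "sets (natural_filtration M \<W> s) \<subseteq> sets (natural_filtration M \<V> t)"
  unfolding sets_natural
proof (rule sigma_sets_mono', safe)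
  fix W r A assume "W \<in> \<W>" "r \<in> {0..s}" "A \<in> sets (borel :: real measure)"
  then show "\<exists>W' r' A'. W r -` A \<inter> space M = W' r' -` A' \<inter> space M \<and> W' \<in> \<V> \<and> r' \<in> {0..t} \<and>
      A' \<in> sets (borel :: real measure)"
    using assms by (intro exI[of _ W] exI[of _ r] exI[of _ A]) auto
qed

lemma sets_natural_subset:
  assumes "t \<in> {0..T}" "\<W> \<subseteq> {W1, W2}"
  shows "sets (natural_filtration M \<W> t) \<subseteq> sets M"
  unfolding sets_natural
proof (rule sets.sigma_sets_subset, safe)
  fix W s A assume "W \<in> \<W>" "s \<in> {0..t}" "A \<in> sets (borel :: real measure)"
  then have "W s \<in> borel_measurable M"
    using assms measurable_Wn[of s False] measurable_Wn[of s True] by (auto simp: Wn_def)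
  then show "W s -` A \<inter> space M \<in> sets M"
    using \<open>A \<in> sets borel\<close> by (rule measurable_sets)
qed

lemma space_F: "space (F t) = space M"
  unfolding augmented_filtration_def
  by (rule space_measure_of)
    (use sets.space_closed[of "natural_filtration M {W1, W2} t"] sets.space_closed[of M] in
      \<open>auto simp: space_natural\<close>)

lemma sets_F:
  "sets (F t) = sigma_sets (space M) (sets (natural_filtration M {W1, W2} t) \<union> null_sets M)"
  unfolding augmented_filtration_def
  by (rule sets_measure_of)
    (use sets.space_closed[of "natural_filtration M {W1, W2} t"] sets.space_closed[of M] in
      \<open>auto simp: space_natural\<close>)

lemma F_mono: "s \<le> t \<Longrightarrow> sets (F s) \<subseteq> sets (F t)"
  unfolding sets_F using natural_mono[of "{W1, W2}" "{W1, W2}" s t] by (intro sigma_sets_mono') auto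

lemma sets_F_subset: "t \<in> {0..T} \<Longrightarrow> sets (F t) \<subseteq> sets M"
  unfolding sets_F using sets_natural_subset[of t "{W1, W2}"] by (intro sets.sigma_sets_subset) auto

lemma measurable_F_mono: "f \<in> measurable (F s) N \<Longrightarrow> s \<le> t \<Longrightarrow> f \<in> measurable (F t) N"
  using F_mono[of s t] by (auto simp: measurable_def space_F)

lemma measurable_F_M: "f \<in> measurable (F t) N \<Longrightarrow> t \<in> {0..T} \<Longrightarrow> f \<in> measurable M N"
  using sets_F_subset[of t] by (auto simp: measurable_def space_F)

lemma measurable_natural_F:
  assumes "f \<in> measurable (natural_filtration M {W1} t) N"
  shows "f \<in> measurable (F t) N"
proof -
  have "sets (natural_filtration M {W1} t) \<subseteq> sets (F t)"
    using natural_mono[of "{W1}" "{W1, W2}" t t] unfolding sets_F by auto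
  then show ?thesis using assms by (auto simp: measurable_def space_F space_natural)
qed

lemma measurable_Wn_F: "0 \<le> s \<Longrightarrow> s \<le> t \<Longrightarrow> Wn i s \<in> borel_measurable (F t)"
proof (rule measurableI)
  fix A assume "0 \<le> s" "s \<le> t" "A \<in> sets (borel :: real measure)"
  then have "Wn i s -` A \<inter> space M \<in> sets (natural_filtration M {W1, W2} t)"
    unfolding sets_natural using Wn_in[of i] by (intro sigma_sets.Basic) auto
  then show "Wn i s -` A \<inter> space (F t) \<in> sets (F t)"
    unfolding space_F sets_F by (intro sigma_sets.Basic) auto
qed simp

text \<open>The definition of \<open>wiener_process2\<close> gives independence from the natural
  filtration only. Adjoining the null sets keeps the product formula, since both sides vanish on
  them, and keeps a system stable under intersection; the generated \<sigma>-algebra inherits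
  independence.\<close>

lemma indep_F_increment:
  assumes st: "0 \<le> s" "s < t" "t \<le> T"
  shows "indep_set (sets (F s))
    (sets (vimage_algebra (space M) (\<lambda>\<omega>. (W1 t \<omega> - W1 s \<omega>, W2 t \<omega> - W2 s \<omega>)) borel))"
proof -
  let ?N = "sets (natural_filtration M {W1, W2} s)"
  let ?V = "sets (vimage_algebra (space M) (\<lambda>\<omega>. (W1 t \<omega> - W1 s \<omega>, W2 t \<omega> - W2 s \<omega>)) borel)"
  have ind: "indep_set ?N ?V"
    using wiener st unfolding wiener_process2_def by blast
  have NM: "?N \<subseteq> sets M"
    by (rule indep_setD_ev1[OF ind])
  have VM: "?V \<subseteq> sets M"
    by (rule indep_setD_ev2[OF ind])
  have "indep_set (?N \<union> null_sets M) ?V"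
  proof (rule indep_setI)
    fix a b assume a: "a \<in> ?N \<union> null_sets M" and b: "b \<in> ?V"
    show "prob (a \<inter> b) = prob a * prob b"
    proof (cases "a \<in> ?N")
      case True
      then show ?thesis using indep_setD[OF ind _ b] by simp
    next
      case False
      then have "a \<in> null_sets M" using a by simp
      moreover from this have "a \<inter> b \<in> null_sets M"
        using b VM null_set_Int2[of a M b] by blast
      ultimately show ?thesis by (simp add: measure_eq_0_null_sets)
    qed
  qed (use NM VM in auto)
  moreover have "Int_stable (?N \<union> null_sets M)"
  proof (rule Int_stableI)
    fix a b assume "a \<in> ?N \<union> null_sets M" "b \<in> ?N \<union> null_sets M"
    then show "a \<inter> b \<in> ?N \<union> null_sets M"
      using NM null_set_Int2[of a M b] null_set_Int2[of b M a] by (auto simp: Int_commute)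
  qed
  moreover have "Int_stable ?V" by (rule sets.Int_stable)
  ultimately have "indep_set (sigma_sets (space M) (?N \<union> null_sets M)) (sigma_sets (space M) ?V)"
    by (rule indep_set_sigma_sets)
  moreover have "sigma_sets (space M) ?V = ?V"
    using sets.sigma_sets_eq[of "vimage_algebra (space M) (\<lambda>\<omega>. (W1 t \<omega> - W1 s \<omega>, W2 t \<omega> - W2 s \<omega>)) borel"]
    by simp
  ultimately show ?thesis by (simp add: sets_F)
qed

text \<open>Independence factorises the expectation. The function \<open>g\<close> acts on the pair
  of increments jointly, so that a single increment and a product of two increments are both
  instances.\<close>

lemma indep_increment_integral:
  fixes Q :: "'a \<Rightarrow> real" and g :: "real \<times> real \<Rightarrow> real"
  assumes st: "0 \<le> s" "s < t" "t \<le> T"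
    and Q: "Q \<in> borel_measurable (F s)" "integrable M Q"
    and g: "g \<in> borel_measurable borel"
    and ig: "integrable M (\<lambda>\<omega>. g (W1 t \<omega> - W1 s \<omega>, W2 t \<omega> - W2 s \<omega>))"
  shows "integrable M (\<lambda>\<omega>. Q \<omega> * g (W1 t \<omega> - W1 s \<omega>, W2 t \<omega> - W2 s \<omega>))"
    and "(\<integral>\<omega>. Q \<omega> * g (W1 t \<omega> - W1 s \<omega>, W2 t \<omega> - W2 s \<omega>) \<partial>M)
      = (\<integral>\<omega>. Q \<omega> \<partial>M) * (\<integral>\<omega>. g (W1 t \<omega> - W1 s \<omega>, W2 t \<omega> - W2 s \<omega>) \<partial>M)"
proof -
  let ?d = "\<lambda>\<omega>. (W1 t \<omega> - W1 s \<omega>, W2 t \<omega> - W2 s \<omega>)"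
  have "indep_var borel Q borel (\<lambda>\<omega>. g (?d \<omega>))"
    unfolding indep_var_eq
  proof (intro conjI)
    show QM: "random_variable borel Q" "random_variable borel (\<lambda>\<omega>. g (?d \<omega>))"
      using Q ig by auto
    note ind = indep_F_increment[OF st]
    have 1: "sigma_sets (space M) {Q -` A \<inter> space M |A. A \<in> sets borel} \<subseteq> sets (F s)"
      using measurable_sets[OF Q(1)]
      by (intro sets.sigma_sets_subset[of _ "F s", unfolded space_F]) (auto simp: space_F)
    have 2: "sigma_sets (space M) {(\<lambda>\<omega>. g (?d \<omega>)) -` A \<inter> space M |A. A \<in> sets borel}
        \<subseteq> sets (vimage_algebra (space M) ?d borel)"
    proof (rule sets.sigma_sets_subset[of _ "vimage_algebra (space M) ?d borel", unfolded space_vimage_algebra], safe)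
      fix A assume "A \<in> sets (borel :: real measure)"
      then have "g -` A \<in> sets borel"
        using measurable_sets[OF g] by simp
      then have "?d -` (g -` A) \<inter> space M \<in> sets (vimage_algebra (space M) ?d borel)"
        by (rule in_vimage_algebra)
      moreover have "?d -` (g -` A) \<inter> space M = (\<lambda>\<omega>. g (?d \<omega>)) -` A \<inter> space M" by auto
      ultimately show "(\<lambda>\<omega>. g (?d \<omega>)) -` A \<inter> space M \<in> sets (vimage_algebra (space M) ?d borel)"
        by simp
    qed
    show "indep_set (sigma_sets (space M) {Q -` A \<inter> space M |A. A \<in> sets borel})
      (sigma_sets (space M) {(\<lambda>\<omega>. g (?d \<omega>)) -` A \<inter> space M |A. A \<in> sets borel})"
      using 1 2 indep_setD_ev1[OF ind] indep_setD_ev2[OF ind]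
      by (intro indep_setI indep_setD[OF ind]) auto
  qed
  from indep_var_integrable[OF this Q(2) ig] indep_var_lebesgue_integral[OF this Q(2) ig]
  show "integrable M (\<lambda>\<omega>. Q \<omega> * g (?d \<omega>))"
    "(\<integral>\<omega>. Q \<omega> * g (?d \<omega>) \<partial>M) = (\<integral>\<omega>. Q \<omega> \<partial>M) * (\<integral>\<omega>. g (?d \<omega>) \<partial>M)" by simp_all
qed

section \<open>Moments of Wiener increments\<close>

definition incr :: "bool \<Rightarrow> real \<Rightarrow> real \<Rightarrow> 'a \<Rightarrow> real" where
  "incr i s t \<omega> = Wn i t \<omega> - Wn i s \<omega>"

lemma incr_same [simp]: "incr i s s \<omega> = 0"
  by (simp add: incr_def)

lemma incr_split: "incr i s u \<omega> = incr i s t \<omega> + incr i t u \<omega>"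
  by (simp add: incr_def)

lemma measurable_incr_F: "0 \<le> s \<Longrightarrow> s \<le> t \<Longrightarrow> t \<le> u \<Longrightarrow> incr i s t \<in> borel_measurable (F u)"
  unfolding incr_def[abs_def] by (intro borel_measurable_diff measurable_Wn_F) auto

text \<open>Strict inequality keeps the variance of the normal law positive; later lemmas split off
  the degenerate case \<open>s = t\<close>.\<close>

lemma incr_moments_less:
  assumes st: "0 \<le> s" "s < t" "t \<le> T"
  shows "sqint M (incr i s t)" "(\<integral>\<omega>. incr i s t \<omega> \<partial>M) = 0" "(\<integral>\<omega>. (incr i s t \<omega>)\<^sup>2 \<partial>M) = t - s"
proof -
  have D: "distributed M lborel (incr i s t) (normal_density 0 (sqrt (t - s)))"
    using wiener Wn_in[of i] st unfolding wiener_process2_def incr_def[abs_def] by blast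
  have pos: "0 < sqrt (t - s)" using st by simp
  show mean: "(\<integral>\<omega>. incr i s t \<omega> \<partial>M) = 0"
    by (rule normal_distributed_expectation[OF pos D])
  show "(\<integral>\<omega>. (incr i s t \<omega>)\<^sup>2 \<partial>M) = t - s"
    using normal_distributed_variance[OF pos D] mean st by simp
  have "integrable M (\<lambda>\<omega>. (incr i s t \<omega>)\<^sup>2)"
    using integrable_normal_moment[OF pos, of 0 2] distributed_integrable[OF D, of "\<lambda>x. x\<^sup>2"]
    by simp
  then show "sqint M (incr i s t)"
    using distributed_measurable[OF D] by (simp add: sqint_def)
qed

lemma sqint_incr: "0 \<le> s \<Longrightarrow> s \<le> t \<Longrightarrow> t \<le> T \<Longrightarrow> sqint M (incr i s t)"
  using incr_moments_less(1)[of s t i] sqint_zero by (cases "s = t") (auto simp: incr_def[abs_def])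

lemma incr_cross_moment:
  assumes st: "0 \<le> s" "s \<le> t" "t \<le> T"
  shows "(\<integral>\<omega>. incr i s t \<omega> * incr j s t \<omega> \<partial>M) = of_bool (i = j) * (t - s)"
proof (cases "s = t")
  case False
  then have st': "0 \<le> s" "s < t" "t \<le> T" using st by auto
  show ?thesis
  proof (cases "i = j")
    case True
    then show ?thesis using incr_moments_less(3)[OF st', of j] by (simp add: power2_eq_square)
  next
    case False
    have "indep_var borel (\<lambda>\<omega>. W1 t \<omega> - W1 s \<omega>) borel (\<lambda>\<omega>. W2 t \<omega> - W2 s \<omega>)"
      using wiener st' unfolding wiener_process2_def by blast
    then have iv: "indep_var borel (incr False s t) borel (incr True s t)"
      by (simp add: incr_def[abs_def] Wn_def)
    have "(\<integral>\<omega>. incr False s t \<omega> * incr True s t \<omega> \<partial>M) = 0"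
      using incr_moments_less(2)[OF st'] sqint_imp_integrable[OF incr_moments_less(1)[OF st']]
      by (subst indep_var_lebesgue_integral[OF iv]) auto
    then show ?thesis using False by (cases i; cases j) (auto simp: mult.commute)
  qed
qed simp

text \<open>Conditional mean zero of the increment given \<open>F s\<close>, expressed by testing
  against \<open>Q\<close>.\<close>

lemma integral_mult_incr:
  assumes st: "0 \<le> s" "s \<le> t" "t \<le> T" and Q: "Q \<in> borel_measurable (F s)" "integrable M Q"
  shows "integrable M (\<lambda>\<omega>. Q \<omega> * incr i s t \<omega>)" "(\<integral>\<omega>. Q \<omega> * incr i s t \<omega> \<partial>M) = 0"
proof -
  have "integrable M (\<lambda>\<omega>. Q \<omega> * incr i s t \<omega>) \<and> (\<integral>\<omega>. Q \<omega> * incr i s t \<omega> \<partial>M) = 0"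
  proof (cases "s = t")
    case False
    then have st': "0 \<le> s" "s < t" "t \<le> T" using st by auto
    let ?g = "\<lambda>x::real \<times> real. if i then snd x else fst x"
    have eq: "incr i s t \<omega> = ?g (W1 t \<omega> - W1 s \<omega>, W2 t \<omega> - W2 s \<omega>)" for \<omega>
      by (simp add: incr_def Wn_def)
    have "?g \<in> borel_measurable borel"
      by (cases i) (simp_all add: borel_measurable_continuous_onI continuous_on_fst continuous_on_snd)
    note * = indep_increment_integral[OF st' Q this, folded eq]
    have "integrable M (incr i s t)"
      by (rule sqint_imp_integrable[OF incr_moments_less(1)[OF st']])
    from *[OF this] show ?thesis
      using incr_moments_less(2)[OF st', of i] by simp
  qed simp
  then show "integrable M (\<lambda>\<omega>. Q \<omega> * incr i s t \<omega>)" "(\<integral>\<omega>. Q \<omega> * incr i s t \<omega> \<partial>M) = 0" by auto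
qed

text \<open>Conditional covariance of the two components given \<open>F s\<close>, which is (t - s)
  times the identity, again expressed by testing against \<open>Q\<close>.\<close>

lemma integral_mult_incr_incr_same:
  assumes st: "0 \<le> s" "s \<le> t" "t \<le> T" and Q: "Q \<in> borel_measurable (F s)" "integrable M Q"
  shows "integrable M (\<lambda>\<omega>. Q \<omega> * (incr i s t \<omega> * incr j s t \<omega>))"
    "(\<integral>\<omega>. Q \<omega> * (incr i s t \<omega> * incr j s t \<omega>) \<partial>M) = of_bool (i = j) * (t - s) * (\<integral>\<omega>. Q \<omega> \<partial>M)"
proof -
  have "integrable M (\<lambda>\<omega>. Q \<omega> * (incr i s t \<omega> * incr j s t \<omega>)) \<and>
    (\<integral>\<omega>. Q \<omega> * (incr i s t \<omega> * incr j s t \<omega>) \<partial>M) = of_bool (i = j) * (t - s) * (\<integral>\<omega>. Q \<omega> \<partial>M)"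
  proof (cases "s = t")
    case False
    then have st': "0 \<le> s" "s < t" "t \<le> T" using st by auto
    let ?p = "\<lambda>k (x::real \<times> real). if k then snd x else fst x"
    let ?g = "\<lambda>x. ?p i x * ?p j x"
    have eq: "incr i s t \<omega> * incr j s t \<omega> = ?g (W1 t \<omega> - W1 s \<omega>, W2 t \<omega> - W2 s \<omega>)" for \<omega>
      by (simp add: incr_def Wn_def)
    have "?g \<in> borel_measurable borel"
      by (cases i; cases j; intro borel_measurable_times) (simp_all add: borel_measurable_continuous_onI continuous_on_fst continuous_on_snd)
    note * = indep_increment_integral[OF st' Q this, folded eq]
    have "integrable M (\<lambda>\<omega>. incr i s t \<omega> * incr j s t \<omega>)"
      using sqint_inner_integrable[OF sqint_incr[OF st, of i] sqint_incr[OF st, of j]] by simp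
    from *[OF this] show ?thesis
      using incr_cross_moment[OF st, of i j] by (simp add: mult.commute)
  qed simp
  then show "integrable M (\<lambda>\<omega>. Q \<omega> * (incr i s t \<omega> * incr j s t \<omega>))"
    "(\<integral>\<omega>. Q \<omega> * (incr i s t \<omega> * incr j s t \<omega>) \<partial>M) = of_bool (i = j) * (t - s) * (\<integral>\<omega>. Q \<omega> \<partial>M)"
    by auto
qed

lemma integrable_bounded_mult:
  fixes q f :: "'a \<Rightarrow> real"
  assumes "q \<in> borel_measurable M" "\<And>\<omega>. \<omega> \<in> space M \<Longrightarrow> \<bar>q \<omega>\<bar> \<le> K" "integrable M f"
  shows "integrable M (\<lambda>\<omega>. q \<omega> * f \<omega>)"
proof (rule Bochner_Integration.integrable_bound)
  show "integrable M (\<lambda>\<omega>. K * f \<omega>)" using assms(3) by simp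
  show "AE \<omega> in M. norm (q \<omega> * f \<omega>) \<le> norm (K * f \<omega>)"
  proof (rule AE_I2)
    fix \<omega> assume "\<omega> \<in> space M"
    then have "\<bar>q \<omega>\<bar> \<le> \<bar>K\<bar>" using assms(2)[of \<omega>] by linarith
    then show "norm (q \<omega> * f \<omega>) \<le> norm (K * f \<omega>)"
      by (simp add: abs_mult mult_right_mono)
  qed
qed (use assms(1,3) in measurable)

text \<open>The longer increment is split at \<open>b\<close>: over [c,b] the two share both
  endpoints, and the increment over [b,d] is orthogonal to the remaining factor, which is known at
  time \<open>b\<close>.\<close>

lemma integral_mult_incr_incr_left_le:
  fixes q :: "'a \<Rightarrow> real"
  assumes st: "0 \<le> c" "c \<le> b" "b \<le> d" "d \<le> T"
    and q: "q \<in> borel_measurable (F c)" "\<And>\<omega>. \<omega> \<in> space M \<Longrightarrow> \<bar>q \<omega>\<bar> \<le> K"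
  shows "(\<integral>\<omega>. q \<omega> * (incr i c b \<omega> * incr j c d \<omega>) \<partial>M) = of_bool (i = j) * (b - c) * (\<integral>\<omega>. q \<omega> \<partial>M)"
proof -
  have qM: "q \<in> borel_measurable M" using q(1) st by (intro measurable_F_M[of q c]) auto
  have iq: "integrable M q"
    using integrable_bounded_mult[OF qM q(2), of "\<lambda>_. 1"] by simp
  have i1: "integrable M (\<lambda>\<omega>. q \<omega> * incr i c b \<omega>)"
    using st by (intro integrable_bounded_mult[OF qM q(2)] sqint_imp_integrable sqint_incr) auto
  have m1: "(\<lambda>\<omega>. q \<omega> * incr i c b \<omega>) \<in> borel_measurable (F b)"
    using st by (intro borel_measurable_times measurable_F_mono[OF q(1)] measurable_incr_F) auto
  have "(\<integral>\<omega>. q \<omega> * (incr i c b \<omega> * incr j c d \<omega>) \<partial>M)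
      = (\<integral>\<omega>. q \<omega> * (incr i c b \<omega> * incr j c b \<omega>) + (q \<omega> * incr i c b \<omega>) * incr j b d \<omega> \<partial>M)"
    by (simp add: incr_split[of j c d _ b] algebra_simps)
  also have "\<dots> = of_bool (i = j) * (b - c) * (\<integral>\<omega>. q \<omega> \<partial>M)"
    using integral_mult_incr_incr_same[OF st(1,2) _ q(1) iq, of i j]
      integral_mult_incr[OF _ st(3,4) m1 i1] st
    by simp
  finally show ?thesis .
qed

text \<open>The factor \<open>max 0 (min b d - max a c)\<close> is the length of the overlap of the
  two intervals. The weight \<open>q\<close> is known only at the later left end, because it will be
  the inner product of the coefficients of two steps.\<close>

lemma integral_mult_incr_incr:
  fixes q :: "'a \<Rightarrow> real"
  assumes ab: "0 \<le> a" "a \<le> b" "b \<le> T" and cd: "0 \<le> c" "c \<le> d" "d \<le> T"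
    and q: "q \<in> borel_measurable (F (max a c))" "\<And>\<omega>. \<omega> \<in> space M \<Longrightarrow> \<bar>q \<omega>\<bar> \<le> K"
  shows "(\<integral>\<omega>. q \<omega> * (incr i a b \<omega> * incr j c d \<omega>) \<partial>M)
    = of_bool (i = j) * max 0 (min b d - max a c) * (\<integral>\<omega>. q \<omega> \<partial>M)"
proof -
  \<comment> \<open>The case in which [c,d] starts last; the other case is its mirror image. The
    increment over [a,b] is cut at \<open>c\<close>, and only the piece after \<open>c\<close>
    contributes.\<close>
  have main: "(\<integral>\<omega>. q \<omega> * (incr i a b \<omega> * incr j c d \<omega>) \<partial>M)
      = of_bool (i = j) * max 0 (min b d - c) * (\<integral>\<omega>. q \<omega> \<partial>M)"
    if ab: "0 \<le> a" "a \<le> b" "b \<le> T" and cd: "0 \<le> c" "c \<le> d" "d \<le> T" and ac: "a \<le> c"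
      and q: "q \<in> borel_measurable (F c)" "\<And>\<omega>. \<omega> \<in> space M \<Longrightarrow> \<bar>q \<omega>\<bar> \<le> K"
    for i j a b c d and q :: "'a \<Rightarrow> real"
  proof -
    have qM: "q \<in> borel_measurable M" using q(1) cd by (intro measurable_F_M[of q c]) auto
    \<comment> \<open>A piece [a,e] that ends by time \<open>c\<close> is known at \<open>c\<close>,
      so the later increment annihilates it in expectation. This is used with \<open>e = b\<close>
      if there is no overlap and with \<open>e = c\<close> for the cut.\<close>
    have 0: "integrable M (\<lambda>\<omega>. (q \<omega> * incr i a e \<omega>) * incr j c d \<omega>)"
      "(\<integral>\<omega>. (q \<omega> * incr i a e \<omega>) * incr j c d \<omega> \<partial>M) = 0"
      if "a \<le> e" "e \<le> c" for e
    proof -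
      have "integrable M (\<lambda>\<omega>. q \<omega> * incr i a e \<omega>)"
        using that ab cd by (intro integrable_bounded_mult[OF qM q(2)] sqint_imp_integrable sqint_incr) auto
      moreover have "(\<lambda>\<omega>. q \<omega> * incr i a e \<omega>) \<in> borel_measurable (F c)"
        using that ab by (intro borel_measurable_times q(1) measurable_incr_F) auto
      ultimately show "integrable M (\<lambda>\<omega>. (q \<omega> * incr i a e \<omega>) * incr j c d \<omega>)"
        "(\<integral>\<omega>. (q \<omega> * incr i a e \<omega>) * incr j c d \<omega> \<partial>M) = 0"
        using integral_mult_incr[OF cd] by blast+
    qed
    show ?thesis
    proof (cases "b \<le> c")
      case True
      then show ?thesis using 0(2)[OF ab(2) True] by (simp add: mult.assoc)
    next
      case False
      have i2: "integrable M (\<lambda>\<omega>. q \<omega> * (incr i c b \<omega> * incr j c d \<omega>))"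
        using sqint_inner_integrable[OF sqint_incr[of c b i] sqint_incr[OF cd, of j]] False ab cd
        by (intro integrable_bounded_mult[OF qM q(2)]) auto
      have *: "(\<integral>\<omega>. q \<omega> * (incr i c b \<omega> * incr j c d \<omega>) \<partial>M)
          = of_bool (i = j) * (min b d - c) * (\<integral>\<omega>. q \<omega> \<partial>M)"
      proof (cases "b \<le> d")
        case True
        then show ?thesis
          using integral_mult_incr_incr_left_le[OF cd(1) _ True cd(3) q, of i j] False by simp
      next
        case False
        then show ?thesis
          using integral_mult_incr_incr_left_le[OF cd(1,2) _ ab(3) q, of j i]
          by (simp add: mult.commute[of "incr i c b _"] eq_commute[of i j])
      qed
      have "(\<integral>\<omega>. q \<omega> * (incr i a b \<omega> * incr j c d \<omega>) \<partial>M)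
        = (\<integral>\<omega>. (q \<omega> * incr i a c \<omega>) * incr j c d \<omega> + q \<omega> * (incr i c b \<omega> * incr j c d \<omega>) \<partial>M)"
        by (simp add: incr_split[of i a b _ c] algebra_simps)
      also have "\<dots> = of_bool (i = j) * (min b d - c) * (\<integral>\<omega>. q \<omega> \<partial>M)"
        using 0[OF ac] i2 * by simp
      finally show ?thesis using False cd by simp
    qed
  qed
  show ?thesis
  proof (cases "a \<le> c")
    case True
    then show ?thesis using main[OF ab cd True _ q(2)] q(1) by (simp add: max_def)
  next
    case False
    then have "(\<integral>\<omega>. q \<omega> * (incr j c d \<omega> * incr i a b \<omega>) \<partial>M)
        = of_bool (j = i) * max 0 (min d b - a) * (\<integral>\<omega>. q \<omega> \<partial>M)"
      using q(1) by (intro main[OF cd ab _ _ q(2)]) (auto simp: max_def)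
    then show ?thesis using False
      by (simp add: max_def min.commute eq_commute[of j i] mult.commute[of "incr j c d _"])
  qed
qed

section \<open>The product measure on time and probability space\<close>

text \<open>Lebesgue measure on [0,t] times the probability. It is encoded as a restriction of
  \<open>lborel \<Otimes>\<^sub>M M\<close>, so that the Fubini theorems for that product apply
  after multiplication by an indicator, and so that different time horizons are restrictions of each
  other.\<close>

definition P :: "real \<Rightarrow> (real \<times> 'a) measure" where
  "P t = restrict_space (lborel \<Otimes>\<^sub>M M) ({0..t} \<times> space M)"

lemma sets_P_region [simp, measurable]: "{0..t::real} \<times> space M \<in> sets (lborel \<Otimes>\<^sub>M M)"
  by (intro pair_measureI) auto

lemma P_region_Int: "({0..t::real} \<times> space M) \<inter> space (lborel \<Otimes>\<^sub>M M) \<in> sets (lborel \<Otimes>\<^sub>M M)"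
  by (rule sets.Int_space_eq2[THEN ssubst]) auto

lemma space_P: "space (P t) = {0..t} \<times> space M"
  unfolding P_def by (auto simp: space_restrict_space space_pair_measure)

lemma indicator_P:
  "\<omega> \<in> space M \<Longrightarrow> indicator ({0..t} \<times> space M) (s, \<omega>) = (indicator {0..t} s :: 'b::zero_neq_one)"
  by (auto simp: indicator_def)

lemma measurable_P_fst: "fst \<in> measurable (P t) lborel"
  unfolding P_def by (intro measurable_restrict_space1) measurable

lemma measurable_P_snd: "snd \<in> measurable (P t) M"
  unfolding P_def by (intro measurable_restrict_space1) measurable

lemma measurable_P_of_pair:
  assumes "f \<in> measurable (restrict_space borel {0..T} \<Otimes>\<^sub>M M) N" "t \<le> T"
  shows "f \<in> measurable (P t) N"
proof -
  have 1: "fst \<in> measurable (P t) (restrict_space borel {0..T})"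
    using measurable_P_fst[of t] assms(2)
    by (intro measurable_restrict_space2) (auto simp: space_P)
  have "(\<lambda>x. (fst x, snd x)) \<in> measurable (P t) (restrict_space borel {0..T} \<Otimes>\<^sub>M M)"
    by (intro measurable_Pair 1 measurable_P_snd)
  from measurable_compose[OF this assms(1)] show ?thesis by simp
qed

lemma nn_integral_P:
  assumes "f \<in> borel_measurable (P t)"
  shows "(\<integral>\<^sup>+x. f x \<partial>P t) = (\<integral>\<^sup>+\<omega>. (\<integral>\<^sup>+s\<in>{0..t}. f (s, \<omega>) \<partial>lborel) \<partial>M)"
proof -
  interpret pair_sigma_finite lborel M ..
  have m: "(\<lambda>x. f x * indicator ({0..t} \<times> space M) x) \<in> borel_measurable (lborel \<Otimes>\<^sub>M M)"
    using assms unfolding P_def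
    by (subst (asm) borel_measurable_restrict_space_iff_ennreal[OF P_region_Int])
  have "(\<integral>\<^sup>+x. f x \<partial>P t) = (\<integral>\<^sup>+x. f x * indicator ({0..t} \<times> space M) x \<partial>(lborel \<Otimes>\<^sub>M M))"
    unfolding P_def by (rule nn_integral_restrict_space[OF P_region_Int])
  also have "\<dots> = (\<integral>\<^sup>+\<omega>. (\<integral>\<^sup>+s. f (s, \<omega>) * indicator ({0..t} \<times> space M) (s, \<omega>) \<partial>lborel) \<partial>M)"
    by (rule nn_integral_snd[symmetric, OF m])
  also have "\<dots> = (\<integral>\<^sup>+\<omega>. (\<integral>\<^sup>+s\<in>{0..t}. f (s, \<omega>) \<partial>lborel) \<partial>M)"
    by (intro nn_integral_cong) (simp add: indicator_P)
  finally show ?thesis .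
qed

lemma finite_measure_P: "finite_measure (P t)"
proof
  have "emeasure (P t) (space (P t)) = (\<integral>\<^sup>+\<omega>. (\<integral>\<^sup>+s\<in>{0..t}. 1 \<partial>lborel) \<partial>M)"
    using nn_integral_P[of "\<lambda>_. 1" t] by simp
  also have "\<dots> \<noteq> \<infinity>" by (simp add: emeasure_space_1 emeasure_lborel_Icc_eq)
  finally show "emeasure (P t) (space (P t)) \<noteq> \<infinity>" .
qed

text \<open>Fubini in both orders. With \<open>\<omega>\<close> outside it connects with drifts and
  the cost, which are time integrals along paths; with \<open>s\<close> outside it connects with the
  martingale property and the stationarity condition, which speak of fixed times. Sections are
  integrable almost everywhere only.\<close>

lemma
  fixes f :: "real \<times> 'a \<Rightarrow> 'b::{banach, second_countable_topology}"
  assumes f: "integrable (P t) f"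
  shows P_AE_integrable_time: "AE \<omega> in M. set_integrable lborel {0..t} (\<lambda>s. f (s, \<omega>))"
    and P_integrable_time: "integrable M (\<lambda>\<omega>. LINT s:{0..t}|lborel. f (s, \<omega>))"
    and P_integral_time: "(\<integral>x. f x \<partial>P t) = (\<integral>\<omega>. (LINT s:{0..t}|lborel. f (s, \<omega>)) \<partial>M)"
    and P_AE_integrable_omega: "AE s in lborel. s \<in> {0..t} \<longrightarrow> integrable M (\<lambda>\<omega>. f (s, \<omega>))"
    and P_integrable_omega: "set_integrable lborel {0..t} (\<lambda>s. \<integral>\<omega>. f (s, \<omega>) \<partial>M)"
    and P_integral_omega: "(\<integral>x. f x \<partial>P t) = (LINT s:{0..t}|lborel. (\<integral>\<omega>. f (s, \<omega>) \<partial>M))"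
proof -
  interpret pair_sigma_finite lborel M ..
  let ?g = "\<lambda>s \<omega>. indicator ({0..t} \<times> space M) (s, \<omega>) *\<^sub>R f (s, \<omega>)"
  have g: "integrable (lborel \<Otimes>\<^sub>M M) (case_prod ?g)"
    using f unfolding P_def by (subst (asm) integrable_restrict_space[OF P_region_Int]) (simp add: case_prod_unfold)
  have I: "(\<integral>x. f x \<partial>P t) = integral\<^sup>L (lborel \<Otimes>\<^sub>M M) (case_prod ?g)"
    unfolding P_def by (subst integral_restrict_space[OF P_region_Int]) (simp add: case_prod_unfold)
  have ind: "(\<integral>s. ?g s \<omega> \<partial>lborel) = (LINT s:{0..t}|lborel. f (s, \<omega>))" if "\<omega> \<in> space M" for \<omega>
    using that by (simp add: indicator_P set_lebesgue_integral_def)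
  show "AE \<omega> in M. set_integrable lborel {0..t} (\<lambda>s. f (s, \<omega>))"
    using AE_integrable_snd[OF g] AE_space
    by eventually_elim (simp add: indicator_P set_integrable_def)
  show "integrable M (\<lambda>\<omega>. LINT s:{0..t}|lborel. f (s, \<omega>))"
    using integrable_snd[OF g] by (subst Bochner_Integration.integrable_cong[OF refl ind[symmetric]])
  show "(\<integral>x. f x \<partial>P t) = (\<integral>\<omega>. (LINT s:{0..t}|lborel. f (s, \<omega>)) \<partial>M)"
    unfolding I integral_snd[OF g, symmetric]
    by (intro Bochner_Integration.integral_cong refl ind)
  have indo: "(\<integral>\<omega>. ?g s \<omega> \<partial>M) = indicator {0..t} s *\<^sub>R (\<integral>\<omega>. f (s, \<omega>) \<partial>M)" for s
  proof -
    have "(\<integral>\<omega>. ?g s \<omega> \<partial>M) = (\<integral>\<omega>. indicator {0..t} s *\<^sub>R f (s, \<omega>) \<partial>M)"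
      by (intro Bochner_Integration.integral_cong refl) (simp add: indicator_P)
    then show ?thesis by simp
  qed
  show "AE s in lborel. s \<in> {0..t} \<longrightarrow> integrable M (\<lambda>\<omega>. f (s, \<omega>))"
    using AE_integrable_fst[OF g]
  proof eventually_elim
    case (elim s)
    have "integrable M (\<lambda>\<omega>. indicator {0..t} s *\<^sub>R f (s, \<omega>))"
      using elim by (subst Bochner_Integration.integrable_cong[OF refl, of M _ "?g s"]) (auto simp: indicator_P)
    then show ?case by auto
  qed
  show "set_integrable lborel {0..t} (\<lambda>s. \<integral>\<omega>. f (s, \<omega>) \<partial>M)"
    using integrable_fst[OF g] unfolding indo set_integrable_def .
  show "(\<integral>x. f x \<partial>P t) = (LINT s:{0..t}|lborel. (\<integral>\<omega>. f (s, \<omega>) \<partial>M))"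
    unfolding I integral_fst[OF g, symmetric] indo set_lebesgue_integral_def ..
qed

lemma P_restrict: "s \<le> t \<Longrightarrow> P s = restrict_space (P t) ({0..s} \<times> space M)"
  unfolding P_def
  by (subst restrict_restrict_space[OF P_region_Int P_region_Int]) (auto intro!: arg_cong2[where f = restrict_space])

lemma P_region_sub: "({0..s} \<times> space M) \<inter> space (P t) \<in> sets (P t)"
  unfolding P_def by (subst sets_restrict_space_iff[OF P_region_Int]) (auto simp: space_restrict_space)

lemma integrable_P_mono:
  fixes f :: "real \<times> 'a \<Rightarrow> 'b::{banach, second_countable_topology}"
  assumes "s \<le> t" "integrable (P t) f"
  shows "integrable (P s) f"
proof -
  have "{0..s} \<times> space M \<in> sets (P t)"
    using P_region_sub[of s t] assms(1) by (simp add: space_P Times_Int_Times min_def)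
  from integrable_mult_indicator[OF this assms(2)] show ?thesis
    unfolding P_restrict[OF assms(1)] by (subst integrable_restrict_space[OF P_region_sub])
qed

lemma integral_P_mono:
  fixes f :: "real \<times> 'a \<Rightarrow> 'b::{banach, second_countable_topology}"
  assumes "s \<le> t"
  shows "(\<integral>x. f x \<partial>P s) = (\<integral>x. indicator ({0..s} \<times> space M) x *\<^sub>R f x \<partial>P t)"
  unfolding P_restrict[OF assms] by (rule integral_restrict_space[OF P_region_sub])

lemma measurable_P_mono:
  assumes "s \<le> t" "f \<in> measurable (P t) N"
  shows "f \<in> measurable (P s) N"
  unfolding P_restrict[OF assms(1)] using assms(2) by (rule measurable_restrict_space1)

lemma sqint_P_mono: "s \<le> t \<Longrightarrow> sqint (P t) f \<Longrightarrow> sqint (P s) f"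
  unfolding sqint_def using measurable_P_mono integrable_P_mono by blast

text \<open>The time side of the isometry: the overlap of two steps, cut off at \<open>t\<close>.
  Nonnegative left ends make the lower cut at 0 void.\<close>

lemma set_lebesgue_integral_interval_overlap:
  fixes a b c d t :: real
  shows "set_integrable lborel {0..t} (\<lambda>s. indicator {a<..b} s * indicator {c<..d} s :: real)"
    and "0 \<le> a \<Longrightarrow> 0 \<le> c \<Longrightarrow>
      (LINT s:{0..t}|lborel. indicator {a<..b} s * indicator {c<..d} s)
      = max 0 (min t (min b d) - max a c)"
proof -
  have eq: "indicator {0..t} s *\<^sub>R (indicator {a<..b} s * indicator {c<..d} s :: real)
      = indicator ({0..t} \<inter> {max a c<..min b d}) s" for s
    by (auto simp: indicator_def)
  show "set_integrable lborel {0..t} (\<lambda>s. indicator {a<..b} s * indicator {c<..d} s :: real)"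
    unfolding set_integrable_def eq
  proof (rule integrable_real_indicator)
    have "emeasure lborel ({0..t} \<inter> {max a c<..min b d}) \<le> emeasure lborel {0..t}"
      by (intro emeasure_mono) auto
    also have "\<dots> < \<infinity>" by (simp add: emeasure_lborel_Icc_eq)
    finally show "emeasure lborel ({0..t} \<inter> {max a c<..min b d}) < \<infinity>" .
  qed simp
  assume ac: "0 \<le> a" "0 \<le> c"
  then have "{0..t} \<inter> {max a c<..min b d} = {max a c<..min t (min b d)}"
    by auto
  moreover have "measure lborel {l<..u} = max 0 (u - l)" for l u :: real
    by (cases "l \<le> u") auto
  ultimately show "(LINT s:{0..t}|lborel. indicator {a<..b} s * indicator {c<..d} s)
      = max 0 (min t (min b d) - max a c)"
    unfolding set_lebesgue_integral_def eq by simp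
qed

lemma integrable_P_mult:
  fixes g :: "real \<Rightarrow> real" and h :: "'a \<Rightarrow> real"
  assumes g: "set_integrable lborel {0..t} g" and h: "integrable M h"
  shows "integrable (P t) (\<lambda>x. g (fst x) * h (snd x))"
    and "(\<integral>x. g (fst x) * h (snd x) \<partial>P t) = (LINT s:{0..t}|lborel. g s) * (\<integral>\<omega>. h \<omega> \<partial>M)"
proof -
  interpret pair_sigma_finite lborel M ..
  let ?f = "\<lambda>x. (indicator {0..t} (fst x) *\<^sub>R g (fst x)) * h (snd x)"
  have [measurable]: "(\<lambda>s. indicator {0..t} s *\<^sub>R g s) \<in> borel_measurable lborel" "h \<in> borel_measurable M"
    using g h unfolding set_integrable_def by auto
  have f: "integrable (lborel \<Otimes>\<^sub>M M) ?f"
  proof (rule Fubini_integrable)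
    show "?f \<in> borel_measurable (lborel \<Otimes>\<^sub>M M)"
      by measurable
    show "integrable lborel (\<lambda>s. \<integral>\<omega>. norm (?f (s, \<omega>)) \<partial>M)"
    proof -
      have "(\<integral>\<omega>. norm (?f (s, \<omega>)) \<partial>M) = norm (indicator {0..t} s *\<^sub>R g s) * (\<integral>\<omega>. \<bar>h \<omega>\<bar> \<partial>M)" for s
        by (simp add: abs_mult mult.assoc)
      then show ?thesis
        using g unfolding set_integrable_def by (simp only:) (intro integrable_mult_left integrable_norm)
    qed
    show "AE s in lborel. integrable M (\<lambda>\<omega>. ?f (s, \<omega>))"
      using h by simp
  qed
  have eq: "indicator ({0..t} \<times> space M) x *\<^sub>R (g (fst x) * h (snd x)) = ?f x"
    if "x \<in> space (lborel \<Otimes>\<^sub>M M)" for x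
    using that by (auto simp: space_pair_measure indicator_def)
  show "integrable (P t) (\<lambda>x. g (fst x) * h (snd x))"
    unfolding P_def using f
    by (subst integrable_restrict_space[OF P_region_Int], subst Bochner_Integration.integrable_cong[OF refl eq])
  have "(\<integral>x. g (fst x) * h (snd x) \<partial>P t) = (\<integral>x. ?f x \<partial>(lborel \<Otimes>\<^sub>M M))"
    unfolding P_def
    by (subst integral_restrict_space[OF P_region_Int], rule Bochner_Integration.integral_cong[OF refl eq])
  also have "\<dots> = (\<integral>s. (\<integral>\<omega>. ?f (s, \<omega>) \<partial>M) \<partial>lborel)"
    by (rule integral_fst'[symmetric, OF f])
  also have "\<dots> = (LINT s:{0..t}|lborel. g s) * (\<integral>\<omega>. h \<omega> \<partial>M)"
    by (simp add: set_lebesgue_integral_def)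
  finally show "(\<integral>x. g (fst x) * h (snd x) \<partial>P t) = (LINT s:{0..t}|lborel. g s) * (\<integral>\<omega>. h \<omega> \<partial>M)" .
qed

section \<open>Integrals of simple processes\<close>

text \<open>The condition that \<open>simple_data\<close> puts on one coefficient, isolated so that
  single steps can be treated on their own.\<close>

definition bdd_at :: "real \<Rightarrow> ('a \<Rightarrow> 'b::euclidean_space) \<Rightarrow> bool" where
  "bdd_at s \<xi> \<longleftrightarrow> \<xi> \<in> borel_measurable (F s) \<and> (\<exists>K. \<forall>\<omega>\<in>space M. norm (\<xi> \<omega>) \<le> K)"

lemma sqint_scaleR_bdd:
  fixes \<xi> :: "'a \<Rightarrow> 'b::euclidean_space"
  assumes "bdd_at s \<xi>" "s \<in> {0..T}" "sqint M (f :: 'a \<Rightarrow> real)"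
  shows "sqint M (\<lambda>\<omega>. f \<omega> *\<^sub>R \<xi> \<omega>)"
proof -
  obtain K where K: "norm (\<xi> \<omega>) \<le> K" if "\<omega> \<in> space M" for \<omega>
    using assms(1) by (auto simp: bdd_at_def)
  have m: "\<xi> \<in> borel_measurable M"
    using assms(1,2) by (auto simp: bdd_at_def intro: measurable_F_M)
  show ?thesis
  proof (rule sqint_mono[OF _ assms(3), of _ K])
    show "(\<lambda>\<omega>. f \<omega> *\<^sub>R \<xi> \<omega>) \<in> borel_measurable M"
      using m sqint_measurable[OF assms(3)] by measurable
    show "AE \<omega> in M. norm (f \<omega> *\<^sub>R \<xi> \<omega>) \<le> norm (K * norm (f \<omega>))"
    proof (rule AE_I2)
      fix \<omega> assume "\<omega> \<in> space M"
      then have "norm (\<xi> \<omega>) \<le> \<bar>K\<bar>" using K[of \<omega>] by linarith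
      then show "norm (f \<omega> *\<^sub>R \<xi> \<omega>) \<le> norm (K * norm (f \<omega>))"
        by (simp add: abs_mult mult.commute[of "\<bar>K\<bar>"] mult_left_mono)
    qed
  qed
qed

lemma sqint_simple_term:
  fixes \<xi> :: "'a \<Rightarrow> 'b::euclidean_space"
  assumes "bdd_at s \<xi>" "s \<in> {0..T}"
  shows "sqint (P t) (\<lambda>x. indicator {a<..b} (fst x) *\<^sub>R \<xi> (snd x))"
proof -
  interpret fP: finite_measure "P t" by (rule finite_measure_P)
  obtain K where K: "norm (\<xi> \<omega>) \<le> K" if "\<omega> \<in> space M" for \<omega>
    using assms(1) by (auto simp: bdd_at_def)
  have m: "\<xi> \<in> borel_measurable M"
    using assms by (auto simp: bdd_at_def intro: measurable_F_M)
  show ?thesis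
  proof (rule sqint_mono[OF _ fP.sqint_const[of "1::real"], of _ K])
    show "(\<lambda>x. indicator {a<..b} (fst x) *\<^sub>R \<xi> (snd x)) \<in> borel_measurable (P t)"
      by (intro borel_measurable_scaleR measurable_compose[OF measurable_P_fst]
          measurable_compose[OF measurable_P_snd m]) measurable
    show "AE x in P t. norm (indicator {a<..b} (fst x) *\<^sub>R \<xi> (snd x)) \<le> norm (K * norm (1::real))"
    proof (rule AE_I2)
      fix x assume "x \<in> space (P t)"
      then have "norm (\<xi> (snd x)) \<le> \<bar>K\<bar>" using K[of "snd x"] by (auto simp: space_P)
      then show "norm (indicator {a<..b} (fst x) *\<^sub>R \<xi> (snd x)) \<le> norm (K * norm (1::real))"
        by (auto simp: indicator_def)
    qed
  qed
qed

text \<open>Both sides equal the length of the overlap of (a,b], (c,d] and [0,t] times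
  E[\<xi> \<bullet> \<eta>] if the components agree, and vanish otherwise.\<close>

lemma simple_term_isometry:
  fixes \<xi> \<eta> :: "'a \<Rightarrow> 'b::euclidean_space"
  assumes ab: "0 \<le> a" "a \<le> b" "b \<le> T" and cd: "0 \<le> c" "c \<le> d" "d \<le> T"
    and \<xi>: "bdd_at a \<xi>" and \<eta>: "bdd_at c \<eta>" and t: "t \<in> {0..T}"
  shows "(\<integral>\<omega>. (incr i (min a t) (min b t) \<omega> *\<^sub>R \<xi> \<omega>) \<bullet> (incr j (min c t) (min d t) \<omega> *\<^sub>R \<eta> \<omega>) \<partial>M)
    = of_bool (i = j) *
      (\<integral>x. (indicator {a<..b} (fst x) *\<^sub>R \<xi> (snd x)) \<bullet> (indicator {c<..d} (fst x) *\<^sub>R \<eta> (snd x)) \<partial>P t)"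
proof -
  let ?q = "\<lambda>\<omega>. \<xi> \<omega> \<bullet> \<eta> \<omega>"
  obtain K L where K: "\<omega> \<in> space M \<Longrightarrow> norm (\<xi> \<omega>) \<le> K" and L: "\<omega> \<in> space M \<Longrightarrow> norm (\<eta> \<omega>) \<le> L" for \<omega>
    using \<xi> \<eta> by (auto simp: bdd_at_def)
  have qb: "\<bar>?q \<omega>\<bar> \<le> K * L" if "\<omega> \<in> space M" for \<omega>
  proof -
    have "\<bar>?q \<omega>\<bar> \<le> norm (\<xi> \<omega>) * norm (\<eta> \<omega>)" by (rule Cauchy_Schwarz_ineq2)
    also have "\<dots> \<le> K * L"
      using K[OF that] L[OF that] by (intro mult_mono) (auto intro: order_trans[OF norm_ge_zero])
    finally show ?thesis .
  qed
  have qF: "?q \<in> borel_measurable (F (max a c))"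
    using \<xi> \<eta> by (intro borel_measurable_inner) (auto simp: bdd_at_def intro: measurable_F_mono)
  have qM: "?q \<in> borel_measurable M"
    using qF ab cd by (intro measurable_F_M[of ?q "max a c"]) auto
  have iq: "integrable M ?q"
    using integrable_bounded_mult[OF qM qb, of "\<lambda>_. 1"] by simp
  have fact: "(indicator {a<..b} (fst x) *\<^sub>R \<xi> (snd x)) \<bullet> (indicator {c<..d} (fst x) *\<^sub>R \<eta> (snd x))
      = (indicator {a<..b} (fst x) * indicator {c<..d} (fst x)) * ?q (snd x)" for x :: "real \<times> 'a"
    by simp
  have R: "(\<integral>x. (indicator {a<..b} (fst x) *\<^sub>R \<xi> (snd x)) \<bullet> (indicator {c<..d} (fst x) *\<^sub>R \<eta> (snd x)) \<partial>P t)
      = max 0 (min t (min b d) - max a c) * (\<integral>\<omega>. ?q \<omega> \<partial>M)"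
    using integrable_P_mult(2)[OF set_lebesgue_integral_interval_overlap(1)[of t a b c d] iq]
      set_lebesgue_integral_interval_overlap(2)[OF ab(1) cd(1), of t b d]
    unfolding fact by simp
  have L: "(\<integral>\<omega>. (incr i (min a t) (min b t) \<omega> *\<^sub>R \<xi> \<omega>) \<bullet> (incr j (min c t) (min d t) \<omega> *\<^sub>R \<eta> \<omega>) \<partial>M)
      = (\<integral>\<omega>. ?q \<omega> * (incr i (min a t) (min b t) \<omega> * incr j (min c t) (min d t) \<omega>) \<partial>M)"
    by (simp add: algebra_simps)
  show ?thesis
  proof (cases "a < t \<and> c < t")
    \<comment> \<open>A step starting at or after \<open>t\<close> has both ends clipped to
      \<open>t\<close>, so its increment vanishes; the overlap length is 0 as well.\<close>
    case False
    then have "min a t = min b t \<or> min c t = min d t" using ab cd by auto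
    then have "(\<lambda>\<omega>. ?q \<omega> * (incr i (min a t) (min b t) \<omega> * incr j (min c t) (min d t) \<omega>)) = (\<lambda>_. 0)"
      by auto
    moreover have "max 0 (min t (min b d) - max a c) = 0" using False by auto
    ultimately show ?thesis unfolding R L by simp
  next
    case True
    then have "(\<integral>\<omega>. ?q \<omega> * (incr i a (min b t) \<omega> * incr j c (min d t) \<omega>) \<partial>M)
       = of_bool (i = j) * max 0 (min (min b t) (min d t) - max a c) * (\<integral>\<omega>. ?q \<omega> \<partial>M)"
      using ab cd t by (intro integral_mult_incr_incr[OF _ _ _ _ _ _ qF qb]) auto
    moreover have "min (min b t) (min d t) = min t (min b d)" by auto
    ultimately show ?thesis using True unfolding R L by (simp add: min_def)
  qed
qed

lemma simple_dataD:
  assumes "simple_data M F T k p \<xi>" "i < k"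
  shows "0 \<le> p i" "p i \<le> p (Suc i)" "p (Suc i) \<le> T" "bdd_at (p i) (\<xi> i)" "p i \<in> {0..T}"
proof -
  have mono: "p m \<le> p n" if "m \<le> n" "n \<le> k" for m n
    using that assms(1) unfolding simple_data_def
    by (induction n) (auto simp: le_Suc_eq intro: order_trans)
  show *: "0 \<le> p i" "p i \<le> p (Suc i)" "p (Suc i) \<le> T" "bdd_at (p i) (\<xi> i)"
    using assms mono[of 0 i] mono[of "Suc i" k] unfolding simple_data_def bdd_at_def by auto
  then show "p i \<in> {0..T}" by auto
qed

lemma simple_integral_incr:
  "simple_integral (Wn i) k p \<xi> t = (\<lambda>\<omega>. \<Sum>l<k. incr i (min (p l) t) (min (p (Suc l)) t) \<omega> *\<^sub>R \<xi> l \<omega>)"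
  by (simp add: simple_integral_def incr_def fun_eq_iff)

lemma simple_process_P:
  "(\<lambda>x. simple_process k p \<xi> (fst x) (snd x)) = (\<lambda>x. \<Sum>l<k. indicator {p l<..p (Suc l)} (fst x) *\<^sub>R \<xi> l (snd x))"
  by (simp add: simple_process_def fun_eq_iff)

lemma sqint_simple_integral_term:
  assumes "simple_data M F T k p \<xi>" "l < k" "t \<in> {0..T}"
  shows "sqint M (\<lambda>\<omega>. incr i (min (p l) t) (min (p (Suc l)) t) \<omega> *\<^sub>R \<xi> l \<omega>)"
proof (rule sqint_scaleR_bdd)
  show "bdd_at (p l) (\<xi> l)" "p l \<in> {0..T}"
    by (rule simple_dataD[OF assms(1,2)])+
  show "sqint M (incr i (min (p l) t) (min (p (Suc l)) t))"
    using simple_dataD(1-3)[OF assms(1,2)] assms(3) by (intro sqint_incr) auto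
qed

lemma sqint_simple_integral:
  assumes "simple_data M F T k p \<xi>" "t \<in> {0..T}"
  shows "sqint M (simple_integral (Wn i) k p \<xi> t)"
  unfolding simple_integral_incr
  by (intro sqint_sum sqint_simple_integral_term[OF assms(1) _ assms(2)]) simp

lemma sqint_simple_process:
  assumes "simple_data M F T k p \<xi>"
  shows "sqint (P t) (\<lambda>x. simple_process k p \<xi> (fst x) (snd x))"
  unfolding simple_process_P
  by (intro sqint_sum sqint_simple_term[OF simple_dataD(4,5)[OF assms]]) auto

lemma integral_inner_sum_sum:
  fixes f :: "'i \<Rightarrow> 'c \<Rightarrow> 'b::euclidean_space"
  assumes f: "\<And>l. l \<in> I \<Longrightarrow> sqint N (f l)" and g: "\<And>m. m \<in> I' \<Longrightarrow> sqint N (g m)"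
  shows "(\<integral>x. (\<Sum>l\<in>I. f l x) \<bullet> (\<Sum>m\<in>I'. g m x) \<partial>N) = (\<Sum>l\<in>I. \<Sum>m\<in>I'. \<integral>x. f l x \<bullet> g m x \<partial>N)"
proof -
  have "(\<integral>x. (\<Sum>l\<in>I. f l x) \<bullet> (\<Sum>m\<in>I'. g m x) \<partial>N)
      = (\<integral>x. (\<Sum>l\<in>I. \<Sum>m\<in>I'. f l x \<bullet> g m x) \<partial>N)"
    by (simp only: inner_sum_left inner_sum_right)
      (intro Bochner_Integration.integral_cong refl sum.swap)
  also have "\<dots> = (\<Sum>l\<in>I. \<integral>x. (\<Sum>m\<in>I'. f l x \<bullet> g m x) \<partial>N)"
    by (intro Bochner_Integration.integral_sum Bochner_Integration.integrable_sum sqint_inner_integrable f g)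
  also have "\<dots> = (\<Sum>l\<in>I. \<Sum>m\<in>I'. \<integral>x. f l x \<bullet> g m x \<partial>N)"
    by (intro sum.cong refl Bochner_Integration.integral_sum sqint_inner_integrable f g)
  finally show ?thesis .
qed

text \<open>The two partitions may be unrelated: the double sum runs over all pairs of steps, and
  the termwise isometry accounts for each overlap.\<close>

lemma simple_isometry:
  assumes S: "simple_data M F T k p \<xi>" "simple_data M F T k' p' \<xi>'" and t: "t \<in> {0..T}"
  shows "(\<integral>\<omega>. simple_integral (Wn i) k p \<xi> t \<omega> \<bullet> simple_integral (Wn j) k' p' \<xi>' t \<omega> \<partial>M)
    = of_bool (i = j) *
      (\<integral>x. simple_process k p \<xi> (fst x) (snd x) \<bullet> simple_process k' p' \<xi>' (fst x) (snd x) \<partial>P t)"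
proof -
  note D = simple_dataD[OF S(1)] and D' = simple_dataD[OF S(2)]
  let ?I = "\<lambda>l \<omega>. incr i (min (p l) t) (min (p (Suc l)) t) \<omega> *\<^sub>R \<xi> l \<omega>"
  let ?J = "\<lambda>l \<omega>. incr j (min (p' l) t) (min (p' (Suc l)) t) \<omega> *\<^sub>R \<xi>' l \<omega>"
  let ?U = "\<lambda>l x. indicator {p l<..p (Suc l)} (fst x) *\<^sub>R \<xi> l (snd x)"
  let ?V = "\<lambda>l x. indicator {p' l<..p' (Suc l)} (fst x) *\<^sub>R \<xi>' l (snd x)"
  have "(\<integral>\<omega>. (\<Sum>l<k. ?I l \<omega>) \<bullet> (\<Sum>m<k'. ?J m \<omega>) \<partial>M)
      = (\<Sum>l<k. \<Sum>m<k'. \<integral>\<omega>. ?I l \<omega> \<bullet> ?J m \<omega> \<partial>M)"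
    using sqint_simple_integral_term[OF S(1) _ t] sqint_simple_integral_term[OF S(2) _ t]
    by (intro integral_inner_sum_sum) auto
  also have "\<dots> = (\<Sum>l<k. \<Sum>m<k'. of_bool (i = j) * (\<integral>x. ?U l x \<bullet> ?V m x \<partial>P t))"
    by (intro sum.cong refl simple_term_isometry D D' t) auto
  also have "\<dots> = of_bool (i = j) * (\<Sum>l<k. \<Sum>m<k'. (\<integral>x. ?U l x \<bullet> ?V m x \<partial>P t))"
    by (simp add: sum_distrib_left)
  also have "(\<Sum>l<k. \<Sum>m<k'. (\<integral>x. ?U l x \<bullet> ?V m x \<partial>P t))
      = (\<integral>x. (\<Sum>l<k. ?U l x) \<bullet> (\<Sum>m<k'. ?V m x) \<partial>P t)"
    using sqint_simple_term[OF D(4,5)] sqint_simple_term[OF D'(4,5)]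
    by (intro integral_inner_sum_sum[symmetric]) auto
  finally show ?thesis
    unfolding simple_integral_incr simple_process_P[THEN fun_cong] .
qed

text \<open>Term by term, the integrals up to \<open>t\<close> and up to \<open>s\<close> differ by
  the increment over the part of the step inside [s,t]. At the start of that part both the
  coefficient and \<open>Q\<close> are known, so it contributes nothing in expectation.\<close>

lemma simple_martingale:
  assumes S: "simple_data M F T k p \<xi>" and st: "0 \<le> s" "s \<le> t" "t \<le> T"
    and Q: "Q \<in> borel_measurable (F s)" "sqint M Q"
  shows "(\<integral>\<omega>. simple_integral (Wn i) k p \<xi> t \<omega> \<bullet> Q \<omega> \<partial>M)
    = (\<integral>\<omega>. simple_integral (Wn i) k p \<xi> s \<omega> \<bullet> Q \<omega> \<partial>M)"
proof -
  note D = simple_dataD[OF S]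
  let ?I = "\<lambda>t l \<omega>. incr i (min (p l) t) (min (p (Suc l)) t) \<omega> *\<^sub>R \<xi> l \<omega>"
  have sI: "sqint M (?I t l)" if "l < k" "t \<in> {0..T}" for t l
    by (rule sqint_simple_integral_term[OF S that])
  have termwise: "(\<integral>\<omega>. ?I t l \<omega> \<bullet> Q \<omega> \<partial>M) = (\<integral>\<omega>. ?I s l \<omega> \<bullet> Q \<omega> \<partial>M)" if l: "l < k" for l
  proof -
    \<comment> \<open>The ends of the step clipped to [s,t]. A step that misses [s,t] degenerates to
      \<open>a = b\<close>.\<close>
    define a b where "a = min (max (p l) s) t" and "b = min (max (p (Suc l)) s) t"
    have ab: "0 \<le> a" "a \<le> b" "b \<le> T" using st D[OF l] by (auto simp: a_def b_def)
    have decomp: "?I t l \<omega> = ?I s l \<omega> + incr i a b \<omega> *\<^sub>R \<xi> l \<omega>" for \<omega>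
    proof -
      \<comment> \<open>A partition point at or after \<open>s\<close> gives the first alternative,
        an earlier one the second. In either case passing from \<open>min (p m) s\<close> to
        \<open>min (p m) t\<close> adds the increment from \<open>s\<close> to
        \<open>a'\<close>.\<close>
      have "min (p m) t = a' \<and> min (p m) s = s \<or> min (p m) t = min (p m) s \<and> a' = s"
        if "a' = min (max (p m) s) t" for m a' using st that by auto
      from this[OF a_def] this[OF b_def]
      have "incr i (min (p l) t) (min (p (Suc l)) t) \<omega> = incr i (min (p l) s) (min (p (Suc l)) s) \<omega> + incr i a b \<omega>"
        by (auto simp: incr_def)
      then show ?thesis by (simp add: scaleR_left_distrib)
    qed
    have z: "(\<integral>\<omega>. (incr i a b \<omega> *\<^sub>R \<xi> l \<omega>) \<bullet> Q \<omega> \<partial>M) = 0"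
    proof (cases "p l < t")
      case True
      then have pa: "p l \<le> a" "s \<le> a" using st by (auto simp: a_def)
      obtain K where K: "\<omega> \<in> space M \<Longrightarrow> norm (\<xi> l \<omega>) \<le> K" for \<omega>
        using D(4)[OF l] by (auto simp: bdd_at_def)
      have m: "(\<lambda>\<omega>. \<xi> l \<omega> \<bullet> Q \<omega>) \<in> borel_measurable (F a)"
        using D(4)[OF l] pa Q(1)
        by (intro borel_measurable_inner) (auto simp: bdd_at_def intro: measurable_F_mono)
      have "sqint M (\<xi> l)"
        using sqint_scaleR_bdd[OF D(4,5)[OF l], OF sqint_const[of 1]] by simp
      from sqint_inner_integrable[OF this Q(2)]
      have "(\<integral>\<omega>. (\<xi> l \<omega> \<bullet> Q \<omega>) * incr i a b \<omega> \<partial>M) = 0"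
        by (rule integral_mult_incr(2)[OF ab m])
      then show ?thesis by (simp add: mult.commute)
    next
      case False
      then have "a = t" "b = t" using st D(2)[OF l] by (auto simp: a_def b_def)
      then show ?thesis by simp
    qed
    have "sqint M (\<lambda>\<omega>. incr i a b \<omega> *\<^sub>R \<xi> l \<omega>)"
      by (intro sqint_scaleR_bdd[OF D(4,5)[OF l]] sqint_incr ab)
    then have "(\<integral>\<omega>. ?I t l \<omega> \<bullet> Q \<omega> \<partial>M) = (\<integral>\<omega>. ?I s l \<omega> \<bullet> Q \<omega> \<partial>M) + (\<integral>\<omega>. (incr i a b \<omega> *\<^sub>R \<xi> l \<omega>) \<bullet> Q \<omega> \<partial>M)"
      by (simp only: decomp inner_add_left)
        (intro Bochner_Integration.integral_add sqint_inner_integrable sI[OF l] Q(2), use st in auto)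
    then show ?thesis using z by simp
  qed
  have *: "(\<integral>\<omega>. (\<Sum>l<k. ?I t l \<omega>) \<bullet> Q \<omega> \<partial>M) = (\<Sum>l<k. \<integral>\<omega>. ?I t l \<omega> \<bullet> Q \<omega> \<partial>M)" if "t \<in> {0..T}" for t
    unfolding inner_sum_left
    by (intro Bochner_Integration.integral_sum sqint_inner_integrable sI Q that) simp
  have "t \<in> {0..T}" "s \<in> {0..T}" using st by auto
  then show ?thesis
    unfolding simple_integral_incr by (simp only: *) (intro sum.cong refl termwise, simp)
qed

section \<open>Adapted square-integrable processes\<close>

abbreviation unc :: "(real \<Rightarrow> 'a \<Rightarrow> 'b) \<Rightarrow> real \<times> 'a \<Rightarrow> 'b" where
  "unc u \<equiv> \<lambda>x. u (fst x) (snd x)"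

text \<open>The common class of controls, diffusion coefficients, drift densities and S2 processes.
  Joint measurability is taken relative to \<open>P T\<close>, which makes the \<open>sqint\<close>
  calculus available.\<close>

definition L2ad :: "(real \<Rightarrow> 'a \<Rightarrow> 'b::euclidean_space) \<Rightarrow> bool" where
  "L2ad u \<longleftrightarrow> sqint (P T) (unc u) \<and> adapted F T u"

lemma L2ad_sqint: "L2ad u \<Longrightarrow> t \<le> T \<Longrightarrow> sqint (P t) (unc u)"
  unfolding L2ad_def using sqint_P_mono by blast

lemma L2ad_adapted: "L2ad u \<Longrightarrow> t \<in> {0..T} \<Longrightarrow> u t \<in> borel_measurable (F t)"
  by (simp add: L2ad_def adapted_def)

lemma L2ad_measurable: "L2ad u \<Longrightarrow> t \<in> {0..T} \<Longrightarrow> u t \<in> borel_measurable M"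
  using L2ad_adapted measurable_F_M by blast

lemma L2ad_add: "L2ad u \<Longrightarrow> L2ad w \<Longrightarrow> L2ad (\<lambda>t \<omega>. u t \<omega> + w t \<omega>)"
  by (simp add: L2ad_def adapted_def sqint_add borel_measurable_add)

lemma L2ad_diff: "L2ad u \<Longrightarrow> L2ad w \<Longrightarrow> L2ad (\<lambda>t \<omega>. u t \<omega> - w t \<omega>)"
  by (simp add: L2ad_def adapted_def sqint_diff borel_measurable_diff)

lemma L2ad_uminus: "L2ad u \<Longrightarrow> L2ad (\<lambda>t \<omega>. - u t \<omega>)"
  by (simp add: L2ad_def adapted_def sqint_uminus)

lemma L2_proc_L2ad:
  assumes "u \<in> L2_proc M F T"
  shows "L2ad u"
proof -
  have m: "unc u \<in> borel_measurable (P T)"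
    using assms measurable_P_of_pair[of "\<lambda>(t, \<omega>). u t \<omega>" borel T]
    by (simp add: L2_proc_def case_prod_beta')
  have "(\<integral>\<^sup>+x. ennreal ((norm (unc u x))\<^sup>2) \<partial>P T) < \<infinity>"
    using assms m by (subst nn_integral_P) (auto simp: L2_proc_def)
  with m show ?thesis
    using assms by (simp add: L2ad_def sqint_iff_nn_integral L2_proc_def)
qed

lemma Vad_L2ad:
  assumes "u \<in> Vad M T W1"
  shows "L2ad u"
proof (rule L2_proc_L2ad)
  show "u \<in> L2_proc M F T"
    using assms unfolding Vad_def L2_proc_def adapted_def
    by (simp add: measurable_natural_F)
qed

lemma nn_integral_P':
  assumes "f \<in> borel_measurable (P t)"
  shows "(\<integral>\<^sup>+x. f x \<partial>P t) = (\<integral>\<^sup>+s\<in>{0..t}. (\<integral>\<^sup>+\<omega>. f (s, \<omega>) \<partial>M) \<partial>lborel)"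
proof -
  have m: "(\<lambda>x. f x * indicator ({0..t} \<times> space M) x) \<in> borel_measurable (lborel \<Otimes>\<^sub>M M)"
    using assms unfolding P_def
    by (subst (asm) borel_measurable_restrict_space_iff_ennreal[OF P_region_Int])
  have "(\<integral>\<^sup>+x. f x \<partial>P t) = (\<integral>\<^sup>+x. f x * indicator ({0..t} \<times> space M) x \<partial>(lborel \<Otimes>\<^sub>M M))"
    unfolding P_def by (rule nn_integral_restrict_space[OF P_region_Int])
  also have "\<dots> = (\<integral>\<^sup>+s. (\<integral>\<^sup>+\<omega>. f (s, \<omega>) * indicator ({0..t} \<times> space M) (s, \<omega>) \<partial>M) \<partial>lborel)"
    by (rule nn_integral_fst[symmetric, OF m])
  also have "\<dots> = (\<integral>\<^sup>+s\<in>{0..t}. (\<integral>\<^sup>+\<omega>. f (s, \<omega>) \<partial>M) \<partial>lborel)"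
  proof (rule nn_integral_cong)
    fix s
    have "(\<integral>\<^sup>+\<omega>. f (s, \<omega>) * indicator ({0..t} \<times> space M) (s, \<omega>) \<partial>M)
        = (\<integral>\<^sup>+\<omega>. f (s, \<omega>) * indicator {0..t} s \<partial>M)"
      by (intro nn_integral_cong) (simp add: indicator_P)
    also have "\<dots> = (\<integral>\<^sup>+\<omega>. f (s, \<omega>) \<partial>M) * indicator {0..t} s"
      by (cases "s \<in> {0..t}") auto
    finally show "(\<integral>\<^sup>+\<omega>. f (s, \<omega>) * indicator ({0..t} \<times> space M) (s, \<omega>) \<partial>M)
        = (\<integral>\<^sup>+\<omega>. f (s, \<omega>) \<partial>M) * indicator {0..t} s" .
  qed
  finally show ?thesis .
qed

lemma sqint_P_uniform:
  fixes f :: "real \<times> 'a \<Rightarrow> 'b::euclidean_space"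
  assumes f: "f \<in> borel_measurable (P t)"
    and bd: "\<And>s. s \<in> {0..t} \<Longrightarrow> (\<integral>\<^sup>+\<omega>. ennreal ((norm (f (s, \<omega>)))\<^sup>2) \<partial>M) \<le> C" and "C < \<infinity>"
  shows "sqint (P t) f"
proof -
  have "(\<integral>\<^sup>+x. ennreal ((norm (f x))\<^sup>2) \<partial>P t)
      = (\<integral>\<^sup>+s\<in>{0..t}. (\<integral>\<^sup>+\<omega>. ennreal ((norm (f (s, \<omega>)))\<^sup>2) \<partial>M) \<partial>lborel)"
    using f by (intro nn_integral_P') simp
  also have "\<dots> \<le> (\<integral>\<^sup>+s. C * indicator {0..t} s \<partial>lborel)"
    using bd by (intro nn_integral_mono) (auto simp: indicator_def)
  also have "\<dots> = C * emeasure lborel {0..t}"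
    by (intro nn_integral_cmult_indicator) simp
  also have "\<dots> < \<infinity>"
    using assms(3) by (simp add: emeasure_lborel_Icc_eq ennreal_mult_less_top)
  finally show ?thesis using f by (simp add: sqint_iff_nn_integral)
qed

text \<open>Membership in \<open>S2_proc\<close> provides continuous paths and measurability at each
  time; joint measurability has to be derived. The process is the pointwise limit of its values at
  rounded times, and these are jointly measurable because the rounded time takes countably many
  values.\<close>

lemma measurable_P_continuous_paths:
  fixes U :: "real \<Rightarrow> 'a \<Rightarrow> 'b::euclidean_space"
  assumes cont: "\<And>\<omega>. \<omega> \<in> space M \<Longrightarrow> continuous_on {0..T} (\<lambda>t. U t \<omega>)"
    and meas: "\<And>t. t \<in> {0..T} \<Longrightarrow> U t \<in> borel_measurable M"
  shows "unc U \<in> borel_measurable (P T)"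
proof (rule borel_measurable_LIMSEQ_metric)
  \<comment> \<open>The last multiple of 1 / (n + 1) at or before \<open>s\<close>;
    \<open>Suc n\<close> avoids division by zero.\<close>
  define \<tau> where "\<tau> n s = real_of_int \<lfloor>real (Suc n) * s\<rfloor> / real (Suc n)" for n and s :: real
  \<comment> \<open>Countable composition asks for a measurable section for every integer, also for
    those whose grid point lies outside [0,T]; \<open>clip\<close> moves these back.\<close>
  define clip where "clip s = max 0 (min T s)" for s :: real
  have clip: "clip s \<in> {0..T}" for s using T_pos by (auto simp: clip_def)
  show "(\<lambda>x. U (clip (\<tau> n (fst x))) (snd x)) \<in> borel_measurable (P T)" for n
    unfolding \<tau>_def
  proof (rule measurable_compose_countable[where g = "\<lambda>x. \<lfloor>real (Suc n) * fst x\<rfloor>"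
        and f = "\<lambda>i x. U (clip (real_of_int i / real (Suc n))) (snd x)"])
    show "(\<lambda>x. U (clip (real_of_int i / real (Suc n))) (snd x)) \<in> borel_measurable (P T)" for i
      by (rule measurable_compose[OF measurable_P_snd meas[OF clip]])
    show "(\<lambda>x. \<lfloor>real (Suc n) * fst x\<rfloor>) \<in> measurable (P T) (count_space UNIV)"
      by (rule measurable_compose[OF measurable_P_fst]) measurable
  qed
  fix x assume "x \<in> space (P T)"
  then obtain s \<omega> where x: "x = (s, \<omega>)" "s \<in> {0..T}" "\<omega> \<in> space M" by (auto simp: space_P)
  have near: "s - 1 / real (Suc n) \<le> \<tau> n s" "\<tau> n s \<le> s" for n
  proof -
    have "real_of_int \<lfloor>real (Suc n) * s\<rfloor> \<le> real (Suc n) * s" by linarith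
    then show "\<tau> n s \<le> s" unfolding \<tau>_def by (simp add: pos_divide_le_eq mult.commute)
    have "real (Suc n) * s - 1 \<le> real_of_int \<lfloor>real (Suc n) * s\<rfloor>" by linarith
    then have "(real (Suc n) * s - 1) / real (Suc n) \<le> \<tau> n s" unfolding \<tau>_def by (intro divide_right_mono) auto
    then show "s - 1 / real (Suc n) \<le> \<tau> n s" by (simp add: diff_divide_distrib)
  qed
  have \<tau>pos: "0 \<le> \<tau> n s" for n using x(2) by (simp add: \<tau>_def)
  have "(\<lambda>n. s - 1 / real (Suc n)) \<longlonglongrightarrow> s - 0"
    by (intro tendsto_diff tendsto_const LIMSEQ_Suc[OF lim_1_over_n])
  then have "(\<lambda>n. s - 1 / real (Suc n)) \<longlonglongrightarrow> s" by simp
  then have "(\<lambda>n. \<tau> n s) \<longlonglongrightarrow> s"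
    by (rule tendsto_sandwich[OF _ _ _ tendsto_const, rotated 2]) (use near in auto)
  moreover have "clip (\<tau> n s) = \<tau> n s" for n
    using \<tau>pos[of n] near(2)[of n] x(2) by (auto simp: clip_def)
  ultimately have "(\<lambda>n. clip (\<tau> n s)) \<longlonglongrightarrow> s" by simp
  then have "(\<lambda>n. U (clip (\<tau> n s)) \<omega>) \<longlonglongrightarrow> U s \<omega>"
    by (rule continuous_on_tendsto_compose[OF cont[OF x(3)] _ x(2)]) (use clip in auto)
  then show "(\<lambda>n. U (clip (\<tau> n (fst x))) (snd x)) \<longlonglongrightarrow> U (fst x) (snd x)"
    by (simp add: x)
qed

lemma S2_proc_bound:
  assumes U: "U \<in> S2_proc M F T"
  obtains C where "C < \<infinity>" "\<And>s. s \<in> {0..T} \<Longrightarrow> (\<integral>\<^sup>+\<omega>. ennreal ((norm (U s \<omega>))\<^sup>2) \<partial>M) \<le> C"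
proof
  show "(\<integral>\<^sup>+ \<omega>. (SUP t\<in>{0..T}. ennreal ((norm (U t \<omega>))\<^sup>2)) \<partial>M) < \<infinity>"
    using U by (simp add: S2_proc_def)
  show "(\<integral>\<^sup>+\<omega>. ennreal ((norm (U s \<omega>))\<^sup>2) \<partial>M) \<le> (\<integral>\<^sup>+ \<omega>. (SUP t\<in>{0..T}. ennreal ((norm (U t \<omega>))\<^sup>2)) \<partial>M)"
    if "s \<in> {0..T}" for s
    \<comment> \<open>Monotonicity of the nonnegative integral holds for arbitrary integrands, so
      the uncountable supremum can be integrated as it stands.\<close>
    using that by (intro nn_integral_mono SUP_upper)
qed

lemma S2_proc_adapted: "U \<in> S2_proc M F T \<Longrightarrow> s \<in> {0..T} \<Longrightarrow> U s \<in> borel_measurable (F s)"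
  by (simp add: S2_proc_def adapted_def)

lemma S2_proc_sqint:
  assumes U: "U \<in> S2_proc M F T" and s: "s \<in> {0..T}"
  shows "sqint M (U s)"
proof -
  obtain C where "C < \<infinity>" "(\<integral>\<^sup>+\<omega>. ennreal ((norm (U s \<omega>))\<^sup>2) \<partial>M) \<le> C"
    using S2_proc_bound[OF U] s by metis
  then show ?thesis
    using measurable_F_M[OF S2_proc_adapted[OF U s] s] by (auto simp: sqint_iff_nn_integral)
qed

lemma S2_proc_L2ad:
  assumes U: "U \<in> S2_proc M F T"
  shows "L2ad U"
proof -
  obtain C where C: "C < \<infinity>" "\<And>s. s \<in> {0..T} \<Longrightarrow> (\<integral>\<^sup>+\<omega>. ennreal ((norm (U s \<omega>))\<^sup>2) \<partial>M) \<le> C"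
    using S2_proc_bound[OF U] by metis
  have "unc U \<in> borel_measurable (P T)"
    using U by (intro measurable_P_continuous_paths sqint_measurable[OF S2_proc_sqint])
      (simp_all add: S2_proc_def)
  then have "sqint (P T) (unc U)"
    by (rule sqint_P_uniform[OF _ _ C(1)]) (simp add: C(2))
  then show ?thesis using U by (simp add: L2ad_def S2_proc_def)
qed

section \<open>Ito integrals\<close>

text \<open>The two limits in the definition are restated as \<open>L2lim\<close> on
  \<open>P t\<close> and on \<open>M\<close>, which brings square integrability of \<open>u\<close>
  and \<open>I\<close> along.\<close>

lemma has_ito_integral_approx:
  assumes "has_ito_integral M F T (Wn i) u t I" and t: "t \<in> {0..T}"
  obtains k p \<xi> where "\<And>j. simple_data M F T (k j) (p j) (\<xi> j)"
    and "L2lim (P t) (\<lambda>j. unc (simple_process (k j) (p j) (\<xi> j))) (unc u)"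
    and "L2lim M (\<lambda>j. simple_integral (Wn i) (k j) (p j) (\<xi> j) t) I"
proof -
  from assms(1) obtain k p \<xi> where S: "\<And>j. simple_data M F T (k j) (p j) (\<xi> j)"
    and l1: "(\<lambda>j. \<integral>\<^sup>+ \<omega>. (\<integral>\<^sup>+ s\<in>{0..t}.
            ennreal ((norm (u s \<omega> - simple_process (k j) (p j) (\<xi> j) s \<omega>))\<^sup>2) \<partial>lborel) \<partial>M) \<longlonglongrightarrow> 0"
    and l2: "(\<lambda>j. \<integral>\<^sup>+ \<omega>.
            ennreal ((norm (I \<omega> - simple_integral (Wn i) (k j) (p j) (\<xi> j) t \<omega>))\<^sup>2) \<partial>M) \<longlonglongrightarrow> 0"
    and u: "u \<in> L2_proc M F T" and I: "I \<in> borel_measurable M"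
    unfolding has_ito_integral_def by blast
  have um: "unc u \<in> borel_measurable (P t)"
    using sqint_measurable[OF L2ad_sqint[OF L2_proc_L2ad[OF u]]] t by auto
  have sm: "sqint (P t) (unc (simple_process (k j) (p j) (\<xi> j)))" for j
    by (rule sqint_simple_process[OF S])
  have "(\<integral>\<^sup>+x. ennreal ((norm (unc u x - unc (simple_process (k j) (p j) (\<xi> j)) x))\<^sup>2) \<partial>P t)
     = (\<integral>\<^sup>+ \<omega>. (\<integral>\<^sup>+ s\<in>{0..t}.
            ennreal ((norm (u s \<omega> - simple_process (k j) (p j) (\<xi> j) s \<omega>))\<^sup>2) \<partial>lborel) \<partial>M)" for j
    using um sqint_measurable[OF sm[of j]] by (subst nn_integral_P) auto
  then have "L2lim (P t) (\<lambda>j. unc (simple_process (k j) (p j) (\<xi> j))) (unc u)"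
    using l1 by (intro L2limI_nn_integral sm um) simp
  moreover have "L2lim M (\<lambda>j. simple_integral (Wn i) (k j) (p j) (\<xi> j) t) I"
    by (rule L2limI_nn_integral[OF sqint_simple_integral[OF S t] I l2])
  ultimately show ?thesis using that S by blast
qed

lemma has_ito_integral_sqint:
  assumes "has_ito_integral M F T (Wn i) u t I" "t \<in> {0..T}"
  shows "sqint M I"
  by (rule has_ito_integral_approx[OF assms]) (simp add: L2lim_def)

text \<open>Both sides of the isometry for simple processes converge, by continuity of the inner
  product. The factor \<open>of_bool (i = j)\<close> records that integrals against different
  components are orthogonal.\<close>

lemma ito_isometry:
  assumes I: "has_ito_integral M F T (Wn i) u t I" and J: "has_ito_integral M F T (Wn j) w t I'"
    and t: "t \<in> {0..T}"
  shows "(\<integral>\<omega>. I \<omega> \<bullet> I' \<omega> \<partial>M) = of_bool (i = j) * (\<integral>x. unc u x \<bullet> unc w x \<partial>P t)"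
proof -
  obtain k p \<xi> where a: "\<And>l. simple_data M F T (k l) (p l) (\<xi> l)"
    "L2lim (P t) (\<lambda>l. unc (simple_process (k l) (p l) (\<xi> l))) (unc u)"
    "L2lim M (\<lambda>l. simple_integral (Wn i) (k l) (p l) (\<xi> l) t) I"
    by (rule has_ito_integral_approx[OF I t]) (rule that)
  obtain k' p' \<xi>' where b: "\<And>l. simple_data M F T (k' l) (p' l) (\<xi>' l)"
    "L2lim (P t) (\<lambda>l. unc (simple_process (k' l) (p' l) (\<xi>' l))) (unc w)"
    "L2lim M (\<lambda>l. simple_integral (Wn j) (k' l) (p' l) (\<xi>' l) t) I'"
    by (rule has_ito_integral_approx[OF J t]) (rule that)
  have "(\<lambda>l. \<integral>\<omega>. simple_integral (Wn i) (k l) (p l) (\<xi> l) t \<omega> \<bullet> simple_integral (Wn j) (k' l) (p' l) (\<xi>' l) t \<omega> \<partial>M)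
      \<longlonglongrightarrow> (\<integral>\<omega>. I \<omega> \<bullet> I' \<omega> \<partial>M)"
    by (rule L2lim_inner[OF a(3) b(3)])
  moreover have "(\<lambda>l. of_bool (i = j) * (\<integral>x. unc (simple_process (k l) (p l) (\<xi> l)) x
        \<bullet> unc (simple_process (k' l) (p' l) (\<xi>' l)) x \<partial>P t))
      \<longlonglongrightarrow> of_bool (i = j) * (\<integral>x. unc u x \<bullet> unc w x \<partial>P t)"
    by (intro tendsto_mult tendsto_const L2lim_inner[OF a(2) b(2)])
  ultimately show ?thesis
    unfolding simple_isometry[OF a(1) b(1) t] by (rule LIMSEQ_unique)
qed

lemma L2lim_P_mono: "s \<le> t \<Longrightarrow> L2lim (P t) f g \<Longrightarrow> L2lim (P s) f g"
proof -
  assume st: "s \<le> t" and L: "L2lim (P t) f g"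
  then have sq: "sqint (P t) (f j)" "sqint (P t) g" for j by (auto simp: L2lim_def)
  have le: "(\<integral>x. (norm (f j x - g x))\<^sup>2 \<partial>P s) \<le> (\<integral>x. (norm (f j x - g x))\<^sup>2 \<partial>P t)" for j
    unfolding integral_P_mono[OF st]
  proof (rule integral_mono_AE')
    show "integrable (P t) (\<lambda>x. (norm (f j x - g x))\<^sup>2)"
      using sqint_diff[OF sq] by (simp add: sqint_def)
  qed (auto simp: indicator_def)
  have "(\<lambda>j. \<integral>x. (norm (f j x - g x))\<^sup>2 \<partial>P s) \<longlonglongrightarrow> 0"
    by (rule tendsto_sandwich[OF _ _ tendsto_const[of 0], of _ _ "\<lambda>j. \<integral>x. (norm (f j x - g x))\<^sup>2 \<partial>P t"])
      (use le L in \<open>auto simp: L2lim_def\<close>)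
  then show ?thesis using sq sqint_P_mono[OF st] by (auto simp: L2lim_def)
qed

text \<open>The integrals \<open>I\<close> and \<open>I'\<close> come with unrelated approximations.
  Those chosen for \<open>t\<close> are also integrated up to \<open>s\<close>; by the isometry the
  resulting integrals \<open>?A\<close> approach the integrals \<open>?B\<close> of the
  approximations chosen for \<open>s\<close>, since both sequences of integrands tend to
  \<open>u\<close> on [0,s]. The martingale property of simple integrals then links
  \<open>?A\<close> with the integrals up to \<open>t\<close>.\<close>

lemma ito_martingale:
  assumes I: "has_ito_integral M F T (Wn i) u t I" and J: "has_ito_integral M F T (Wn i) u s I'"
    and st: "0 \<le> s" "s \<le> t" "t \<le> T" and Q: "Q \<in> borel_measurable (F s)" "sqint M Q"
  shows "(\<integral>\<omega>. I \<omega> \<bullet> Q \<omega> \<partial>M) = (\<integral>\<omega>. I' \<omega> \<bullet> Q \<omega> \<partial>M)"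
proof -
  have t: "t \<in> {0..T}" and s: "s \<in> {0..T}" using st by auto
  obtain k p \<xi> where a: "\<And>l. simple_data M F T (k l) (p l) (\<xi> l)"
    "L2lim (P t) (\<lambda>l. unc (simple_process (k l) (p l) (\<xi> l))) (unc u)"
    "L2lim M (\<lambda>l. simple_integral (Wn i) (k l) (p l) (\<xi> l) t) I"
    by (rule has_ito_integral_approx[OF I t]) (rule that)
  obtain k' p' \<xi>' where b: "\<And>l. simple_data M F T (k' l) (p' l) (\<xi>' l)"
    "L2lim (P s) (\<lambda>l. unc (simple_process (k' l) (p' l) (\<xi>' l))) (unc u)"
    "L2lim M (\<lambda>l. simple_integral (Wn i) (k' l) (p' l) (\<xi>' l) s) I'"
    by (rule has_ito_integral_approx[OF J s]) (rule that)
  let ?A = "\<lambda>l. simple_integral (Wn i) (k l) (p l) (\<xi> l) s"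
  let ?B = "\<lambda>l. simple_integral (Wn i) (k' l) (p' l) (\<xi>' l) s"
  let ?u = "\<lambda>l. unc (simple_process (k l) (p l) (\<xi> l))"
  let ?w = "\<lambda>l. unc (simple_process (k' l) (p' l) (\<xi>' l))"
  have sA: "sqint M (?A l)" and sB: "sqint M (?B l)" for l
    by (rule sqint_simple_integral[OF a(1) s] sqint_simple_integral[OF b(1) s])+
  have su: "sqint (P s) (?u l)" and sw: "sqint (P s) (?w l)" for l
    by (rule sqint_simple_process[OF a(1)] sqint_simple_process[OF b(1)])+
  \<comment> \<open>The squared distance is expressed by inner products, because the isometry is
    stated for pairs of simple processes; their difference as one simple process would require a
    merged partition.\<close>
  have dist: "(\<integral>x. (norm (f x - g x))\<^sup>2 \<partial>N)
      = (\<integral>x. f x \<bullet> f x \<partial>N) - 2 * (\<integral>x. f x \<bullet> g x \<partial>N) + (\<integral>x. g x \<bullet> g x \<partial>N)"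
    if "sqint N f" "sqint N g" for N :: "'x measure" and f g :: "'x \<Rightarrow> 'b"
  proof -
    note i = sqint_inner_integrable[OF that(1,1)] sqint_inner_integrable[OF that(1,2)]
      sqint_inner_integrable[OF that(2,2)]
    have "(\<integral>x. (norm (f x - g x))\<^sup>2 \<partial>N) = (\<integral>x. f x \<bullet> f x - 2 * (f x \<bullet> g x) + g x \<bullet> g x \<partial>N)"
      by (simp add: power2_norm_eq_inner inner_diff_left inner_diff_right inner_commute algebra_simps)
    then show ?thesis using i by simp
  qed
  have "(\<integral>\<omega>. (norm (?A l \<omega> - ?B l \<omega>))\<^sup>2 \<partial>M) = (\<integral>x. (norm (?u l x - ?w l x))\<^sup>2 \<partial>P s)" for l
    unfolding dist[OF sA sB] dist[OF su sw]
    by (simp add: simple_isometry[OF a(1) a(1) s] simple_isometry[OF a(1) b(1) s] simple_isometry[OF b(1) b(1) s])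
  moreover have "(\<lambda>l. \<integral>x. (norm (?u l x - ?w l x))\<^sup>2 \<partial>P s) \<longlonglongrightarrow> 0"
    by (rule L2lim_dist[OF L2lim_P_mono[OF st(2) a(2)] b(2)])
  ultimately have "L2lim M (\<lambda>l \<omega>. ?A l \<omega> - ?B l \<omega>) (\<lambda>_. 0)"
    by (simp add: L2lim_def sqint_diff[OF sA sB] sqint_zero)
  from L2lim_inner[OF this L2lim_const[OF Q(2)]]
  have lim0: "(\<lambda>l. \<integral>\<omega>. (?A l \<omega> - ?B l \<omega>) \<bullet> Q \<omega> \<partial>M) \<longlonglongrightarrow> 0" by simp
  have "(\<integral>\<omega>. (?A l \<omega> - ?B l \<omega>) \<bullet> Q \<omega> \<partial>M)
      = (\<integral>\<omega>. simple_integral (Wn i) (k l) (p l) (\<xi> l) t \<omega> \<bullet> Q \<omega> \<partial>M) - (\<integral>\<omega>. ?B l \<omega> \<bullet> Q \<omega> \<partial>M)" for l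
    unfolding inner_diff_left simple_martingale[OF a(1) st Q]
    by (intro Bochner_Integration.integral_diff sqint_inner_integrable sA sB Q)
  then have "(\<lambda>l. \<integral>\<omega>. (?A l \<omega> - ?B l \<omega>) \<bullet> Q \<omega> \<partial>M)
      \<longlonglongrightarrow> (\<integral>\<omega>. I \<omega> \<bullet> Q \<omega> \<partial>M) - (\<integral>\<omega>. I' \<omega> \<bullet> Q \<omega> \<partial>M)"
    by (simp only:) (intro tendsto_diff L2lim_inner[OF a(3) L2lim_const[OF Q(2)]]
        L2lim_inner[OF b(3) L2lim_const[OF Q(2)]])
  from LIMSEQ_unique[OF this lim0] show ?thesis by simp
qed

end

section \<open>Integrals of vector-valued functions: a Jensen-type bound and a product
  formula\<close>

lemma (in finite_measure) norm_integral_squared_le: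
  fixes f :: "'a \<Rightarrow> 'b::euclidean_space"
  assumes f: "sqint M f"
  shows "(norm (\<integral>x. f x \<partial>M))\<^sup>2 \<le> measure M (space M) * (\<integral>x. (norm (f x))\<^sup>2 \<partial>M)"
proof -
  \<comment> \<open>The integral is tested against its own value \<open>d\<close>; dividing the
    resulting bound by |d| gives the claim.\<close>
  define d where "d = (\<integral>x. f x \<partial>M)"
  let ?A = "\<integral>x. (norm (f x))\<^sup>2 \<partial>M" and ?m = "measure M (space M)"
  have "(norm d)\<^sup>2 = (\<integral>x. f x \<bullet> d \<partial>M)"
    using sqint_imp_integrable[OF f] by (simp add: power2_norm_eq_inner d_def)
  also have "\<dots> \<le> sqrt ?A * sqrt (?m * (norm d)\<^sup>2)"
    using sqint_Cauchy_Schwarz[OF f sqint_const[of d]] by simp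
  finally have "norm d * norm d \<le> (sqrt ?A * sqrt ?m) * norm d"
    by (simp add: real_sqrt_mult power2_eq_square mult.assoc)
  then have "norm d \<le> sqrt ?A * sqrt ?m"
    by (cases "d = 0") auto
  then have "(norm d)\<^sup>2 \<le> (sqrt ?A * sqrt ?m)\<^sup>2"
    by (intro power_mono) auto
  then show ?thesis by (simp add: power_mult_distrib d_def mult.commute)
qed

text \<open>Integration by parts for two primitives, obtained from Fubini: the product is the
  integral of f r \<bullet> g s over the square, which is split along its diagonal.\<close>

lemma integral_product_triangle:
  fixes f g :: "real \<Rightarrow> 'b::euclidean_space"
  assumes f: "set_integrable lborel {0..t} f" and g: "set_integrable lborel {0..t} g"
  shows "(LINT s:{0..t}|lborel. f s) \<bullet> (LINT s:{0..t}|lborel. g s)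
    = (LINT s:{0..t}|lborel. (LINT r:{0..s}|lborel. f r) \<bullet> g s + (LINT r:{0..s}|lborel. g r) \<bullet> f s)"
proof -
  define f0 where "f0 = (\<lambda>s. indicator {0..t} s *\<^sub>R f s)"
  define g0 where "g0 = (\<lambda>s. indicator {0..t} s *\<^sub>R g s)"
  have fi: "integrable lborel f0" and gi: "integrable lborel g0"
    using f g by (auto simp: f0_def g0_def set_integrable_def)
  have [measurable]: "f0 \<in> borel_measurable lborel" "g0 \<in> borel_measurable lborel"
    using fi gi by auto
  have int: "integrable (lborel \<Otimes>\<^sub>M lborel) (\<lambda>x. f0 (fst x) \<bullet> g0 (snd x))"
  proof (rule Bochner_Integration.integrable_bound)
    show "integrable (lborel \<Otimes>\<^sub>M lborel) (\<lambda>x. norm (f0 (fst x)) * norm (g0 (snd x)))"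
      by (rule lborel_pair.Fubini_integrable) (use fi gi in auto)
    show "AE x in lborel \<Otimes>\<^sub>M lborel. norm (f0 (fst x) \<bullet> g0 (snd x)) \<le> norm (norm (f0 (fst x)) * norm (g0 (snd x)))"
      by (rule AE_I2) (simp add: Cauchy_Schwarz_ineq2)
  qed measurable
  let ?L = "{x. fst x \<le> snd x} :: (real \<times> real) set" and ?U = "{x. snd x < fst x} :: (real \<times> real) set"
  have LU: "?L \<in> sets (lborel \<Otimes>\<^sub>M lborel)" "?U \<in> sets (lborel \<Otimes>\<^sub>M lborel)"
    unfolding lborel_prod sets_lborel
    by (intro borel_closed borel_open closed_Collect_le open_Collect_less continuous_intros)+
  note intL = integrable_mult_indicator[OF LU(1) int] and intU = integrable_mult_indicator[OF LU(2) int]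
  have "(LINT s:{0..t}|lborel. f s) \<bullet> (LINT s:{0..t}|lborel. g s)
      = (\<integral>r. (\<integral>s. f0 r \<bullet> g0 s \<partial>lborel) \<partial>lborel)"
    using fi gi by (simp add: set_lebesgue_integral_def f0_def[symmetric] g0_def[symmetric])
  also have "\<dots> = (\<integral>x. f0 (fst x) \<bullet> g0 (snd x) \<partial>(lborel \<Otimes>\<^sub>M lborel))"
    using lborel_pair.integral_fst'[OF int] by simp
  also have "\<dots> = (\<integral>x. indicator ?L x *\<^sub>R (f0 (fst x) \<bullet> g0 (snd x)) + indicator ?U x *\<^sub>R (f0 (fst x) \<bullet> g0 (snd x))
      \<partial>(lborel \<Otimes>\<^sub>M lborel))"
    by (intro Bochner_Integration.integral_cong refl) (auto simp: indicator_def)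
  also have "\<dots> = (\<integral>x. indicator ?L x *\<^sub>R (f0 (fst x) \<bullet> g0 (snd x)) \<partial>(lborel \<Otimes>\<^sub>M lborel))
      + (\<integral>x. indicator ?U x *\<^sub>R (f0 (fst x) \<bullet> g0 (snd x)) \<partial>(lborel \<Otimes>\<^sub>M lborel))"
    by (rule Bochner_Integration.integral_add[OF intL intU])
  finally have main: "(LINT s:{0..t}|lborel. f s) \<bullet> (LINT s:{0..t}|lborel. g s)
      = (\<integral>x. indicator ?L x *\<^sub>R (f0 (fst x) \<bullet> g0 (snd x)) \<partial>(lborel \<Otimes>\<^sub>M lborel))
      + (\<integral>x. indicator ?U x *\<^sub>R (f0 (fst x) \<bullet> g0 (snd x)) \<partial>(lborel \<Otimes>\<^sub>M lborel))" .
  \<comment> \<open>The diagonal belongs to \<open>?L\<close>, so the inner integral of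
    \<open>g\<close> runs over a half-open interval; the missing point is a null set.\<close>
  have part: "(LINT r:{0..s}|lborel. f r) = (\<integral>r. indicator {..s} r *\<^sub>R f0 r \<partial>lborel)"
    "(LINT r:{0..s}|lborel. g r) = (\<integral>r. indicator {..<s} r *\<^sub>R g0 r \<partial>lborel)" if "s \<in> {0..t}" for s
  proof -
    show "(LINT r:{0..s}|lborel. f r) = (\<integral>r. indicator {..s} r *\<^sub>R f0 r \<partial>lborel)"
      unfolding set_lebesgue_integral_def f0_def
      using that by (intro Bochner_Integration.integral_cong refl) (auto simp: indicator_def)
    have "AE r in lborel. r \<noteq> s"
      by (rule AE_lborel_singleton)
    then have "AE r in lborel. indicator {0..s} r *\<^sub>R g0 r = indicator {..<s} r *\<^sub>R g0 r"
      by eventually_elim (auto simp: indicator_def g0_def)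
    then have "(\<integral>r. indicator {0..s} r *\<^sub>R g0 r \<partial>lborel) = (\<integral>r. indicator {..<s} r *\<^sub>R g0 r \<partial>lborel)"
      by (intro integral_cong_AE) measurable
    moreover have "(\<integral>r. indicator {0..s} r *\<^sub>R g0 r \<partial>lborel) = (LINT r:{0..s}|lborel. g r)"
      unfolding set_lebesgue_integral_def g0_def
      using that by (intro Bochner_Integration.integral_cong refl) (auto simp: indicator_def)
    ultimately show "(LINT r:{0..s}|lborel. g r) = (\<integral>r. indicator {..<s} r *\<^sub>R g0 r \<partial>lborel)" by simp
  qed
  have L1: "(\<integral>r. indicator ?L (r, s) *\<^sub>R (f0 r \<bullet> g0 s) \<partial>lborel)
      = indicator {0..t} s *\<^sub>R ((LINT r:{0..s}|lborel. f r) \<bullet> g s)" for s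
  proof (cases "s \<in> {0..t}")
    case True
    have "(\<integral>r. indicator ?L (r, s) *\<^sub>R (f0 r \<bullet> g0 s) \<partial>lborel) = (\<integral>r. (indicator {..s} r *\<^sub>R f0 r) \<bullet> g s \<partial>lborel)"
      using True by (intro Bochner_Integration.integral_cong refl) (auto simp: indicator_def g0_def)
    also have "\<dots> = (\<integral>r. indicator {..s} r *\<^sub>R f0 r \<partial>lborel) \<bullet> g s"
      by (intro integral_inner_left integrable_mult_indicator fi) auto
    finally show ?thesis using True part(1) by simp
  qed (simp add: g0_def)
  have U1: "(\<integral>s. indicator ?U (r, s) *\<^sub>R (f0 r \<bullet> g0 s) \<partial>lborel)
      = indicator {0..t} r *\<^sub>R ((LINT s:{0..r}|lborel. g s) \<bullet> f r)" for r
  proof (cases "r \<in> {0..t}")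
    case True
    have "(\<integral>s. indicator ?U (r, s) *\<^sub>R (f0 r \<bullet> g0 s) \<partial>lborel) = (\<integral>s. (indicator {..<r} s *\<^sub>R g0 s) \<bullet> f r \<partial>lborel)"
      using True by (intro Bochner_Integration.integral_cong refl) (auto simp: indicator_def f0_def inner_commute)
    also have "\<dots> = (\<integral>s. indicator {..<r} s *\<^sub>R g0 s \<partial>lborel) \<bullet> f r"
      by (intro integral_inner_left integrable_mult_indicator gi) auto
    finally show ?thesis using True part(2) by simp
  qed (simp add: f0_def)
  have L2: "(\<integral>x. indicator ?L x *\<^sub>R (f0 (fst x) \<bullet> g0 (snd x)) \<partial>(lborel \<Otimes>\<^sub>M lborel))
      = (\<integral>s. indicator {0..t} s *\<^sub>R ((LINT r:{0..s}|lborel. f r) \<bullet> g s) \<partial>lborel)"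
    "integrable lborel (\<lambda>s. indicator {0..t} s *\<^sub>R ((LINT r:{0..s}|lborel. f r) \<bullet> g s))"
    using lborel_pair.integral_snd[of "\<lambda>r s. indicator ?L (r, s) *\<^sub>R (f0 r \<bullet> g0 s)"]
      lborel_pair.integrable_snd[of "\<lambda>r s. indicator ?L (r, s) *\<^sub>R (f0 r \<bullet> g0 s)"] intL L1
    by (simp_all add: case_prod_beta')
  have U2: "(\<integral>x. indicator ?U x *\<^sub>R (f0 (fst x) \<bullet> g0 (snd x)) \<partial>(lborel \<Otimes>\<^sub>M lborel))
      = (\<integral>s. indicator {0..t} s *\<^sub>R ((LINT r:{0..s}|lborel. g r) \<bullet> f s) \<partial>lborel)"
    "integrable lborel (\<lambda>s. indicator {0..t} s *\<^sub>R ((LINT r:{0..s}|lborel. g r) \<bullet> f s))"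
    using lborel_pair.integral_fst'[OF intU] lborel_pair.integrable_fst'[OF intU] U1 by simp_all
  show ?thesis
    unfolding main L2(1) U2(1) Bochner_Integration.integral_add[OF L2(2) U2(2), symmetric]
    by (simp add: set_lebesgue_integral_def scaleR_add_right distrib_left)
qed

context wiener
begin

section \<open>The product rule\<close>

definition drift :: "(real \<Rightarrow> 'a \<Rightarrow> 'b::euclidean_space) \<Rightarrow> real \<Rightarrow> 'a \<Rightarrow> 'b" where
  "drift b t \<omega> = (LINT s:{0..t}|lborel. b s \<omega>)"

lemma L2ad_integrable: "L2ad b \<Longrightarrow> t \<le> T \<Longrightarrow> integrable (P t) (unc b)"
  using finite_measure.sqint_imp_integrable[OF finite_measure_P L2ad_sqint] by blast

text \<open>Cauchy-Schwarz on [0,s]; the factor \<open>s\<close> and the inner integral are then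
  enlarged to [0,T], which makes the bound independent of \<open>s\<close>.\<close>

lemma drift_norm_bound:
  assumes b: "L2ad b" and s: "s \<in> {0..T}"
  shows "AE \<omega> in M. (norm (drift b s \<omega>))\<^sup>2 \<le> T * (LINT r:{0..T}|lborel. (norm (b r \<omega>))\<^sup>2)"
  using P_AE_integrable_time[OF L2ad_integrable[OF b order_refl]]
    P_AE_integrable_time[OF sqint_integrable[OF L2ad_sqint[OF b order_refl]]]
proof eventually_elim
  case (elim \<omega>)
  let ?N = "restrict_space lborel {0..s} :: real measure"
  have sub: "{0..s} \<subseteq> {0..T}" using s by auto
  have i1: "set_integrable lborel {0..s} (\<lambda>r. b r \<omega>)" "set_integrable lborel {0..s} (\<lambda>r. (norm (b r \<omega>))\<^sup>2)"
    using elim by (auto intro: set_integrable_subset[OF _ _ sub])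
  have sq: "sqint ?N (\<lambda>r. b r \<omega>)"
    using i1 unfolding sqint_def set_integrable_def
    by (simp add: integrable_restrict_space borel_measurable_restrict_space_iff)
  interpret N: finite_measure ?N
    by standard (simp add: emeasure_restrict_space space_restrict_space emeasure_lborel_Icc_eq)
  have m: "measure ?N (space ?N) = s"
    using s by (simp add: measure_restrict_space space_restrict_space)
  have "(norm (drift b s \<omega>))\<^sup>2 \<le> s * (LINT r:{0..s}|lborel. (norm (b r \<omega>))\<^sup>2)"
    using N.norm_integral_squared_le[OF sq] unfolding m
    by (simp add: integral_restrict_space drift_def set_lebesgue_integral_def)
  also have "\<dots> \<le> T * (LINT r:{0..T}|lborel. (norm (b r \<omega>))\<^sup>2)"
  proof (rule mult_mono)
    show "(LINT r:{0..s}|lborel. (norm (b r \<omega>))\<^sup>2) \<le> (LINT r:{0..T}|lborel. (norm (b r \<omega>))\<^sup>2)"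
      using i1(2) elim sub unfolding set_lebesgue_integral_def set_integrable_def
      by (intro integral_mono) (auto simp: indicator_def)
    show "0 \<le> (LINT r:{0..s}|lborel. (norm (b r \<omega>))\<^sup>2)"
      unfolding set_lebesgue_integral_def by simp
  qed (use s T_pos in auto)
  finally show ?case .
qed

lemma drift_uniform_bound:
  assumes b: "L2ad b"
  obtains C where "C < \<infinity>" "\<And>s. s \<in> {0..T} \<Longrightarrow> (\<integral>\<^sup>+\<omega>. ennreal ((norm (drift b s \<omega>))\<^sup>2) \<partial>M) \<le> C"
proof
  let ?B = "\<lambda>\<omega>. T * (LINT r:{0..T}|lborel. (norm (b r \<omega>))\<^sup>2)"
  have "integrable M ?B"
    using P_integrable_time[OF sqint_integrable[OF L2ad_sqint[OF b order_refl]]] by simp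
  then have "(\<integral>\<^sup>+\<omega>. ennreal (norm (?B \<omega>)) \<partial>M) < \<infinity>"
    unfolding integrable_iff_bounded by blast
  moreover have "norm (?B \<omega>) = ?B \<omega>" for \<omega>
    using T_pos by (simp add: set_lebesgue_integral_def)
  ultimately show "(\<integral>\<^sup>+\<omega>. ennreal (?B \<omega>) \<partial>M) < \<infinity>" by simp
  show "(\<integral>\<^sup>+\<omega>. ennreal ((norm (drift b s \<omega>))\<^sup>2) \<partial>M) \<le> (\<integral>\<^sup>+\<omega>. ennreal (?B \<omega>) \<partial>M)" if "s \<in> {0..T}" for s
    using drift_norm_bound[OF b that]
    by (intro nn_integral_mono_AE) (auto elim!: eventually_mono intro: ennreal_leI)
qed

lemma sqint_drift:
  assumes b: "L2ad b" and s: "s \<in> {0..T}"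
  shows "sqint M (drift b s)"
proof -
  obtain C where "C < \<infinity>" "(\<integral>\<^sup>+\<omega>. ennreal ((norm (drift b s \<omega>))\<^sup>2) \<partial>M) \<le> C"
    by (rule drift_uniform_bound[OF b]) (use s in blast)
  moreover have "drift b s \<in> borel_measurable M"
    using borel_measurable_integrable[OF P_integrable_time[OF L2ad_integrable[OF b, of s]]] s
    by (simp add: drift_def[abs_def])
  ultimately show ?thesis by (auto simp: sqint_iff_nn_integral)
qed

text \<open>The variable upper limit becomes a truncation of the integrand on
  \<open>P T \<Otimes>\<^sub>M lborel\<close>, to which measurability of parametric integrals
  applies. The extension \<open>b0\<close> of \<open>b\<close> by zero is measurable on the whole
  product space.\<close>

lemma measurable_drift:
  assumes b: "L2ad b"
  shows "unc (drift b) \<in> borel_measurable (P T)"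
proof -
  define b0 where "b0 x = indicator ({0..T} \<times> space M) x *\<^sub>R unc b x" for x
  have b0[measurable]: "b0 \<in> borel_measurable (lborel \<Otimes>\<^sub>M M)"
    using sqint_measurable[OF L2ad_sqint[OF b order_refl]] unfolding P_def b0_def[abs_def]
    by (subst (asm) borel_measurable_restrict_space_iff[OF P_region_Int])
  have f1: "(\<lambda>y. fst (fst y)) \<in> borel_measurable (P T \<Otimes>\<^sub>M lborel)"
    using measurable_compose[OF measurable_fst measurable_P_fst, of T lborel] by simp
  have f2: "snd \<in> borel_measurable (P T \<Otimes>\<^sub>M lborel)"
    using measurable_snd[of "P T" lborel] by simp
  have f3: "(\<lambda>y. b0 (snd y, snd (fst y))) \<in> borel_measurable (P T \<Otimes>\<^sub>M lborel)"
    by (rule measurable_compose[OF measurable_Pair b0])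
      (rule measurable_snd measurable_compose[OF measurable_fst measurable_P_snd])+
  have "(\<lambda>y. if 0 \<le> snd y \<and> snd y \<le> fst (fst y) then b0 (snd y, snd (fst y)) else 0)
      \<in> borel_measurable (P T \<Otimes>\<^sub>M lborel)"
  proof (rule measurable_If[OF f3 measurable_const])
    note f1[measurable] f2[measurable]
    show "{y \<in> space (P T \<Otimes>\<^sub>M lborel). 0 \<le> snd y \<and> snd y \<le> fst (fst y)} \<in> sets (P T \<Otimes>\<^sub>M lborel)"
      by measurable
  qed simp
  then have "(\<lambda>x. \<integral>r. (if 0 \<le> r \<and> r \<le> fst x then b0 (r, snd x) else 0) \<partial>lborel) \<in> borel_measurable (P T)"
    by (intro lborel.borel_measurable_lebesgue_integral) (simp add: case_prod_beta')
  moreover have "(\<integral>r. (if 0 \<le> r \<and> r \<le> fst x then b0 (r, snd x) else 0) \<partial>lborel) = unc (drift b) x"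
    if "x \<in> space (P T)" for x
    unfolding drift_def set_lebesgue_integral_def
    using that by (intro Bochner_Integration.integral_cong refl) (auto simp: b0_def indicator_def space_P)
  ultimately show ?thesis by (subst measurable_cong[of "P T" "unc (drift b)"]) auto
qed

lemma sqint_P_drift:
  assumes b: "L2ad b" and t: "t \<le> T"
  shows "sqint (P t) (unc (drift b))"
proof -
  obtain C where C: "C < \<infinity>" "\<And>s. s \<in> {0..T} \<Longrightarrow> (\<integral>\<^sup>+\<omega>. ennreal ((norm (drift b s \<omega>))\<^sup>2) \<partial>M) \<le> C"
    by (rule drift_uniform_bound[OF b]) (rule that)
  have "sqint (P T) (unc (drift b))"
    by (rule sqint_P_uniform[OF measurable_drift[OF b] _ C(1)]) (simp add: C(2))
  then show ?thesis by (rule sqint_P_mono[OF t])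
qed

lemma sqint_P_snd:
  assumes Q: "sqint M Q"
  shows "sqint (P t) (\<lambda>x. Q (snd x))"
proof (rule sqint_P_uniform)
  show "(\<lambda>x. Q (snd x)) \<in> borel_measurable (P t)"
    by (rule measurable_compose[OF measurable_P_snd sqint_measurable[OF Q]])
  show "(\<integral>\<^sup>+\<omega>. ennreal ((norm (Q (snd (s, \<omega>))))\<^sup>2) \<partial>M) \<le> (\<integral>\<^sup>+\<omega>. ennreal ((norm (Q \<omega>))\<^sup>2) \<partial>M)" for s
    by simp
  show "(\<integral>\<^sup>+\<omega>. ennreal ((norm (Q \<omega>))\<^sup>2) \<partial>M) < \<infinity>"
    using Q by (simp add: sqint_iff_nn_integral)
qed

lemma integral_drift_inner:
  assumes b: "L2ad b" and t: "t \<in> {0..T}" and Q: "sqint M Q"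
  shows "(\<integral>\<omega>. drift b t \<omega> \<bullet> Q \<omega> \<partial>M) = (\<integral>x. unc b x \<bullet> Q (snd x) \<partial>P t)"
proof -
  have tT: "t \<le> T" using t by simp
  have "AE \<omega> in M. drift b t \<omega> \<bullet> Q \<omega> = (LINT s:{0..t}|lborel. b s \<omega> \<bullet> Q \<omega>)"
    using P_AE_integrable_time[OF L2ad_integrable[OF b tT]]
  proof eventually_elim
    case (elim \<omega>)
    then show ?case
      by (simp add: drift_def set_lebesgue_integral_def set_integrable_def flip: integral_inner_left inner_scaleR_left)
  qed
  moreover note i = sqint_inner_integrable[OF L2ad_sqint[OF b tT] sqint_P_snd[OF Q]]
  ultimately show ?thesis
    unfolding P_integral_time[OF i]
    using P_integrable_time[OF i] sqint_inner_integrable[OF sqint_drift[OF b t] Q]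
    by (intro integral_cong_AE) auto
qed

text \<open>The product formula for two primitives holds along almost every path; Fubini turns its
  expectation into integrals over \<open>P t\<close>.\<close>

lemma integral_drift_drift:
  assumes b: "L2ad b" and b': "L2ad b'" and t: "t \<in> {0..T}"
  shows "(\<integral>\<omega>. drift b t \<omega> \<bullet> drift b' t \<omega> \<partial>M)
    = (\<integral>x. unc (drift b) x \<bullet> unc b' x \<partial>P t) + (\<integral>x. unc (drift b') x \<bullet> unc b x \<partial>P t)"
proof -
  have tT: "t \<le> T" using t by simp
  let ?f = "\<lambda>x. unc (drift b) x \<bullet> unc b' x + unc (drift b') x \<bullet> unc b x"
  have i: "integrable (P t) (\<lambda>x. unc (drift b) x \<bullet> unc b' x)"
    "integrable (P t) (\<lambda>x. unc (drift b') x \<bullet> unc b x)"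
    by (intro sqint_inner_integrable sqint_P_drift L2ad_sqint b b' tT)+
  then have ifx: "integrable (P t) ?f" by simp
  have "AE \<omega> in M. drift b t \<omega> \<bullet> drift b' t \<omega> = (LINT s:{0..t}|lborel. ?f (s, \<omega>))"
    using P_AE_integrable_time[OF L2ad_integrable[OF b tT]] P_AE_integrable_time[OF L2ad_integrable[OF b' tT]]
  proof eventually_elim
    case (elim \<omega>)
    then show ?case
      using integral_product_triangle[of t "\<lambda>s. b s \<omega>" "\<lambda>s. b' s \<omega>"] by (simp add: drift_def)
  qed
  then have "(\<integral>\<omega>. drift b t \<omega> \<bullet> drift b' t \<omega> \<partial>M) = (\<integral>x. ?f x \<partial>P t)"
    unfolding P_integral_time[OF ifx]
    using P_integrable_time[OF ifx] sqint_inner_integrable[OF sqint_drift[OF b t] sqint_drift[OF b' t]]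
    by (intro integral_cong_AE) auto
  also have "\<dots> = (\<integral>x. unc (drift b) x \<bullet> unc b' x \<partial>P t) + (\<integral>x. unc (drift b') x \<bullet> unc b x \<partial>P t)"
    using i by simp
  finally show ?thesis .
qed

text \<open>Adds to \<open>ito_differential\<close>, where the drift is only integrable along paths,
  the square integrability that makes the mixed moments in the product rule finite.\<close>

definition ito_process :: "(real \<Rightarrow> 'a \<Rightarrow> 'b::euclidean_space) \<Rightarrow> (real \<Rightarrow> 'a \<Rightarrow> 'b) \<Rightarrow>
    (real \<Rightarrow> 'a \<Rightarrow> 'b) \<Rightarrow> (real \<Rightarrow> 'a \<Rightarrow> 'b) \<Rightarrow> bool" where
  "ito_process U b \<sigma>1 \<sigma>2 \<longleftrightarrow> U \<in> S2_proc M F T \<and> L2ad b \<and> L2ad \<sigma>1 \<and> L2ad \<sigma>2 \<and>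
     ito_differential M F T W1 W2 U b \<sigma>1 \<sigma>2"

text \<open>The martingale part, defined as a remainder and not as a sum of Ito integrals: those
  exist as random variables only separately for each time and up to null sets, whereas the remainder
  is jointly measurable and can be integrated over time.\<close>

definition mpart :: "(real \<Rightarrow> 'a \<Rightarrow> 'b::euclidean_space) \<Rightarrow> (real \<Rightarrow> 'a \<Rightarrow> 'b) \<Rightarrow> real \<Rightarrow> 'a \<Rightarrow> 'b" where
  "mpart U b t \<omega> = U t \<omega> - U 0 \<omega> - drift b t \<omega>"

lemma mpart_ito:
  assumes U: "ito_process U b \<sigma>1 \<sigma>2" and t: "t \<in> {0..T}"
  obtains I1 I2 where "has_ito_integral M F T (Wn False) \<sigma>1 t I1" "has_ito_integral M F T (Wn True) \<sigma>2 t I2"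
    "AE \<omega> in M. mpart U b t \<omega> = I1 \<omega> + I2 \<omega>"
proof -
  from U t obtain I1 I2 where I: "has_ito_integral M F T W1 \<sigma>1 t I1" "has_ito_integral M F T W2 \<sigma>2 t I2"
    "AE \<omega> in M. U t \<omega> = U 0 \<omega> + (LINT s:{0..t}|lborel. b s \<omega>) + I1 \<omega> + I2 \<omega>"
    unfolding ito_process_def ito_differential_def by blast
  have "AE \<omega> in M. mpart U b t \<omega> = I1 \<omega> + I2 \<omega>"
    using I(3) by eventually_elim (simp add: mpart_def drift_def)
  with I(1,2) that show ?thesis by (simp add: Wn_def)
qed

lemma sqint_mpart:
  assumes U: "ito_process U b \<sigma>1 \<sigma>2" and t: "t \<in> {0..T}"
  shows "sqint M (mpart U b t)"
  unfolding mpart_def[abs_def]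
  using U t T_pos by (intro sqint_diff sqint_drift S2_proc_sqint) (auto simp: ito_process_def)

lemma sqint_P_mpart:
  assumes U: "ito_process U b \<sigma>1 \<sigma>2" and t: "t \<le> T"
  shows "sqint (P t) (unc (mpart U b))"
  unfolding mpart_def
  using U t T_pos by (intro sqint_diff sqint_P_drift L2ad_sqint[OF S2_proc_L2ad] sqint_P_snd[OF S2_proc_sqint])
    (auto simp: ito_process_def)

lemma mpart_martingale:
  assumes U: "ito_process U b \<sigma>1 \<sigma>2" and st: "0 \<le> s" "s \<le> t" "t \<le> T"
    and Q: "Q \<in> borel_measurable (F s)" "sqint M Q"
  shows "(\<integral>\<omega>. mpart U b t \<omega> \<bullet> Q \<omega> \<partial>M) = (\<integral>\<omega>. mpart U b s \<omega> \<bullet> Q \<omega> \<partial>M)"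
proof -
  have t: "t \<in> {0..T}" and s: "s \<in> {0..T}" using st by auto
  obtain I1 I2 where I: "has_ito_integral M F T (Wn False) \<sigma>1 t I1" "has_ito_integral M F T (Wn True) \<sigma>2 t I2"
    "AE \<omega> in M. mpart U b t \<omega> = I1 \<omega> + I2 \<omega>" by (rule mpart_ito[OF U t]) (rule that)
  obtain K1 K2 where K: "has_ito_integral M F T (Wn False) \<sigma>1 s K1" "has_ito_integral M F T (Wn True) \<sigma>2 s K2"
    "AE \<omega> in M. mpart U b s \<omega> = K1 \<omega> + K2 \<omega>" by (rule mpart_ito[OF U s]) (rule that)
  have *: "(\<integral>\<omega>. mpart U b r \<omega> \<bullet> Q \<omega> \<partial>M) = (\<integral>\<omega>. L1 \<omega> \<bullet> Q \<omega> \<partial>M) + (\<integral>\<omega>. L2 \<omega> \<bullet> Q \<omega> \<partial>M)"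
    if L: "sqint M L1" "sqint M L2" "AE \<omega> in M. mpart U b r \<omega> = L1 \<omega> + L2 \<omega>" and r: "r \<in> {0..T}" for r L1 L2
  proof -
    note i = sqint_inner_integrable[OF L(1) Q(2)] sqint_inner_integrable[OF L(2) Q(2)]
    have "(\<integral>\<omega>. mpart U b r \<omega> \<bullet> Q \<omega> \<partial>M) = (\<integral>\<omega>. L1 \<omega> \<bullet> Q \<omega> + L2 \<omega> \<bullet> Q \<omega> \<partial>M)"
    proof (rule integral_cong_AE)
      show "AE \<omega> in M. mpart U b r \<omega> \<bullet> Q \<omega> = L1 \<omega> \<bullet> Q \<omega> + L2 \<omega> \<bullet> Q \<omega>"
        using L(3) by eventually_elim (simp add: inner_add_left)
    qed (use i sqint_inner_integrable[OF sqint_mpart[OF U r] Q(2)] in auto)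
    then show ?thesis using i by simp
  qed
  show ?thesis
    using ito_martingale[OF I(1) K(1) st Q] ito_martingale[OF I(2) K(2) st Q]
      *[OF has_ito_integral_sqint[OF I(1) t] has_ito_integral_sqint[OF I(2) t] I(3) t]
      *[OF has_ito_integral_sqint[OF K(1) s] has_ito_integral_sqint[OF K(2) s] K(3) s]
    by simp
qed

text \<open>Of the four products of Ito integrals, the two that mix the Wiener components
  vanish.\<close>

lemma mpart_isometry:
  assumes U: "ito_process U b \<sigma>1 \<sigma>2" and V: "ito_process V b' \<tau>1 \<tau>2" and t: "t \<in> {0..T}"
  shows "(\<integral>\<omega>. mpart U b t \<omega> \<bullet> mpart V b' t \<omega> \<partial>M)
    = (\<integral>x. unc \<sigma>1 x \<bullet> unc \<tau>1 x \<partial>P t) + (\<integral>x. unc \<sigma>2 x \<bullet> unc \<tau>2 x \<partial>P t)"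
proof -
  obtain I1 I2 where I: "has_ito_integral M F T (Wn False) \<sigma>1 t I1" "has_ito_integral M F T (Wn True) \<sigma>2 t I2"
    "AE \<omega> in M. mpart U b t \<omega> = I1 \<omega> + I2 \<omega>" by (rule mpart_ito[OF U t]) (rule that)
  obtain K1 K2 where K: "has_ito_integral M F T (Wn False) \<tau>1 t K1" "has_ito_integral M F T (Wn True) \<tau>2 t K2"
    "AE \<omega> in M. mpart V b' t \<omega> = K1 \<omega> + K2 \<omega>" by (rule mpart_ito[OF V t]) (rule that)
  note sI = has_ito_integral_sqint[OF I(1) t] has_ito_integral_sqint[OF I(2) t]
  note sK = has_ito_integral_sqint[OF K(1) t] has_ito_integral_sqint[OF K(2) t]
  note i = sqint_inner_integrable[OF sI(1) sK(1)] sqint_inner_integrable[OF sI(1) sK(2)]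
    sqint_inner_integrable[OF sI(2) sK(1)] sqint_inner_integrable[OF sI(2) sK(2)]
  have "(\<integral>\<omega>. mpart U b t \<omega> \<bullet> mpart V b' t \<omega> \<partial>M)
      = (\<integral>\<omega>. I1 \<omega> \<bullet> K1 \<omega> + I1 \<omega> \<bullet> K2 \<omega> + (I2 \<omega> \<bullet> K1 \<omega> + I2 \<omega> \<bullet> K2 \<omega>) \<partial>M)"
  proof (rule integral_cong_AE)
    show "AE \<omega> in M. mpart U b t \<omega> \<bullet> mpart V b' t \<omega>
        = I1 \<omega> \<bullet> K1 \<omega> + I1 \<omega> \<bullet> K2 \<omega> + (I2 \<omega> \<bullet> K1 \<omega> + I2 \<omega> \<bullet> K2 \<omega>)"
      using I(3) K(3) by eventually_elim (simp add: inner_add_left inner_add_right)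
  qed (use i sqint_inner_integrable[OF sqint_mpart[OF U t] sqint_mpart[OF V t]] in auto)
  also have "\<dots> = (\<integral>\<omega>. I1 \<omega> \<bullet> K1 \<omega> \<partial>M) + (\<integral>\<omega>. I1 \<omega> \<bullet> K2 \<omega> \<partial>M) + ((\<integral>\<omega>. I2 \<omega> \<bullet> K1 \<omega> \<partial>M) + (\<integral>\<omega>. I2 \<omega> \<bullet> K2 \<omega> \<partial>M))"
    using i by simp
  finally show ?thesis
    by (simp add: ito_isometry[OF I(1) K(1) t] ito_isometry[OF I(1) K(2) t]
        ito_isometry[OF I(2) K(1) t] ito_isometry[OF I(2) K(2) t])
qed

text \<open>Fubini moves time outside, leaving E[N t \<bullet> b' s] with N the martingale part.
  Since \<open>b' s\<close> is known at time \<open>s\<close>, the martingale property replaces N t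
  by N s, which yields an integrand evaluated at a single time.\<close>

lemma mpart_drift:
  assumes U: "ito_process U b \<sigma>1 \<sigma>2" and b': "L2ad b'" and t: "t \<in> {0..T}"
  shows "(\<integral>\<omega>. mpart U b t \<omega> \<bullet> drift b' t \<omega> \<partial>M) = (\<integral>x. unc (mpart U b) x \<bullet> unc b' x \<partial>P t)"
proof -
  have tT: "t \<le> T" using t by simp
  note sm = sqint_mpart[OF U t]
  note i1 = sqint_inner_integrable[OF sqint_P_snd[OF sm] L2ad_sqint[OF b' tT]]
  note i2 = sqint_inner_integrable[OF sqint_P_mpart[OF U tT] L2ad_sqint[OF b' tT]]
  have "(\<integral>\<omega>. mpart U b t \<omega> \<bullet> drift b' t \<omega> \<partial>M) = (\<integral>x. mpart U b t (snd x) \<bullet> unc b' x \<partial>P t)"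
    using integral_drift_inner[OF b' t sm] by (simp add: inner_commute)
  also have "\<dots> = (LINT s:{0..t}|lborel. (\<integral>\<omega>. mpart U b t \<omega> \<bullet> b' s \<omega> \<partial>M))"
    using P_integral_omega[OF i1] by simp
  also have "\<dots> = (LINT s:{0..t}|lborel. (\<integral>\<omega>. mpart U b s \<omega> \<bullet> b' s \<omega> \<partial>M))"
    unfolding set_lebesgue_integral_def
  proof (rule integral_cong_AE)
    show "AE s in lborel. indicator {0..t} s *\<^sub>R (\<integral>\<omega>. mpart U b t \<omega> \<bullet> b' s \<omega> \<partial>M)
        = indicator {0..t} s *\<^sub>R (\<integral>\<omega>. mpart U b s \<omega> \<bullet> b' s \<omega> \<partial>M)"
      \<comment> \<open>Square integrability of \<open>b' s\<close> is known for almost every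
        \<open>s\<close>, which suffices under the time integral.\<close>
      using P_AE_integrable_omega[OF sqint_integrable[OF L2ad_sqint[OF b' tT]]]
    proof eventually_elim
      case (elim s)
      show ?case
      proof (cases "s \<in> {0..t}")
        case True
        then have s: "s \<in> {0..T}" using t by auto
        have "sqint M (b' s)" using elim True L2ad_measurable[OF b' s] by (simp add: sqint_def)
        from mpart_martingale[OF U _ _ tT L2ad_adapted[OF b' s] this] show ?thesis using True by simp
      qed simp
    qed
  qed (use P_integrable_omega[OF i1] P_integrable_omega[OF i2] in \<open>auto simp: set_integrable_def\<close>)
  also have "\<dots> = (\<integral>x. unc (mpart U b) x \<bullet> unc b' x \<partial>P t)"
    using P_integral_omega[OF i2] by simp
  finally show ?thesis .
qed

lemma mpart_initial:
  assumes U: "ito_process U b \<sigma>1 \<sigma>2" and t: "t \<in> {0..T}" and Q: "Q \<in> borel_measurable (F 0)" "sqint M Q"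
  shows "(\<integral>\<omega>. mpart U b t \<omega> \<bullet> Q \<omega> \<partial>M) = 0"
proof -
  \<comment> \<open>The drift at time 0 is an integral over the null set {0}.\<close>
  have "mpart U b 0 \<omega> = 0" for \<omega>
    by (simp add: mpart_def drift_def set_lebesgue_integral_def)
      (rule integral_eq_zero_AE, use AE_lborel_singleton[of 0] in \<open>auto elim!: eventually_mono\<close>)
  then show ?thesis using mpart_martingale[OF U order_refl _ _ Q, of t] t by simp
qed

text \<open>The integrand of Ito's product formula in expectation: two drift terms and the
  covariation of the martingale parts.\<close>

definition prod_density where
  "prod_density U b \<sigma>1 \<sigma>2 V b' \<tau>1 \<tau>2 x =
     unc U x \<bullet> unc b' x + unc b x \<bullet> unc V x + unc \<sigma>1 x \<bullet> unc \<tau>1 x + unc \<sigma>2 x \<bullet> unc \<tau>2 x"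

text \<open>Of the nine products, those of an initial value with a martingale part vanish. The
  others that contain a drift are regrouped by its density: \<open>b'\<close> is paired with initial
  value, drift and martingale part of \<open>U\<close>, which add up to \<open>U\<close>, and
  \<open>b\<close> likewise with \<open>V\<close>. The two martingale parts give the
  covariation.\<close>

lemma product_rule:
  assumes U: "ito_process U b \<sigma>1 \<sigma>2" and V: "ito_process V b' \<tau>1 \<tau>2" and t: "t \<in> {0..T}"
  shows "(\<integral>\<omega>. U t \<omega> \<bullet> V t \<omega> \<partial>M)
    = (\<integral>\<omega>. U 0 \<omega> \<bullet> V 0 \<omega> \<partial>M) + (\<integral>x. prod_density U b \<sigma>1 \<sigma>2 V b' \<tau>1 \<tau>2 x \<partial>P t)"
proof -
  have tT: "t \<le> T" and z: "0 \<in> {0..T}" using t by auto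
  have b: "L2ad b" "L2ad b'" "L2ad \<sigma>1" "L2ad \<sigma>2" "L2ad \<tau>1" "L2ad \<tau>2"
    using U V by (auto simp: ito_process_def)
  have S2: "U \<in> S2_proc M F T" "V \<in> S2_proc M F T" using U V by (auto simp: ito_process_def)
  note s0 = S2_proc_sqint[OF S2(1) z] S2_proc_sqint[OF S2(2) z]
  note m0 = S2_proc_adapted[OF S2(1) z] S2_proc_adapted[OF S2(2) z]
  note sd = sqint_drift[OF b(1) t] sqint_drift[OF b(2) t]
  note sm = sqint_mpart[OF U t] sqint_mpart[OF V t]
  let ?D = "drift b" and ?D' = "drift b'" and ?N = "mpart U b" and ?N' = "mpart V b'"
  have dec: "U s \<omega> = U 0 \<omega> + ?D s \<omega> + ?N s \<omega>" "V s \<omega> = V 0 \<omega> + ?D' s \<omega> + ?N' s \<omega>" for s \<omega>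
    by (simp_all add: mpart_def)
  note I = sqint_inner_integrable
  have "(\<integral>\<omega>. U t \<omega> \<bullet> V t \<omega> \<partial>M) = (\<integral>\<omega>. U 0 \<omega> \<bullet> V 0 \<omega> + ?D' t \<omega> \<bullet> U 0 \<omega> + ?N' t \<omega> \<bullet> U 0 \<omega>
      + ?D t \<omega> \<bullet> V 0 \<omega> + ?D t \<omega> \<bullet> ?D' t \<omega> + ?N' t \<omega> \<bullet> ?D t \<omega>
      + ?N t \<omega> \<bullet> V 0 \<omega> + ?N t \<omega> \<bullet> ?D' t \<omega> + ?N t \<omega> \<bullet> ?N' t \<omega> \<partial>M)"
    by (intro Bochner_Integration.integral_cong refl, subst dec(1), subst dec(2))
      (simp add: inner_add_left inner_add_right inner_commute algebra_simps)
  also have "\<dots> = (\<integral>\<omega>. U 0 \<omega> \<bullet> V 0 \<omega> \<partial>M) + (\<integral>\<omega>. ?D' t \<omega> \<bullet> U 0 \<omega> \<partial>M) + (\<integral>\<omega>. ?N' t \<omega> \<bullet> U 0 \<omega> \<partial>M)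
      + (\<integral>\<omega>. ?D t \<omega> \<bullet> V 0 \<omega> \<partial>M) + (\<integral>\<omega>. ?D t \<omega> \<bullet> ?D' t \<omega> \<partial>M) + (\<integral>\<omega>. ?N' t \<omega> \<bullet> ?D t \<omega> \<partial>M)
      + (\<integral>\<omega>. ?N t \<omega> \<bullet> V 0 \<omega> \<partial>M) + (\<integral>\<omega>. ?N t \<omega> \<bullet> ?D' t \<omega> \<partial>M) + (\<integral>\<omega>. ?N t \<omega> \<bullet> ?N' t \<omega> \<partial>M)"
    by (simp add: I[OF s0(1) s0(2)] I[OF sd(2) s0(1)] I[OF sm(2) s0(1)] I[OF sd(1) s0(2)] I[OF sd(1) sd(2)]
        I[OF sm(2) sd(1)] I[OF sm(1) s0(2)] I[OF sm(1) sd(2)] I[OF sm(1) sm(2)])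
  also have "\<dots> = (\<integral>\<omega>. U 0 \<omega> \<bullet> V 0 \<omega> \<partial>M) + (\<integral>x. unc b' x \<bullet> U 0 (snd x) \<partial>P t)
      + (\<integral>x. unc b x \<bullet> V 0 (snd x) \<partial>P t)
      + ((\<integral>x. unc ?D x \<bullet> unc b' x \<partial>P t) + (\<integral>x. unc ?D' x \<bullet> unc b x \<partial>P t)) + (\<integral>x. unc ?N' x \<bullet> unc b x \<partial>P t)
      + (\<integral>x. unc ?N x \<bullet> unc b' x \<partial>P t)
      + ((\<integral>x. unc \<sigma>1 x \<bullet> unc \<tau>1 x \<partial>P t) + (\<integral>x. unc \<sigma>2 x \<bullet> unc \<tau>2 x \<partial>P t))"
    by (simp add: integral_drift_inner[OF b(2) t s0(1)] integral_drift_inner[OF b(1) t s0(2)]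
        mpart_initial[OF U t m0(2) s0(2)] mpart_initial[OF V t m0(1) s0(1)]
        integral_drift_drift[OF b(1,2) t] mpart_drift[OF U b(2) t] mpart_drift[OF V b(1) t]
        mpart_isometry[OF U V t])
  also have "\<dots> = (\<integral>\<omega>. U 0 \<omega> \<bullet> V 0 \<omega> \<partial>M) + (\<integral>x. unc b' x \<bullet> U 0 (snd x) + unc b x \<bullet> V 0 (snd x)
      + (unc ?D x \<bullet> unc b' x + unc ?D' x \<bullet> unc b x) + unc ?N' x \<bullet> unc b x + unc ?N x \<bullet> unc b' x
      + (unc \<sigma>1 x \<bullet> unc \<tau>1 x + unc \<sigma>2 x \<bullet> unc \<tau>2 x) \<partial>P t)"
    by (simp add: I[OF L2ad_sqint[OF b(2) tT] sqint_P_snd[OF s0(1)]] I[OF L2ad_sqint[OF b(1) tT] sqint_P_snd[OF s0(2)]]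
        I[OF sqint_P_drift[OF b(1) tT] L2ad_sqint[OF b(2) tT]] I[OF sqint_P_drift[OF b(2) tT] L2ad_sqint[OF b(1) tT]]
        I[OF sqint_P_mpart[OF U tT] L2ad_sqint[OF b(2) tT]] I[OF sqint_P_mpart[OF V tT] L2ad_sqint[OF b(1) tT]]
        I[OF L2ad_sqint[OF b(3) tT] L2ad_sqint[OF b(5) tT]] I[OF L2ad_sqint[OF b(4) tT] L2ad_sqint[OF b(6) tT]])
  also have "(\<integral>x. unc b' x \<bullet> U 0 (snd x) + unc b x \<bullet> V 0 (snd x)
      + (unc ?D x \<bullet> unc b' x + unc ?D' x \<bullet> unc b x) + unc ?N' x \<bullet> unc b x + unc ?N x \<bullet> unc b' x
      + (unc \<sigma>1 x \<bullet> unc \<tau>1 x + unc \<sigma>2 x \<bullet> unc \<tau>2 x) \<partial>P t) = (\<integral>x. prod_density U b \<sigma>1 \<sigma>2 V b' \<tau>1 \<tau>2 x \<partial>P t)"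
    unfolding prod_density_def
  proof (intro Bochner_Integration.integral_cong refl)
    fix x
    show "unc b' x \<bullet> U 0 (snd x) + unc b x \<bullet> V 0 (snd x)
      + (unc ?D x \<bullet> unc b' x + unc ?D' x \<bullet> unc b x) + unc ?N' x \<bullet> unc b x + unc ?N x \<bullet> unc b' x
      + (unc \<sigma>1 x \<bullet> unc \<tau>1 x + unc \<sigma>2 x \<bullet> unc \<tau>2 x)
      = unc U x \<bullet> unc b' x + unc b x \<bullet> unc V x + unc \<sigma>1 x \<bullet> unc \<tau>1 x + unc \<sigma>2 x \<bullet> unc \<tau>2 x"
      unfolding dec(1)[of "fst x" "snd x"] dec(2)[of "fst x" "snd x"]
      by (simp add: inner_add_left inner_add_right inner_commute)
  qed
  finally show ?thesis .
qed

end

text \<open>Iterating the inequality \<open>n\<close> times yields the bound C (L (T - t))^n / n!,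
  up to the factor \<open>C\<close> the general term of the exponential series and hence a null
  sequence. The a priori bound \<open>C\<close> starts the iteration.\<close>

lemma backward_Gronwall:
  fixes g :: "real \<Rightarrow> real"
  assumes g: "set_integrable lborel {0..T} g"
    and nn: "\<And>t. t \<in> {0..T} \<Longrightarrow> 0 \<le> g t" and C: "\<And>t. t \<in> {0..T} \<Longrightarrow> g t \<le> C"
    and L: "0 \<le> L" and le: "\<And>t. t \<in> {0..T} \<Longrightarrow> g t \<le> L * (LINT s:{t..T}|lborel. g s)"
    and t: "t \<in> {0..T}"
  shows "g t = 0"
proof -
  have iter: "g t \<le> C * (L * (T - t)) ^ n / fact n" if "t \<in> {0..T}" for n t
    using that
  proof (induction n arbitrary: t)
    case 0
    then show ?case using C by simp
  next
    case (Suc n)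
    let ?f = "\<lambda>s. C * (L * (T - s)) ^ n / fact n"
    have tT: "t \<le> T" and sub: "{t..T} \<subseteq> {0..T}" using Suc.prems by auto
    \<comment> \<open>Antiderivative of \<open>L\<close> times the previous bound; it vanishes at
      \<open>s = T\<close>.\<close>
    have deriv: "((\<lambda>s. - (C * (L * (T - s)) ^ Suc n / fact (Suc n))) has_vector_derivative L * ?f s)
        (at s within {t..T})" for s
      unfolding has_real_derivative_iff_has_vector_derivative[symmetric]
      by (rule derivative_eq_intros refl | simp)+
    have cont: "continuous_on {t..T} (\<lambda>s. L * ?f s)" "continuous_on {t..T} ?f"
      by (intro continuous_intros; simp)+
    have "g t \<le> L * (LINT s:{t..T}|lborel. g s)"
      by (rule le[OF Suc.prems])
    also have "\<dots> \<le> L * (LINT s:{t..T}|lborel. ?f s)"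
    proof (intro mult_left_mono L set_integral_mono)
      show "set_integrable lborel {t..T} g"
        by (rule set_integrable_subset[OF g _ sub]) simp
      show "set_integrable lborel {t..T} ?f"
        by (rule borel_integrable_atLeastAtMost'[OF cont(2)])
      show "g s \<le> ?f s" if "s \<in> {t..T}" for s
        using Suc.IH sub that by blast
    qed
    also have "\<dots> = (\<integral>s. indicator {t..T} s *\<^sub>R (L * ?f s) \<partial>lborel)"
      unfolding set_lebesgue_integral_def by (simp flip: integral_mult_right_zero add: algebra_simps)
    also have "\<dots> = C * (L * (T - t)) ^ Suc n / fact (Suc n)"
      by (subst integral_FTC_atLeastAtMost[OF tT deriv cont(1)]) simp
    finally show ?case .
  qed
  have "(\<lambda>n. C * (inverse (fact n) * (L * (T - t)) ^ n)) \<longlonglongrightarrow> C * 0"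
    by (intro tendsto_mult tendsto_const summable_LIMSEQ_zero summable_exp)
  then have "(\<lambda>n. C * (L * (T - t)) ^ n / fact n) \<longlonglongrightarrow> 0"
    by (simp add: field_simps)
  then have "g t \<le> 0"
    by (rule LIMSEQ_le_const) (use iter[OF t] in auto)
  then show ?thesis using nn[OF t] by simp
qed

lemma inner_transpose_mult:
  fixes A :: "real^'n^'m"
  shows "(transpose A *v x) \<bullet> y = x \<bullet> (A *v y)"
  by (simp add: dot_lmul_matrix)

context wiener
begin

section \<open>Linear coefficients\<close>

lemma Linf_bound:
  assumes "A \<in> Linf T"
  obtains K where "0 \<le> K" "\<And>t. t \<in> {0..T} \<Longrightarrow> norm (A t) \<le> K"
proof -
  obtain K where "\<forall>t\<in>{0..T}. norm (A t) \<le> K" using assms by (auto simp: Linf_def)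
  then show ?thesis by (intro that[of "\<bar>K\<bar>"]) (auto intro: order_trans[OF _ abs_ge_self])
qed

lemma Linf_mult_bound:
  fixes A :: "real \<Rightarrow> real^'n^'m"
  assumes "A \<in> Linf T"
  obtains K where "0 \<le> K" "\<And>t x. t \<in> {0..T} \<Longrightarrow> norm (A t *v x) \<le> K * norm x"
proof -
  obtain K where K: "0 \<le> K" "\<And>t. t \<in> {0..T} \<Longrightarrow> norm (A t) \<le> K" by (rule Linf_bound[OF assms]) (rule that)
  obtain c where c: "0 < c" "\<And>(A :: real^'n^'m) x. norm (A *v x) \<le> norm A * norm x * c"
    using bounded_bilinear.pos_bounded[OF bounded_bilinear_matrix_vector_mult] by blast
  show ?thesis
  proof (rule that[of "K * c"])
    show "norm (A t *v x) \<le> K * c * norm x" if "t \<in> {0..T}" for t x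
    proof -
      have "norm (A t *v x) \<le> norm (A t) * (norm x * c)" using c(2)[of "A t" x] by (simp add: mult.assoc)
      also have "\<dots> \<le> K * (norm x * c)" using K(2)[OF that] c(1) by (intro mult_right_mono) auto
      finally show ?thesis by (simp add: algebra_simps)
    qed
  qed (use K c in auto)
qed

text \<open>The coefficient is measurable on [0,T] only, so it is composed with the time projection
  of \<open>P T\<close> into the restricted space.\<close>

lemma L2ad_mult:
  fixes A :: "real \<Rightarrow> real^'n^'m" and u :: "real \<Rightarrow> 'a \<Rightarrow> real^'n"
  assumes A: "A \<in> Linf T" and u: "L2ad u"
  shows "L2ad (\<lambda>t \<omega>. A t *v u t \<omega>)"
proof -
  obtain K where K: "0 \<le> K" "\<And>t x. t \<in> {0..T} \<Longrightarrow> norm (A t *v x) \<le> K * norm x"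
    by (rule Linf_mult_bound[OF A]) (rule that)
  have "fst \<in> measurable (P T) (restrict_space borel {0..T})"
    using measurable_P_fst[of T] by (intro measurable_restrict_space2) (auto simp: space_P)
  moreover have "A \<in> borel_measurable (restrict_space borel {0..T})" using A by (simp add: Linf_def)
  ultimately have Am: "(\<lambda>x. A (fst x)) \<in> borel_measurable (P T)"
    by (rule measurable_compose)
  have sq: "sqint (P T) (unc u)" by (rule L2ad_sqint[OF u order_refl])
  have "sqint (P T) (\<lambda>x. A (fst x) *v unc u x)"
  proof (rule sqint_mono[OF _ sq, of _ K])
    show "(\<lambda>x. A (fst x) *v unc u x) \<in> borel_measurable (P T)"
      by (rule borel_measurable_continuous_Pair[OF Am sqint_measurable[OF sq]])
        (intro bounded_bilinear.continuous_on[OF bounded_bilinear_matrix_vector_mult] continuous_intros)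
    show "AE x in P T. norm (A (fst x) *v unc u x) \<le> norm (K * norm (unc u x))"
      by (rule AE_I2) (use K in \<open>auto simp: space_P abs_mult\<close>)
  qed
  moreover have "(\<lambda>\<omega>. A t *v u t \<omega>) \<in> borel_measurable (F t)" if "t \<in> {0..T}" for t
    by (rule measurable_compose[OF L2ad_adapted[OF u that] borel_measurable_continuous_onI])
      (rule matrix_vector_mult_linear_continuous_on)
  ultimately show ?thesis by (simp add: L2ad_def adapted_def)
qed

lemma sqint_matrix_mult:
  fixes A :: "real^'n^'m"
  assumes "sqint M f"
  shows "sqint M (\<lambda>\<omega>. A *v f \<omega>)"
proof -
  obtain c where c: "0 < c" "\<And>(A :: real^'n^'m) x. norm (A *v x) \<le> norm A * norm x * c"
    using bounded_bilinear.pos_bounded[OF bounded_bilinear_matrix_vector_mult] by blast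
  show ?thesis
  proof (rule sqint_mono[OF _ assms, of _ "norm A * c"])
    show "(\<lambda>\<omega>. A *v f \<omega>) \<in> borel_measurable M"
      by (rule measurable_compose[OF sqint_measurable[OF assms] borel_measurable_continuous_onI])
        (rule matrix_vector_mult_linear_continuous_on)
    show "AE x in M. norm (A *v f x) \<le> norm (norm A * c * norm (f x))"
    proof (rule AE_I2)
      show "norm (A *v f x) \<le> norm (norm A * c * norm (f x))" for x
        using c(1) c(2)[of A "f x"] by (simp add: abs_mult mult_ac)
    qed
  qed
qed

lemma integrable_prod_density:
  assumes "L2ad U" "L2ad b" "L2ad \<sigma>1" "L2ad \<sigma>2" "L2ad V" "L2ad b'" "L2ad \<tau>1" "L2ad \<tau>2" "t \<le> T"
  shows "integrable (P t) (prod_density U b \<sigma>1 \<sigma>2 V b' \<tau>1 \<tau>2)"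
  unfolding prod_density_def[abs_def]
  by (intro Bochner_Integration.integrable_add sqint_inner_integrable L2ad_sqint assms)

lemma ito_processD:
  assumes "ito_process U b \<sigma>1 \<sigma>2"
  shows "L2ad U" "L2ad b" "L2ad \<sigma>1" "L2ad \<sigma>2" "t \<in> {0..T} \<Longrightarrow> sqint M (U t)"
  using assms S2_proc_L2ad S2_proc_sqint by (auto simp: ito_process_def)

abbreviation dif :: "(real \<Rightarrow> 'a \<Rightarrow> 'b::euclidean_space) \<Rightarrow> (real \<Rightarrow> 'a \<Rightarrow> 'b) \<Rightarrow> real \<Rightarrow> 'a \<Rightarrow> 'b" where
  "dif u w \<equiv> \<lambda>t \<omega>. u t \<omega> - w t \<omega>"

text \<open>Obtained from bilinearity of the product rule. Showing that the difference is itself an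
  Ito process would require adding Ito integrals, and thus merging the partitions of their
  approximations.\<close>

lemma product_rule_diff_right:
  assumes U: "ito_process U b \<sigma>1 \<sigma>2" and V: "ito_process V c \<tau>1 \<tau>2" and V': "ito_process V' c' \<tau>1' \<tau>2'"
    and t: "t \<in> {0..T}"
  shows "(\<integral>\<omega>. U t \<omega> \<bullet> dif V' V t \<omega> \<partial>M) = (\<integral>\<omega>. U 0 \<omega> \<bullet> dif V' V 0 \<omega> \<partial>M)
    + (\<integral>x. prod_density U b \<sigma>1 \<sigma>2 (dif V' V) (dif c' c) (dif \<tau>1' \<tau>1) (dif \<tau>2' \<tau>2) x \<partial>P t)"
proof -
  have z: "0 \<in> {0..T}" and tT: "t \<le> T" using t by auto
  note D = ito_processD[OF U] ito_processD[OF V] ito_processD[OF V']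
  have "(\<integral>x. prod_density U b \<sigma>1 \<sigma>2 (dif V' V) (dif c' c) (dif \<tau>1' \<tau>1) (dif \<tau>2' \<tau>2) x \<partial>P t)
     = (\<integral>x. prod_density U b \<sigma>1 \<sigma>2 V' c' \<tau>1' \<tau>2' x - prod_density U b \<sigma>1 \<sigma>2 V c \<tau>1 \<tau>2 x \<partial>P t)"
    by (intro Bochner_Integration.integral_cong refl) (simp add: prod_density_def inner_diff_right)
  also have "\<dots> = (\<integral>x. prod_density U b \<sigma>1 \<sigma>2 V' c' \<tau>1' \<tau>2' x \<partial>P t) - (\<integral>x. prod_density U b \<sigma>1 \<sigma>2 V c \<tau>1 \<tau>2 x \<partial>P t)"
    by (intro Bochner_Integration.integral_diff integrable_prod_density D tT)
  moreover have "(\<integral>\<omega>. U r \<omega> \<bullet> dif V' V r \<omega> \<partial>M) = (\<integral>\<omega>. U r \<omega> \<bullet> V' r \<omega> \<partial>M) - (\<integral>\<omega>. U r \<omega> \<bullet> V r \<omega> \<partial>M)"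
    if "r \<in> {0..T}" for r
    unfolding inner_diff_right
    by (intro Bochner_Integration.integral_diff sqint_inner_integrable D(5,10,15) that)
  ultimately show ?thesis
    using product_rule[OF U V t] product_rule[OF U V' t] z t by simp
qed

lemma product_rule_diff:
  assumes U: "ito_process U b \<sigma>1 \<sigma>2" and U': "ito_process U' b' \<sigma>1' \<sigma>2'"
    and V: "ito_process V c \<tau>1 \<tau>2" and V': "ito_process V' c' \<tau>1' \<tau>2'" and t: "t \<in> {0..T}"
  shows "(\<integral>\<omega>. dif U' U t \<omega> \<bullet> dif V' V t \<omega> \<partial>M) = (\<integral>\<omega>. dif U' U 0 \<omega> \<bullet> dif V' V 0 \<omega> \<partial>M)
    + (\<integral>x. prod_density (dif U' U) (dif b' b) (dif \<sigma>1' \<sigma>1) (dif \<sigma>2' \<sigma>2)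
        (dif V' V) (dif c' c) (dif \<tau>1' \<tau>1) (dif \<tau>2' \<tau>2) x \<partial>P t)"
proof -
  have z: "0 \<in> {0..T}" and tT: "t \<le> T" using t by auto
  note D = ito_processD[OF U] ito_processD[OF U'] ito_processD[OF V] ito_processD[OF V']
  let ?p = "\<lambda>U b \<sigma>1 \<sigma>2. prod_density U b \<sigma>1 \<sigma>2 (dif V' V) (dif c' c) (dif \<tau>1' \<tau>1) (dif \<tau>2' \<tau>2)"
  have "(\<integral>x. ?p (dif U' U) (dif b' b) (dif \<sigma>1' \<sigma>1) (dif \<sigma>2' \<sigma>2) x \<partial>P t)
     = (\<integral>x. ?p U' b' \<sigma>1' \<sigma>2' x - ?p U b \<sigma>1 \<sigma>2 x \<partial>P t)"
    by (intro Bochner_Integration.integral_cong refl) (simp add: prod_density_def inner_diff_left)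
  also have "\<dots> = (\<integral>x. ?p U' b' \<sigma>1' \<sigma>2' x \<partial>P t) - (\<integral>x. ?p U b \<sigma>1 \<sigma>2 x \<partial>P t)"
    by (intro Bochner_Integration.integral_diff integrable_prod_density L2ad_diff D tT)
  moreover have "(\<integral>\<omega>. dif U' U r \<omega> \<bullet> dif V' V r \<omega> \<partial>M)
      = (\<integral>\<omega>. U' r \<omega> \<bullet> dif V' V r \<omega> \<partial>M) - (\<integral>\<omega>. U r \<omega> \<bullet> dif V' V r \<omega> \<partial>M)"
    if "r \<in> {0..T}" for r
    unfolding inner_diff_left[of "U' r \<omega>" for \<omega>]
    by (intro Bochner_Integration.integral_diff sqint_inner_integrable sqint_diff D(5,10,15,20) that)
  ultimately show ?thesis
    using product_rule_diff_right[OF U V V' t] product_rule_diff_right[OF U' V V' t] z t by simp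
qed

section \<open>Uniqueness for the linear backward equation\<close>

lemma AE_zero_of_integral_norm_zero:
  assumes "sqint N f" "(\<integral>x. (norm (f x))\<^sup>2 \<partial>N) = 0"
  shows "AE x in N. f x = 0"
proof -
  have "AE x in N. (norm (f x))\<^sup>2 = 0"
    using assms integral_nonneg_eq_0_iff_AE[of N "\<lambda>x. (norm (f x))\<^sup>2"] by (simp add: sqint_def)
  then show ?thesis by eventually_elim simp
qed

text \<open>Energy estimate for the difference y of two solutions whose drifts differ by a linear
  function of the differences, as they do for a common control. Since y vanishes at
  \<open>T\<close>, the product rule bounds E|y t|^2 by a multiple of its integral over [t,T]. Once
  y = 0 is known, only the squares of the z terms are left in the product rule, and they vanish
  too.\<close>

lemma backward_uniqueness:
  fixes A C1 C2 :: "real \<Rightarrow> real^'n^'n" and Y Y' Z1 Z1' Z2 Z2' c c' :: "real \<Rightarrow> 'a \<Rightarrow> real^'n"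
  assumes A: "A \<in> Linf T" and C1: "C1 \<in> Linf T" and C2: "C2 \<in> Linf T"
    and Y: "ito_process Y c Z1 Z2" and Y': "ito_process Y' c' Z1' Z2'"
    and c: "\<And>t \<omega>. dif c' c t \<omega> = A t *v dif Y' Y t \<omega> + C1 t *v dif Z1' Z1 t \<omega> + C2 t *v dif Z2' Z2 t \<omega>"
    and terminal: "AE \<omega> in M. Y' T \<omega> = Y T \<omega>"
  shows "AE \<omega> in M. Y' 0 \<omega> = Y 0 \<omega>" "AE x in P T. unc Y' x = unc Y x"
    "AE x in P T. unc Z1' x = unc Z1 x" "AE x in P T. unc Z2' x = unc Z2 x"
proof -
  obtain KA where KA: "0 \<le> KA" "\<And>t x. t \<in> {0..T} \<Longrightarrow> norm (A t *v x) \<le> KA * norm x"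
    by (rule Linf_mult_bound[OF A]) (rule that)
  obtain K1 where K1: "0 \<le> K1" "\<And>t x. t \<in> {0..T} \<Longrightarrow> norm (C1 t *v x) \<le> K1 * norm x"
    by (rule Linf_mult_bound[OF C1]) (rule that)
  obtain K2 where K2: "0 \<le> K2" "\<And>t x. t \<in> {0..T} \<Longrightarrow> norm (C2 t *v x) \<le> K2 * norm x"
    by (rule Linf_mult_bound[OF C2]) (rule that)
  note D = ito_processD[OF Y] ito_processD[OF Y']
  \<comment> \<open>The term with A contributes \<open>2 * KA\<close>; the squares
    \<open>K1\<^sup>2\<close> and \<open>K2\<^sup>2\<close> are the price for absorbing the cross
    terms with C1 and C2.\<close>
  define L where "L = 2 * KA + K1\<^sup>2 + K2\<^sup>2"
  let ?y = "dif Y' Y" and ?z1 = "dif Z1' Z1" and ?z2 = "dif Z2' Z2"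
  have Ly: "L2ad ?y" "L2ad ?z1" "L2ad ?z2" by (intro L2ad_diff D)+
  have sy: "sqint M (?y t)" if "t \<in> {0..T}" for t
    by (intro sqint_diff D(5,10) that)
  define g where "g t = (\<integral>\<omega>. (norm (?y t \<omega>))\<^sup>2 \<partial>M)" for t
  define f where "f = prod_density ?y (dif c' c) ?z1 ?z2 ?y (dif c' c) ?z1 ?z2"
  have fi: "integrable (P t) f" if "t \<le> T" for t
    unfolding f_def by (intro integrable_prod_density L2ad_diff D that)
  have rule: "g t = g 0 + (\<integral>x. f x \<partial>P t)" if "t \<in> {0..T}" for t
    unfolding g_def f_def power2_norm_eq_inner by (rule product_rule_diff[OF Y Y' Y Y' that])
  have gT: "g T = 0"
  proof -
    have "g T = (\<integral>\<omega>. 0 \<partial>M)"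
      unfolding g_def using sqint_integrable[OF sy[of T]] T_pos terminal
      by (intro integral_cong_AE) (auto elim!: eventually_mono)
    then show ?thesis by simp
  qed
  \<comment> \<open>Young's inequality from (K |a| - |d|)^2 \<ge> 0. The coefficient 1 of |d|^2 is
    chosen so that the |z|^2 in the product rule covers it exactly.\<close>
  have young: "2 * (a \<bullet> b) \<ge> - (K\<^sup>2 * (norm a)\<^sup>2) - (norm d)\<^sup>2"
    if "norm b \<le> K * norm d" for a b d :: "real^'n" and K
  proof -
    have "\<bar>a \<bullet> b\<bar> \<le> norm a * norm b" by (rule Cauchy_Schwarz_ineq2)
    also have "\<dots> \<le> norm a * (K * norm d)" using that by (intro mult_left_mono) auto
    finally have "\<bar>a \<bullet> b\<bar> \<le> norm a * (K * norm d)" .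
    moreover have "0 \<le> (K * norm a - norm d)\<^sup>2" by simp
    then have "2 * (norm a * (K * norm d)) \<le> K\<^sup>2 * (norm a)\<^sup>2 + (norm d)\<^sup>2"
      by (simp add: power2_diff power_mult_distrib algebra_simps)
    ultimately show ?thesis by linarith
  qed
  have flow: "- (L * (norm (unc ?y x))\<^sup>2) \<le> f x" if x: "x \<in> space (P T)" for x
  proof -
    let ?s = "fst x" and ?w = "snd x"
    have s: "?s \<in> {0..T}" using x by (auto simp: space_P)
    have "f x = 2 * (unc ?y x \<bullet> (A ?s *v unc ?y x)) + 2 * (unc ?y x \<bullet> (C1 ?s *v unc ?z1 x))
        + 2 * (unc ?y x \<bullet> (C2 ?s *v unc ?z2 x)) + (norm (unc ?z1 x))\<^sup>2 + (norm (unc ?z2 x))\<^sup>2"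
      unfolding f_def prod_density_def c power2_norm_eq_inner
      by (simp add: inner_add_left inner_add_right inner_commute)
    moreover have "- (KA * (norm (unc ?y x))\<^sup>2) \<le> unc ?y x \<bullet> (A ?s *v unc ?y x)"
    proof -
      have "\<bar>unc ?y x \<bullet> (A ?s *v unc ?y x)\<bar> \<le> norm (unc ?y x) * norm (A ?s *v unc ?y x)"
        by (rule Cauchy_Schwarz_ineq2)
      also have "\<dots> \<le> norm (unc ?y x) * (KA * norm (unc ?y x))"
        by (intro mult_left_mono KA(2) s) auto
      finally show ?thesis by (simp add: power2_eq_square algebra_simps)
    qed
    moreover have "2 * (unc ?y x \<bullet> (C1 ?s *v unc ?z1 x)) \<ge> - (K1\<^sup>2 * (norm (unc ?y x))\<^sup>2) - (norm (unc ?z1 x))\<^sup>2"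
      by (rule young[OF K1(2)[OF s]])
    moreover have "2 * (unc ?y x \<bullet> (C2 ?s *v unc ?z2 x)) \<ge> - (K2\<^sup>2 * (norm (unc ?y x))\<^sup>2) - (norm (unc ?z2 x))\<^sup>2"
      by (rule young[OF K2(2)[OF s]])
    ultimately show ?thesis unfolding L_def by (simp add: algebra_simps)
  qed
  have yi: "integrable (P T) (\<lambda>x. (norm (unc ?y x))\<^sup>2)"
    by (rule sqint_integrable[OF L2ad_sqint[OF Ly(1) order_refl]])
  have gi: "set_integrable lborel {0..T} g"
    using P_integrable_omega[OF yi] by (simp add: g_def[abs_def])
  have L0: "0 \<le> L" using KA(1) by (simp add: L_def)
  have gbound: "g t \<le> L * (LINT s:{t..T}|lborel. g s)" if t: "t \<in> {0..T}" for t
  proof -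
    have tT: "t \<le> T" using t by simp
    \<comment> \<open>The product rule at \<open>t\<close> minus the one at \<open>T\<close>: what
      remains is minus the integral of \<open>f\<close> over (t,T].\<close>
    have "g t = (\<integral>x. f x \<partial>P t) - (\<integral>x. f x \<partial>P T)"
      using rule[OF t] rule[of T] gT T_pos by simp
    also have "\<dots> = (\<integral>x. indicator ({0..t} \<times> space M) x *\<^sub>R f x - f x \<partial>P T)"
      unfolding integral_P_mono[OF tT]
    proof (rule Bochner_Integration.integral_diff[symmetric])
      have "{0..t} \<times> space M \<in> sets (P T)"
        using P_region_sub[of t T] tT by (simp add: space_P Times_Int_Times min_def)
      then show "integrable (P T) (\<lambda>x. indicator ({0..t} \<times> space M) x *\<^sub>R f x)"
        by (rule integrable_mult_indicator[OF _ fi[OF order_refl]])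
    qed (rule fi[OF order_refl])
    also have "\<dots> \<le> (\<integral>x. L * (indicator {t..T} (fst x) * (norm (unc ?y x))\<^sup>2) \<partial>P T)"
    proof (rule integral_mono)
      have "{0..t} \<times> space M \<in> sets (P T)"
        using P_region_sub[of t T] tT by (simp add: space_P Times_Int_Times min_def)
      then show "integrable (P T) (\<lambda>x. indicator ({0..t} \<times> space M) x *\<^sub>R f x - f x)"
        by (intro Bochner_Integration.integrable_diff integrable_mult_indicator fi) auto
      show "integrable (P T) (\<lambda>x. L * (indicator {t..T} (fst x) * (norm (unc ?y x))\<^sup>2))"
      proof (intro integrable_mult_right Bochner_Integration.integrable_bound[OF yi])
        show "(\<lambda>x. indicat_real {t..T} (fst x) * (norm (unc ?y x))\<^sup>2) \<in> borel_measurable (P T)"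
          using yi by (intro borel_measurable_times measurable_compose[OF measurable_P_fst]) auto
      qed (auto simp: indicator_def)
      fix x assume x: "x \<in> space (P T)"
      show "indicator ({0..t} \<times> space M) x *\<^sub>R f x - f x \<le> L * (indicator {t..T} (fst x) * (norm (unc ?y x))\<^sup>2)"
        using flow[OF x] x L0 by (cases x) (auto simp: space_P indicator_def)
    qed
    also have "\<dots> = L * (LINT s:{0..T}|lborel. indicator {t..T} s * g s)"
    proof -
      have "integrable (P T) (\<lambda>x. indicat_real {t..T} (fst x) * (norm (unc ?y x))\<^sup>2)"
      proof (rule Bochner_Integration.integrable_bound[OF yi])
        show "(\<lambda>x. indicat_real {t..T} (fst x) * (norm (unc ?y x))\<^sup>2) \<in> borel_measurable (P T)"
          using yi by (intro borel_measurable_times measurable_compose[OF measurable_P_fst]) auto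
      qed (auto simp: indicator_def)
      from P_integral_omega[OF this] show ?thesis by (simp add: g_def)
    qed
    also have "(LINT s:{0..T}|lborel. indicator {t..T} s * g s) = (LINT s:{t..T}|lborel. g s)"
      unfolding set_lebesgue_integral_def using t
      by (intro Bochner_Integration.integral_cong refl) (auto simp: indicator_def)
    finally show ?thesis .
  qed
  \<comment> \<open>The inequality itself supplies the a priori bound, once the integral is enlarged
    to [0,T].\<close>
  obtain C where C: "\<And>t. t \<in> {0..T} \<Longrightarrow> g t \<le> C"
  proof
    fix t assume t: "t \<in> {0..T}"
    have "g t \<le> L * (LINT s:{t..T}|lborel. g s)" by (rule gbound[OF t])
    also have "\<dots> \<le> L * (LINT s:{0..T}|lborel. g s)"
    proof (rule mult_left_mono[OF _ L0])
      have "{t..T} \<subseteq> {0..T}" using t by auto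
      with gi show "(LINT s:{t..T}|lborel. g s) \<le> (LINT s:{0..T}|lborel. g s)"
        unfolding set_lebesgue_integral_def
        by (intro integral_mono set_integrable_subset[unfolded set_integrable_def, of lborel "{0..T}" g "{t..T}"])
          (auto simp: set_integrable_def indicator_def g_def)
    qed
    finally show "g t \<le> L * (LINT s:{0..T}|lborel. g s)" .
  qed
  have g0: "g t = 0" if "t \<in> {0..T}" for t
    by (rule backward_Gronwall[OF gi _ C L0 gbound that]) (simp_all add: g_def)
  have z: "0 \<in> {0..T}" using T_pos by simp
  have "AE \<omega> in M. ?y 0 \<omega> = 0"
    using g0[OF z] by (intro AE_zero_of_integral_norm_zero sy z) (simp add: g_def)
  then show "AE \<omega> in M. Y' 0 \<omega> = Y 0 \<omega>" by eventually_elim simp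
  have "(\<integral>x. (norm (unc ?y x))\<^sup>2 \<partial>P T) = (LINT s:{0..T}|lborel. g s)"
    using P_integral_omega[OF yi] by (simp add: g_def)
  also have "\<dots> = (LINT s:{0..T}|lborel. 0)"
    by (rule set_lebesgue_integral_cong) (auto simp: g0)
  finally have "AE x in P T. unc ?y x = 0"
    by (intro AE_zero_of_integral_norm_zero L2ad_sqint[OF Ly(1)]) (auto simp: set_lebesgue_integral_def)
  then show "AE x in P T. unc Y' x = unc Y x" by eventually_elim simp
  note zi = sqint_integrable[OF L2ad_sqint[OF Ly(2) order_refl]] sqint_integrable[OF L2ad_sqint[OF Ly(3) order_refl]]
  \<comment> \<open>With y = 0 almost everywhere the cross terms in the density drop out; since
    \<open>g\<close> vanishes at 0 and \<open>T\<close>, the integral of the remaining squares is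
    zero.\<close>
  have "(\<integral>x. f x \<partial>P T) = (\<integral>x. (norm (unc ?z1 x))\<^sup>2 + (norm (unc ?z2 x))\<^sup>2 \<partial>P T)"
  proof (rule integral_cong_AE)
    show "AE x in P T. f x = (norm (unc ?z1 x))\<^sup>2 + (norm (unc ?z2 x))\<^sup>2"
      using \<open>AE x in P T. unc ?y x = 0\<close>
      by eventually_elim (simp add: f_def prod_density_def power2_norm_eq_inner)
  qed (use fi[of T] zi in auto)
  then have "(\<integral>x. (norm (unc ?z1 x))\<^sup>2 \<partial>P T) + (\<integral>x. (norm (unc ?z2 x))\<^sup>2 \<partial>P T) = 0"
    using rule[of T] gT g0[OF z] T_pos zi by simp
  moreover have "0 \<le> (\<integral>x. (norm (unc ?z1 x))\<^sup>2 \<partial>P T)" "0 \<le> (\<integral>x. (norm (unc ?z2 x))\<^sup>2 \<partial>P T)"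
    by simp_all
  ultimately have "(\<integral>x. (norm (unc ?z1 x))\<^sup>2 \<partial>P T) = 0" "(\<integral>x. (norm (unc ?z2 x))\<^sup>2 \<partial>P T) = 0"
    by linarith+
  then have "AE x in P T. unc ?z1 x = 0" "AE x in P T. unc ?z2 x = 0"
    using AE_zero_of_integral_norm_zero[OF L2ad_sqint[OF Ly(2) order_refl]]
      AE_zero_of_integral_norm_zero[OF L2ad_sqint[OF Ly(3) order_refl]] by auto
  then show "AE x in P T. unc Z1' x = unc Z1 x" "AE x in P T. unc Z2' x = unc Z2 x"
    by (auto elim!: eventually_mono)
qed

section \<open>The cost functional\<close>

definition cost_density :: "(real \<Rightarrow> real^'n^'n) \<Rightarrow> (real \<Rightarrow> real^'m^'m) \<Rightarrow> (real \<Rightarrow> real^'n^'n) \<Rightarrow>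
    (real \<Rightarrow> real^'n^'n) \<Rightarrow> (real \<Rightarrow> 'a \<Rightarrow> real^'m) \<Rightarrow> (real \<Rightarrow> 'a \<Rightarrow> real^'n) \<Rightarrow> (real \<Rightarrow> 'a \<Rightarrow> real^'n) \<Rightarrow>
    (real \<Rightarrow> 'a \<Rightarrow> real^'n) \<Rightarrow> real \<times> 'a \<Rightarrow> real" where
  "cost_density H R N1 N2 v Y Z1 Z2 x =
     unc Y x \<bullet> (H (fst x) *v unc Y x) + unc v x \<bullet> (R (fst x) *v unc v x) +
     unc Z1 x \<bullet> (N1 (fst x) *v unc Z1 x) + unc Z2 x \<bullet> (N2 (fst x) *v unc Z2 x)"

lemma integrable_form:
  fixes H :: "real \<Rightarrow> real^'n^'m"
  assumes "H \<in> Linf T" "L2ad u" "L2ad w" "t \<le> T"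
  shows "integrable (P t) (\<lambda>x. unc u x \<bullet> (H (fst x) *v unc w x))"
  using sqint_inner_integrable[OF L2ad_sqint[OF assms(2,4)] L2ad_sqint[OF L2ad_mult[OF assms(1,3)] assms(4)]] .

lemma integrable_cost_density:
  assumes "H \<in> Linf T" "R \<in> Linf T" "N1 \<in> Linf T" "N2 \<in> Linf T" "L2ad v" "L2ad Y" "L2ad Z1" "L2ad Z2"
  shows "integrable (P T) (cost_density H R N1 N2 v Y Z1 Z2)"
  unfolding cost_density_def[abs_def]
  by (intro Bochner_Integration.integrable_add integrable_form assms order_refl)

lemma cost_eq:
  assumes H: "H \<in> Linf T" "R \<in> Linf T" "N1 \<in> Linf T" "N2 \<in> Linf T"
    and L: "L2ad v" "L2ad Y" "L2ad Z1" "L2ad Z2" and Y0: "sqint M (Y 0)"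
  shows "cost M T H R N1 N2 G v Y Z1 Z2
    = 1/2 * ((\<integral>\<omega>. Y 0 \<omega> \<bullet> (G *v Y 0 \<omega>) \<partial>M) + (\<integral>x. cost_density H R N1 N2 v Y Z1 Z2 x \<partial>P T))"
proof -
  note i = integrable_cost_density[OF H L]
  show ?thesis
    unfolding cost_def P_integral_time[OF i]
    using P_integrable_time[OF i] sqint_inner_integrable[OF Y0 sqint_matrix_mult[OF Y0, of G]]
    by (simp add: cost_density_def)
qed

lemma is_state_ito_process:
  assumes A: "A \<in> Linf T" "B \<in> Linf T" "C1 \<in> Linf T" "C2 \<in> Linf T" and v: "v \<in> Vad M T W1"
    and S: "is_state M T W1 W2 A B C1 C2 \<zeta> v Y Z1 Z2"
  shows "ito_process Y (\<lambda>t \<omega>. A t *v Y t \<omega> + B t *v v t \<omega> + C1 t *v Z1 t \<omega> + C2 t *v Z2 t \<omega>) Z1 Z2"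
    and "AE \<omega> in M. Y T \<omega> = \<zeta> \<omega>"
proof -
  have *: "Y \<in> S2_proc M F T" "Z1 \<in> L2_proc M F T" "Z2 \<in> L2_proc M F T"
    "ito_differential M F T W1 W2 Y
        (\<lambda>t \<omega>. A t *v Y t \<omega> + B t *v v t \<omega> + C1 t *v Z1 t \<omega> + C2 t *v Z2 t \<omega>) Z1 Z2"
    "AE \<omega> in M. Y T \<omega> = \<zeta> \<omega>"
    using S by (simp_all add: is_state_def Let_def)
  note L = S2_proc_L2ad[OF *(1)] L2_proc_L2ad[OF *(2)] L2_proc_L2ad[OF *(3)] Vad_L2ad[OF v]
  show "ito_process Y (\<lambda>t \<omega>. A t *v Y t \<omega> + B t *v v t \<omega> + C1 t *v Z1 t \<omega> + C2 t *v Z2 t \<omega>) Z1 Z2"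
    unfolding ito_process_def by (intro conjI *(1,4) L L2ad_add L2ad_mult A)
  show "AE \<omega> in M. Y T \<omega> = \<zeta> \<omega>" by (rule *(5))
qed

text \<open>For a common control the terms with \<open>B\<close> cancel in the difference of the
  drifts, so the two states agree almost everywhere on \<open>P T\<close> and almost surely at time
  0, which is all that the cost sees. This leaves a single candidate for the \<open>THE\<close> in
  \<open>J\<close>.\<close>

lemma cost_unique:
  assumes A: "A \<in> Linf T" "B \<in> Linf T" "C1 \<in> Linf T" "C2 \<in> Linf T" and v: "v \<in> Vad M T W1"
    and H: "H \<in> Linf T" "R \<in> Linf T" "N1 \<in> Linf T" "N2 \<in> Linf T"
    and S: "is_state M T W1 W2 A B C1 C2 \<zeta> v Y Z1 Z2" and S': "is_state M T W1 W2 A B C1 C2 \<zeta> v Y' Z1' Z2'"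
  shows "cost M T H R N1 N2 G v Y' Z1' Z2' = cost M T H R N1 N2 G v Y Z1 Z2"
proof -
  note I = is_state_ito_process[OF A v S] and I' = is_state_ito_process[OF A v S']
  note D = ito_processD[OF I(1)] and D' = ito_processD[OF I'(1)]
  have z: "0 \<in> {0..T}" using T_pos by simp
  have T_end: "AE \<omega> in M. Y' T \<omega> = Y T \<omega>"
    using I(2) I'(2) by eventually_elim simp
  have "(A t *v Y' t \<omega> + B t *v v t \<omega> + C1 t *v Z1' t \<omega> + C2 t *v Z2' t \<omega>)
      - (A t *v Y t \<omega> + B t *v v t \<omega> + C1 t *v Z1 t \<omega> + C2 t *v Z2 t \<omega>)
      = A t *v dif Y' Y t \<omega> + C1 t *v dif Z1' Z1 t \<omega> + C2 t *v dif Z2' Z2 t \<omega>" for t \<omega>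
    by (simp add: matrix_vector_mult_diff_distrib)
  note uniq = backward_uniqueness[OF A(1,3,4) I(1) I'(1) this T_end]
  have "(\<integral>\<omega>. Y' 0 \<omega> \<bullet> (G *v Y' 0 \<omega>) \<partial>M) = (\<integral>\<omega>. Y 0 \<omega> \<bullet> (G *v Y 0 \<omega>) \<partial>M)"
  proof (rule integral_cong_AE)
    show "AE \<omega> in M. Y' 0 \<omega> \<bullet> (G *v Y' 0 \<omega>) = Y 0 \<omega> \<bullet> (G *v Y 0 \<omega>)"
      using uniq(1) by eventually_elim simp
  qed (intro borel_measurable_integrable sqint_inner_integrable sqint_matrix_mult D(5) D'(5) z)+
  moreover have "(\<integral>x. cost_density H R N1 N2 v Y' Z1' Z2' x \<partial>P T) = (\<integral>x. cost_density H R N1 N2 v Y Z1 Z2 x \<partial>P T)"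
  proof (rule integral_cong_AE)
    show "AE x in P T. cost_density H R N1 N2 v Y' Z1' Z2' x = cost_density H R N1 N2 v Y Z1 Z2 x"
      using uniq(2,3,4) by eventually_elim (simp add: cost_density_def)
  qed (intro borel_measurable_integrable integrable_cost_density H Vad_L2ad[OF v] D(1,3,4) D'(1,3,4))+
  ultimately show ?thesis
    by (simp add: cost_eq[OF H Vad_L2ad[OF v] D(1,3,4) D(5)[OF z]] cost_eq[OF H Vad_L2ad[OF v] D'(1,3,4) D'(5)[OF z]])
qed

lemma J_eq_cost:
  assumes "A \<in> Linf T" "B \<in> Linf T" "C1 \<in> Linf T" "C2 \<in> Linf T" "v \<in> Vad M T W1"
    "H \<in> Linf T" "R \<in> Linf T" "N1 \<in> Linf T" "N2 \<in> Linf T"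
    and S: "is_state M T W1 W2 A B C1 C2 \<zeta> v Y Z1 Z2"
  shows "J M T W1 W2 A B C1 C2 H R N1 N2 G \<zeta> v = ereal (cost M T H R N1 N2 G v Y Z1 Z2)"
proof -
  have "(THE c. \<exists>Y Z1 Z2. is_state M T W1 W2 A B C1 C2 \<zeta> v Y Z1 Z2 \<and> c = cost M T H R N1 N2 G v Y Z1 Z2)
      = cost M T H R N1 N2 G v Y Z1 Z2"
    using S cost_unique[OF assms(1-9) S] by (intro the_equality) blast+
  with S show ?thesis unfolding J_def by auto
qed

section \<open>Optimality\<close>

lemma sqint_component:
  fixes f :: "'a \<Rightarrow> real^'m"
  assumes "sqint M f"
  shows "sqint M (\<lambda>\<omega>. f \<omega> $ i)"
proof (rule sqint_mono[OF _ assms, of _ 1])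
  show "(\<lambda>\<omega>. f \<omega> $ i) \<in> borel_measurable M"
    by (rule measurable_compose[OF sqint_measurable[OF assms] borel_measurable_continuous_onI])
      (intro continuous_intros)
  show "AE \<omega> in M. norm (f \<omega> $ i) \<le> norm (1 * norm (f \<omega>))"
    by (rule AE_I2) (simp add: component_le_norm_cart)
qed

text \<open>Since \<open>cond_exp_vec\<close> acts coordinate by coordinate, the defining property
  of the real conditional expectation is applied to each product of coordinates of \<open>q\<close>
  and \<open>w\<close>, with \<open>w\<close> measurable for \<open>G\<close>.\<close>

lemma integral_inner_cond_exp_zero:
  fixes q w :: "'a \<Rightarrow> real^'m"
  assumes sub: "subalgebra M G" and q: "sqint M q" and w: "sqint M w" "w \<in> borel_measurable G"
    and zero: "AE \<omega> in M. cond_exp_vec M G q \<omega> = 0"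
  shows "(\<integral>\<omega>. q \<omega> \<bullet> w \<omega> \<partial>M) = 0"
proof -
  have "finite_measure_subalgebra M G"
    using sub by (simp add: finite_measure_subalgebra_def finite_measure_subalgebra_axioms_def finite_measure_axioms)
  then interpret sigma_finite_subalgebra M G
    by (rule finite_measure_subalgebra_is_sigma_finite)
  have comp: "(\<integral>\<omega>. q \<omega> $ i * w \<omega> $ i \<partial>M) = 0" "integrable M (\<lambda>\<omega>. q \<omega> $ i * w \<omega> $ i)" for i
  proof -
    note sq = sqint_component[OF q, of i] and sw = sqint_component[OF w(1), of i]
    have wG: "(\<lambda>\<omega>. w \<omega> $ i) \<in> borel_measurable G"
      by (rule measurable_compose[OF w(2) borel_measurable_continuous_onI]) (intro continuous_intros)
    have int: "integrable M (\<lambda>\<omega>. w \<omega> $ i * q \<omega> $ i)"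
      using sqint_inner_integrable[OF sw sq] by simp
    show "integrable M (\<lambda>\<omega>. q \<omega> $ i * w \<omega> $ i)"
      using int by (simp add: mult.commute)
    have "(\<integral>\<omega>. w \<omega> $ i * q \<omega> $ i \<partial>M) = (\<integral>\<omega>. w \<omega> $ i * real_cond_exp M G (\<lambda>\<omega>. q \<omega> $ i) \<omega> \<partial>M)"
      by (rule real_cond_exp_intg(2)[symmetric, OF int wG sqint_measurable[OF sq]])
    also have "\<dots> = (\<integral>\<omega>. 0 \<partial>M)"
    proof (rule integral_cong_AE)
      show "AE \<omega> in M. w \<omega> $ i * real_cond_exp M G (\<lambda>\<omega>. q \<omega> $ i) \<omega> = 0"
        using zero
      proof eventually_elim
        case (elim \<omega>)
        then have "cond_exp_vec M G q \<omega> $ i = 0" by simp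
        then show ?case by (simp add: cond_exp_vec_def)
      qed
    qed (use real_cond_exp_intg(1)[OF int wG sqint_measurable[OF sq]] in auto)
    finally show "(\<integral>\<omega>. q \<omega> $ i * w \<omega> $ i \<partial>M) = 0" by (simp add: mult.commute)
  qed
  have "(\<integral>\<omega>. q \<omega> \<bullet> w \<omega> \<partial>M) = (\<Sum>i\<in>UNIV. \<integral>\<omega>. q \<omega> $ i * w \<omega> $ i \<partial>M)"
    unfolding inner_vec_def using comp(2) by (subst Bochner_Integration.integral_sum[symmetric]) auto
  then show ?thesis using comp(1) by simp
qed

text \<open>The stationarity condition is given for almost every time only, and so is square
  integrability of the sections; with time outside in Fubini the exceptional times form a null
  set.\<close>

lemma first_order_condition:
  fixes q w :: "real \<Rightarrow> 'a \<Rightarrow> real^'m"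
  assumes q: "L2ad q" and w: "L2ad w"
    and wG: "\<And>t. t \<in> {0..T} \<Longrightarrow> w t \<in> borel_measurable (natural_filtration M {W1} t)"
    and zero: "AE t in lborel. t \<in> {0..T} \<longrightarrow>
      (AE \<omega> in M. cond_exp_vec M (natural_filtration M {W1} t) (q t) \<omega> = 0)"
  shows "(\<integral>x. unc q x \<bullet> unc w x \<partial>P T) = 0"
proof -
  note sq = L2ad_sqint[OF q order_refl] and sw = L2ad_sqint[OF w order_refl]
  note i = sqint_inner_integrable[OF sq sw]
  have "(\<integral>x. unc q x \<bullet> unc w x \<partial>P T) = (LINT t:{0..T}|lborel. (\<integral>\<omega>. q t \<omega> \<bullet> w t \<omega> \<partial>M))"
    using P_integral_omega[OF i] by simp
  also have "\<dots> = (\<integral>(t::real). 0 \<partial>lborel)"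
    unfolding set_lebesgue_integral_def
  proof (rule integral_cong_AE)
    show "AE t in lborel. indicator {0..T} t *\<^sub>R (\<integral>\<omega>. q t \<omega> \<bullet> w t \<omega> \<partial>M) = 0"
      using zero P_AE_integrable_omega[OF sqint_integrable[OF sq]] P_AE_integrable_omega[OF sqint_integrable[OF sw]]
    proof eventually_elim
      case (elim t)
      show ?case
      proof (cases "t \<in> {0..T}")
        case True
        have sub: "subalgebra M (natural_filtration M {W1} t)"
          using sets_natural_subset[OF True, of "{W1}"] by (simp add: subalgebra_def space_natural)
        have "sqint M (q t)" "sqint M (w t)"
          using elim True L2ad_measurable[OF q True] L2ad_measurable[OF w True] by (auto simp: sqint_def)
        from integral_inner_cond_exp_zero[OF sub this wG[OF True]] elim True show ?thesis by simp
      qed simp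
    qed
  qed (use P_integrable_omega[OF i] in \<open>auto simp: set_integrable_def\<close>)
  finally show ?thesis by simp
qed

text \<open>Exact second-order expansion at \<open>y\<close> with a nonnegative remainder: the
  tangent inequality of a convex quadratic form. Symmetry of \<open>S\<close> merges the two mixed
  terms.\<close>

lemma psd_quadratic_lower_bound:
  fixes S :: "real^'n^'n"
  assumes "psd S"
  shows "y \<bullet> (S *v y) + 2 * (y \<bullet> (S *v (y' - y))) \<le> y' \<bullet> (S *v y')"
proof -
  have "y' \<bullet> (S *v y) = y \<bullet> (S *v y')"
    using inner_transpose_mult[of S y' y, unfolded conjunct1[OF assms[unfolded psd_def]]]
    by (simp add: inner_commute)
  then have "y' \<bullet> (S *v y') = y \<bullet> (S *v y) + 2 * (y \<bullet> (S *v (y' - y))) + (y' - y) \<bullet> (S *v (y' - y))"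
    by (simp add: matrix_vector_mult_diff_distrib inner_diff_left inner_diff_right)
  moreover have "0 \<le> (y' - y) \<bullet> (S *v (y' - y))"
    using assms unfolding psd_def by blast
  ultimately show ?thesis by linarith
qed

lemma Linf_upd_psd:
  assumes "R \<in> Linf_upd T" "t \<in> {0..T}"
  shows "psd (R t)"
proof -
  obtain \<delta> where d: "\<delta> > 0" "psd (R t - mat \<delta>)" and R: "transpose (R t) = R t"
    using assms by (auto simp: Linf_upd_def)
  have "0 \<le> x \<bullet> (R t *v x)" for x
  proof -
    have "mat \<delta> *v x = \<delta> *\<^sub>R x"
      by (simp add: vec_eq_iff matrix_vector_mult_def mat_def if_distrib[of "\<lambda>a. a * _"] cong: if_cong)
    then have "x \<bullet> ((R t - mat \<delta>) *v x) = x \<bullet> (R t *v x) - \<delta> * (x \<bullet> x)"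
      by (simp only: matrix_vector_mult_diff_rdistrib inner_diff_right inner_scaleR_right)
    moreover have "0 \<le> x \<bullet> ((R t - mat \<delta>) *v x)"
      using d(2) unfolding psd_def by blast
    moreover have "0 \<le> \<delta> * (x \<bullet> x)" using d(1) by simp
    ultimately show ?thesis by linarith
  qed
  with R show ?thesis by (simp add: psd_def)
qed

lemma Linf_transpose:
  fixes E :: "real \<Rightarrow> real^'p^'q"
  assumes "E \<in> Linf T"
  shows "(\<lambda>t. transpose (E t)) \<in> Linf T"
proof -
  have "linear (transpose :: real^'p^'q \<Rightarrow> real^'q^'p)"
    by (rule linearI) (simp_all add: transpose_def vec_eq_iff)
  then have bl: "bounded_linear (transpose :: real^'p^'q \<Rightarrow> real^'q^'p)"
    by (simp add: linear_conv_bounded_linear)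
  obtain c where c: "0 < c" "\<And>S :: real^'p^'q. norm (transpose S) \<le> norm S * c"
    using bounded_linear.pos_bounded[OF bl] by blast
  obtain K where K: "0 \<le> K" "\<And>t. t \<in> {0..T} \<Longrightarrow> norm (E t) \<le> K"
    by (rule Linf_bound[OF assms]) (rule that)
  have "(\<lambda>t. transpose (E t)) \<in> borel_measurable (restrict_space borel {0..T})"
    using assms by (intro measurable_compose[OF _ borel_measurable_continuous_onI[OF linear_continuous_on[OF bl]]])
      (simp add: Linf_def)
  moreover have "norm (transpose (E t)) \<le> K * c" if "t \<in> {0..T}" for t
    using c(2)[of "E t"] mult_right_mono[OF K(2)[OF that], of c] c(1) by linarith
  ultimately show ?thesis unfolding Linf_def by blast
qed

lemma cost_minimal:
  fixes A C1 C2 H N1 N2 :: "real \<Rightarrow> real^'n^'n" and B :: "real \<Rightarrow> real^'m^'n" and R :: "real \<Rightarrow> real^'m^'m"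
    and X Y Z1 Z2 Y' Z1' Z2' :: "real \<Rightarrow> 'a \<Rightarrow> real^'n" and v v' :: "real \<Rightarrow> 'a \<Rightarrow> real^'m"
  assumes A: "A \<in> Linf T" "B \<in> Linf T" "C1 \<in> Linf T" "C2 \<in> Linf T"
    and H: "H \<in> Linf_psd T" "N1 \<in> Linf_psd T" "N2 \<in> Linf_psd T" and R: "R \<in> Linf_upd T" and G: "psd G"
    and X: "X \<in> S2_proc M F T"
      "ito_differential M F T W1 W2 X (\<lambda>t \<omega>. - (transpose (A t) *v X t \<omega> + H t *v Y t \<omega>))
        (\<lambda>t \<omega>. - (transpose (C1 t) *v X t \<omega> + N1 t *v Z1 t \<omega>))
        (\<lambda>t \<omega>. - (transpose (C2 t) *v X t \<omega> + N2 t *v Z2 t \<omega>))"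
    and X0: "AE \<omega> in M. X 0 \<omega> = - (G *v Y 0 \<omega>)"
    and stat: "AE t in lborel. t \<in> {0..T} \<longrightarrow>
        (AE \<omega> in M. cond_exp_vec M (natural_filtration M {W1} t)
           (\<lambda>\<omega>'. R t *v v t \<omega>' + transpose (B t) *v X t \<omega>') \<omega> = 0)"
    and v: "v \<in> Vad M T W1" "v' \<in> Vad M T W1"
    and S: "is_state M T W1 W2 A B C1 C2 \<zeta> v Y Z1 Z2" and S': "is_state M T W1 W2 A B C1 C2 \<zeta> v' Y' Z1' Z2'"
  shows "cost M T H R N1 N2 G v Y Z1 Z2 \<le> cost M T H R N1 N2 G v' Y' Z1' Z2'"
proof -
  have HL: "H \<in> Linf T" "R \<in> Linf T" "N1 \<in> Linf T" "N2 \<in> Linf T"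
    using H R by (auto simp: Linf_psd_def Linf_upd_def)
  have z: "0 \<in> {0..T}" and e: "T \<in> {0..T}" using T_pos by auto
  note I = is_state_ito_process[OF A v(1) S] and I' = is_state_ito_process[OF A v(2) S']
  note D = ito_processD[OF I(1)] and D' = ito_processD[OF I'(1)]
  note Lv = Vad_L2ad[OF v(1)] Vad_L2ad[OF v(2)] and LX = S2_proc_L2ad[OF X(1)]
  have IX: "ito_process X (\<lambda>t \<omega>. - (transpose (A t) *v X t \<omega> + H t *v Y t \<omega>))
        (\<lambda>t \<omega>. - (transpose (C1 t) *v X t \<omega> + N1 t *v Z1 t \<omega>))
        (\<lambda>t \<omega>. - (transpose (C2 t) *v X t \<omega> + N2 t *v Z2 t \<omega>))"
    unfolding ito_process_def
    by (intro conjI X L2ad_uminus L2ad_add L2ad_mult Linf_transpose A HL LX D(1,3,4))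
  let ?y = "dif Y' Y" and ?z1 = "dif Z1' Z1" and ?z2 = "dif Z2' Z2" and ?w = "dif v' v"
  have Ly: "L2ad ?y" "L2ad ?z1" "L2ad ?z2" "L2ad ?w"
    by (intro L2ad_diff D(1,3,4) D'(1,3,4) Lv)+
  \<comment> \<open>Together with the integral of \<open>?c\<close> this is the derivative of the
    cost at \<open>v\<close> in the direction \<open>v' - v\<close>; the factor 1/2 of the cost has
    cancelled the 2 of each quadratic form.\<close>
  let ?G = "\<integral>\<omega>. Y 0 \<omega> \<bullet> (G *v ?y 0 \<omega>) \<partial>M"
  let ?c = "\<lambda>x. unc Y x \<bullet> (H (fst x) *v unc ?y x) + unc v x \<bullet> (R (fst x) *v unc ?w x)
    + unc Z1 x \<bullet> (N1 (fst x) *v unc ?z1 x) + unc Z2 x \<bullet> (N2 (fst x) *v unc ?z2 x)"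
  \<comment> \<open>The control gradient of the Hamiltonian, whose conditional expectation vanishes
    by stationarity.\<close>
  let ?q = "\<lambda>t \<omega>. R t *v v t \<omega> + transpose (B t) *v X t \<omega>"
  have ci: "integrable (P T) ?c"
    by (intro Bochner_Integration.integrable_add integrable_form HL D(1,3,4) Lv Ly order_refl)
  have pd: "psd (H t)" "psd (R t)" "psd (N1 t)" "psd (N2 t)" if "t \<in> {0..T}" for t
    using H Linf_upd_psd[OF R that] that by (auto simp: Linf_psd_def)
  have first_order: "?G + (\<integral>x. ?c x \<partial>P T) = 0"
  proof -
    have Lq: "L2ad ?q" by (intro L2ad_add L2ad_mult HL Linf_transpose A Lv LX)
    have qi: "integrable (P T) (\<lambda>x. unc ?q x \<bullet> unc ?w x)"
      by (intro sqint_inner_integrable L2ad_sqint Lq Ly order_refl)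
    have "(\<integral>\<omega>. X T \<omega> \<bullet> ?y T \<omega> \<partial>M) = (\<integral>\<omega>. 0 \<partial>M)"
    proof (rule integral_cong_AE)
      show "AE \<omega> in M. X T \<omega> \<bullet> ?y T \<omega> = 0"
        using I(2) I'(2) by eventually_elim simp
    qed (intro borel_measurable_integrable sqint_inner_integrable sqint_diff S2_proc_sqint[OF X(1)] D(5) D'(5) e, simp)
    \<comment> \<open>Symmetry of \<open>G\<close> moves it onto the difference of the states, which
      turns the boundary term at 0 into minus \<open>?G\<close>.\<close>
    moreover have "(\<integral>\<omega>. X 0 \<omega> \<bullet> ?y 0 \<omega> \<partial>M) = (\<integral>\<omega>. - (Y 0 \<omega> \<bullet> (G *v ?y 0 \<omega>)) \<partial>M)"
    proof (rule integral_cong_AE)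
      show "AE \<omega> in M. X 0 \<omega> \<bullet> ?y 0 \<omega> = - (Y 0 \<omega> \<bullet> (G *v ?y 0 \<omega>))"
        using X0
      proof eventually_elim
        case (elim \<omega>)
        then show ?case
          using inner_transpose_mult[of G "Y 0 \<omega>" "?y 0 \<omega>", unfolded conjunct1[OF G[unfolded psd_def]]] by simp
      qed
      show "(\<lambda>\<omega>. X 0 \<omega> \<bullet> ?y 0 \<omega>) \<in> borel_measurable M"
        by (intro borel_measurable_integrable sqint_inner_integrable sqint_diff S2_proc_sqint[OF X(1)] D(5) D'(5) z)
      show "(\<lambda>\<omega>. - (Y 0 \<omega> \<bullet> (G *v ?y 0 \<omega>))) \<in> borel_measurable M"
        by (intro borel_measurable_uminus borel_measurable_integrable sqint_inner_integrable sqint_matrix_mult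
            sqint_diff D(5) D'(5) z)
    qed
    \<comment> \<open>The terms with A, C1 and C2 cancel against their transposes in the adjoint
      equation. What is left of the control is X \<bullet> B w with w = v' - v; adding and
      subtracting v \<bullet> R w completes it to \<open>?q\<close> and \<open>?c\<close>.\<close>
    moreover have "(\<integral>x. prod_density X (\<lambda>t \<omega>. - (transpose (A t) *v X t \<omega> + H t *v Y t \<omega>))
        (\<lambda>t \<omega>. - (transpose (C1 t) *v X t \<omega> + N1 t *v Z1 t \<omega>))
        (\<lambda>t \<omega>. - (transpose (C2 t) *v X t \<omega> + N2 t *v Z2 t \<omega>)) ?y
        (dif (\<lambda>t \<omega>. A t *v Y' t \<omega> + B t *v v' t \<omega> + C1 t *v Z1' t \<omega> + C2 t *v Z2' t \<omega>)
          (\<lambda>t \<omega>. A t *v Y t \<omega> + B t *v v t \<omega> + C1 t *v Z1 t \<omega> + C2 t *v Z2 t \<omega>)) ?z1 ?z2 x \<partial>P T)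
        = (\<integral>x. unc ?q x \<bullet> unc ?w x - ?c x \<partial>P T)"
    proof (intro Bochner_Integration.integral_cong refl)
      fix x assume "x \<in> space (P T)"
      then have t: "fst x \<in> {0..T}" by (auto simp: space_P)
      have sym: "(E *v a) \<bullet> b = a \<bullet> (E *v b)" if "psd E" for E :: "real^'k^'k" and a b
        by (rule inner_transpose_mult[of E a b, unfolded conjunct1[OF that[unfolded psd_def]]])
      show "prod_density X (\<lambda>t \<omega>. - (transpose (A t) *v X t \<omega> + H t *v Y t \<omega>))
        (\<lambda>t \<omega>. - (transpose (C1 t) *v X t \<omega> + N1 t *v Z1 t \<omega>))
        (\<lambda>t \<omega>. - (transpose (C2 t) *v X t \<omega> + N2 t *v Z2 t \<omega>)) ?y
        (dif (\<lambda>t \<omega>. A t *v Y' t \<omega> + B t *v v' t \<omega> + C1 t *v Z1' t \<omega> + C2 t *v Z2' t \<omega>)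
          (\<lambda>t \<omega>. A t *v Y t \<omega> + B t *v v t \<omega> + C1 t *v Z1 t \<omega> + C2 t *v Z2 t \<omega>)) ?z1 ?z2 x
        = unc ?q x \<bullet> unc ?w x - ?c x"
        unfolding prod_density_def
        by (simp only: inner_minus_left inner_add_left inner_transpose_mult sym[OF pd(1)[OF t]]
            sym[OF pd(2)[OF t]] sym[OF pd(3)[OF t]] sym[OF pd(4)[OF t]])
          (simp add: matrix_vector_mult_diff_distrib inner_diff_right inner_add_right)
    qed
    moreover have "(\<integral>x. unc ?q x \<bullet> unc ?w x - ?c x \<partial>P T) = (\<integral>x. unc ?q x \<bullet> unc ?w x \<partial>P T) - (\<integral>x. ?c x \<partial>P T)"
      by (rule Bochner_Integration.integral_diff[OF qi ci])
    moreover have "(\<integral>x. unc ?q x \<bullet> unc ?w x \<partial>P T) = 0"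
    proof (rule first_order_condition[OF Lq Ly(4) _ stat])
      show "?w t \<in> borel_measurable (natural_filtration M {W1} t)" if "t \<in> {0..T}" for t
        using v that by (intro borel_measurable_diff) (auto simp: Vad_def L2_proc_def adapted_def)
    qed
    ultimately show ?thesis
      using product_rule_diff_right[OF IX I(1) I'(1) e] by simp
  qed
  note i0 = sqint_inner_integrable[OF D(5)[OF z] sqint_matrix_mult[OF D(5)[OF z], of G]]
    sqint_inner_integrable[OF D(5)[OF z] sqint_matrix_mult[OF sqint_diff[OF D'(5)[OF z] D(5)[OF z]], of G]]
    sqint_inner_integrable[OF D'(5)[OF z] sqint_matrix_mult[OF D'(5)[OF z], of G]]
  have "(\<integral>\<omega>. Y 0 \<omega> \<bullet> (G *v Y 0 \<omega>) + 2 * (Y 0 \<omega> \<bullet> (G *v ?y 0 \<omega>)) \<partial>M) \<le> (\<integral>\<omega>. Y' 0 \<omega> \<bullet> (G *v Y' 0 \<omega>) \<partial>M)"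
  proof (rule integral_mono)
    fix \<omega>
    show "Y 0 \<omega> \<bullet> (G *v Y 0 \<omega>) + 2 * (Y 0 \<omega> \<bullet> (G *v ?y 0 \<omega>)) \<le> Y' 0 \<omega> \<bullet> (G *v Y' 0 \<omega>)"
      by (rule psd_quadratic_lower_bound[OF G])
  qed (use i0 in auto)
  then have 1: "(\<integral>\<omega>. Y 0 \<omega> \<bullet> (G *v Y 0 \<omega>) \<partial>M) + 2 * ?G \<le> (\<integral>\<omega>. Y' 0 \<omega> \<bullet> (G *v Y' 0 \<omega>) \<partial>M)"
    using i0 by simp
  note di = integrable_cost_density[OF HL Lv(1) D(1,3,4)] integrable_cost_density[OF HL Lv(2) D'(1,3,4)]
  have "(\<integral>x. cost_density H R N1 N2 v Y Z1 Z2 x + 2 * ?c x \<partial>P T) \<le> (\<integral>x. cost_density H R N1 N2 v' Y' Z1' Z2' x \<partial>P T)"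
  proof (rule integral_mono)
    fix x assume "x \<in> space (P T)"
    then have t: "fst x \<in> {0..T}" by (auto simp: space_P)
    show "cost_density H R N1 N2 v Y Z1 Z2 x + 2 * ?c x \<le> cost_density H R N1 N2 v' Y' Z1' Z2' x"
      using psd_quadratic_lower_bound[OF pd(1)[OF t], of "unc Y x" "unc Y' x"]
        psd_quadratic_lower_bound[OF pd(2)[OF t], of "unc v x" "unc v' x"]
        psd_quadratic_lower_bound[OF pd(3)[OF t], of "unc Z1 x" "unc Z1' x"]
        psd_quadratic_lower_bound[OF pd(4)[OF t], of "unc Z2 x" "unc Z2' x"]
      unfolding cost_density_def by simp
  qed (intro Bochner_Integration.integrable_add integrable_mult_right di ci)+
  then have 2: "(\<integral>x. cost_density H R N1 N2 v Y Z1 Z2 x \<partial>P T) + 2 * (\<integral>x. ?c x \<partial>P T)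
      \<le> (\<integral>x. cost_density H R N1 N2 v' Y' Z1' Z2' x \<partial>P T)"
    unfolding Bochner_Integration.integral_add[OF di(1) integrable_mult_right[OF ci]] integral_mult_right_zero .
  \<comment> \<open>Here \<open>a\<close> and \<open>d\<close> stand for the initial and the running
    cost, \<open>g\<close> and \<open>k\<close> for the two parts of the derivative, whose sum is
    zero.\<close>
  have arith: "1/2 * (a + d) \<le> 1/2 * (a' + d')" if "a + 2 * g \<le> a'" "d + 2 * k \<le> d'" "g + k = 0"
    for a a' d d' g k :: real
    using that by simp
  show ?thesis
    unfolding cost_eq[OF HL Lv(1) D(1,3,4) D(5)[OF z]] cost_eq[OF HL Lv(2) D'(1,3,4) D'(5)[OF z]]
    by (rule arith[OF 1 2 first_order])
qed

end

theorem theorem2p2: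
  fixes M :: "'a measure" and T :: real
    and W1 W2 :: "real \<Rightarrow> 'a \<Rightarrow> real"
    and A C1 C2 H N1 N2 :: "real \<Rightarrow> real^'n^'n"
    and B :: "real \<Rightarrow> real^'m^'n"
    and R :: "real \<Rightarrow> real^'m^'m"
    and G :: "real^'n^'n"
    and \<zeta> :: "'a \<Rightarrow> real^'n"
    and X Y Z1 Z2 :: "real \<Rightarrow> 'a \<Rightarrow> real^'n"
    and v :: "real \<Rightarrow> 'a \<Rightarrow> real^'m"
  assumes "T > 0"
    and "prob_space M" and "complete_measure M"
    and "wiener_process2 M T W1 W2"
    and "A \<in> Linf T" and "C1 \<in> Linf T" and "C2 \<in> Linf T" and "B \<in> Linf T"
    and "H \<in> Linf_psd T" and "N1 \<in> Linf_psd T" and "N2 \<in> Linf_psd T"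
    and "R \<in> Linf_upd T" and "psd G"
    and "\<zeta> \<in> L2_rv M (augmented_filtration M {W1, W2} T)"
    and "hamiltonian_solution M T W1 W2 A B C1 C2 H R N1 N2 G \<zeta> X Y Z1 Z2 v"
  shows "optimal_control M T W1 W2 A B C1 C2 H R N1 N2 G \<zeta> v"
proof -
  interpret prob_space M by (rule assms(2))
  interpret wiener M T W1 W2
    by unfold_locales (rule assms(1,4))+
  note A = assms(5,8,6,7)
  have HL: "H \<in> Linf T" "R \<in> Linf T" "N1 \<in> Linf T" "N2 \<in> Linf T"
    using assms(9-12) by (auto simp: Linf_psd_def Linf_upd_def)
  have hs: "X \<in> S2_proc M F T" "v \<in> Vad M T W1"
      "ito_differential M F T W1 W2 X (\<lambda>t \<omega>. - (transpose (A t) *v X t \<omega> + H t *v Y t \<omega>))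
        (\<lambda>t \<omega>. - (transpose (C1 t) *v X t \<omega> + N1 t *v Z1 t \<omega>))
        (\<lambda>t \<omega>. - (transpose (C2 t) *v X t \<omega> + N2 t *v Z2 t \<omega>))"
      "AE \<omega> in M. X 0 \<omega> = - (G *v Y 0 \<omega>)"
      "AE t in lborel. t \<in> {0..T} \<longrightarrow>
        (AE \<omega> in M. cond_exp_vec M (natural_filtration M {W1} t)
           (\<lambda>\<omega>'. R t *v v t \<omega>' + transpose (B t) *v X t \<omega>') \<omega> = 0)"
      "is_state M T W1 W2 A B C1 C2 \<zeta> v Y Z1 Z2"
    using assms(15) unfolding hamiltonian_solution_def is_state_def Let_def by blast+
  \<comment> \<open>The Hamiltonian system contains the state equation, so \<open>v\<close> has the
    state \<open>Y\<close>, \<open>Z1\<close>, \<open>Z2\<close> and its cost is a real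
    number.\<close>
  note Jv = J_eq_cost[OF A hs(2) HL hs(6), where G = G]
  have "J M T W1 W2 A B C1 C2 H R N1 N2 G \<zeta> v \<le> J M T W1 W2 A B C1 C2 H R N1 N2 G \<zeta> u"
    if u: "u \<in> Vad M T W1" for u
  proof (cases "\<exists>Y' Z1' Z2'. is_state M T W1 W2 A B C1 C2 \<zeta> u Y' Z1' Z2'")
    case True
    then obtain Y' Z1' Z2' where S: "is_state M T W1 W2 A B C1 C2 \<zeta> u Y' Z1' Z2'" by blast
    have "cost M T H R N1 N2 G v Y Z1 Z2 \<le> cost M T H R N1 N2 G u Y' Z1' Z2'"
      by (rule cost_minimal[OF A assms(9-13) hs(1,3,4,5,2) u hs(6) S])
    then show ?thesis unfolding Jv J_eq_cost[OF A u HL S, where G = G] by simp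
  next
    \<comment> \<open>Without a state, \<open>J\<close> takes its default value \<infinity> at
      \<open>u\<close>, an upper bound for every cost.\<close>
    case False
    then show ?thesis by (simp add: J_def)
  qed
  then have "J M T W1 W2 A B C1 C2 H R N1 N2 G \<zeta> v = (INF u\<in>Vad M T W1. J M T W1 W2 A B C1 C2 H R N1 N2 G \<zeta> u)"
    using hs(2) by (intro antisym INF_greatest INF_lower)
  with hs(2) show ?thesis by (simp add: optimal_control_def)
qed

end
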